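(* Let $E=T(V)/(R)$ be a Koszul Frobenius algebra over $\mathbb C$ and let $\theta\colon R\to\mathbb C$ be a Clifford map of $E$. Let $\widetilde E$, $\widetilde\theta$ be the trivial extension of $E$ and the induced Clifford map, and let $\widetilde{\widetilde E}$, $\widetilde{\widetilde\theta}$ be obtained by applying the same construction to $(\widetilde E,\widetilde\theta)$. Then there is an equivalence of abelian categories $$\mathrm{gr}_{\mathbb Z_2}\,\widetilde{\widetilde E}(\widetilde{\widetilde\theta})\cong\mathrm{gr}_{\mathbb Z_2}E(\theta).$$
   Context: The base field is $\Bbbk=\mathbb C$. A Koszul Frobenius algebra is a finite dimensional Koszul algebra $E=T(V)/(R)$ ($V$ finite dimensional, $R\subseteq V\otimes V$) that is graded Frobenius, i.e. $E\cong E^*(l)$ as right graded $E$-modules for some $l\in\mathbb Z$. A Clifford map of $E$ is a linear map $\theta\colon R\to\Bbbk$ with $(\theta\otimes1-1\otimes\theta)(V\otimes R\cap R\otimes V)=0$; the Clifford deformation is $E(\theta)=T(V)/(r-\theta(r):r\in R)$, which is $\mathbb Z_2$-graded with even (resp. odd) part the image of the even (resp. odd) tensor powers of $V$. Trivial extension: let $\epsilon$ be the automorphism of $E$ with $\epsilon(x)=(-1)^{|x|}x$ for homogeneous $x$, and let ${}_\epsilon E$ be the graded bimodule $E$ with left action twisted by $\epsilon$. Then $\widetilde E=E\oplus{}_\epsilon E(-1)$ with multiplication $(x_1,m)(x_2,n)=(x_1x_2,x_1n+mx_2)$. It is a Koszul Frobenius algebra, presented as $\widetilde E=T(\widetilde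 V)/(\widetilde R)$ with $\widetilde V=V\oplus\Bbbk y$ and $\widetilde R=R\oplus\mathrm{span}\{x\otimes y+y\otimes x: x\in V\}\oplus\Bbbk\, y\otimes y$. Induced Clifford map: $\widetilde\theta\colon\widetilde R\to\Bbbk$ is given by $\widetilde\theta(r)=\theta(r)$ for $r\in R$, $\widetilde\theta(y\otimes y)=1$, $\widetilde\theta(x\otimes y+y\otimes x)=0$ for $x\in V$. It is a Clifford map of $\widetilde E$. $\mathrm{gr}_{\mathbb Z_2}B$ is the category of finitely generated right $\mathbb Z_2$-graded $B$-modules with degree $0$ morphisms. *)

theory Defs
  imports Complex_Main "HOL-Library.FuncSet" "HOL-Library.Poly_Mapping" "HOL-Library.Z2"
    "HOL-Algebra.QuotRing" "HOL-Algebra.Module"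
begin

section \<open>Additive and abelian categories\<close>

text \<open>The object arguments of \<open>Cmp X Y Z g f\<close> (the composite of \<open>f : X \<rightarrow> Y\<close> and
  \<open>g : Y \<rightarrow> Z\<close>) are explicit because different Hom sets are not required to be disjoint.\<close>

record ('o, 'f) precat =
  Ob :: "'o set"
  Hom :: "'o \<Rightarrow> 'o \<Rightarrow> 'f set"
  Cmp :: "'o \<Rightarrow> 'o \<Rightarrow> 'o \<Rightarrow> 'f \<Rightarrow> 'f \<Rightarrow> 'f"
  Idn :: "'o \<Rightarrow> 'f"
  HAdd :: "'o \<Rightarrow> 'o \<Rightarrow> 'f \<Rightarrow> 'f \<Rightarrow> 'f"
  HZero :: "'o \<Rightarrow> 'o \<Rightarrow> 'f"

definition category :: "('o, 'f) precat \<Rightarrow> bool" where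
  "category C \<longleftrightarrow>
    (\<forall>X\<in>Ob C. Idn C X \<in> Hom C X X) \<and>
    (\<forall>X\<in>Ob C. \<forall>Y\<in>Ob C. \<forall>Z\<in>Ob C. \<forall>f\<in>Hom C X Y. \<forall>g\<in>Hom C Y Z. Cmp C X Y Z g f \<in> Hom C X Z) \<and>
    (\<forall>X\<in>Ob C. \<forall>Y\<in>Ob C. \<forall>f\<in>Hom C X Y.
      Cmp C X X Y f (Idn C X) = f \<and> Cmp C X Y Y (Idn C Y) f = f) \<and>
    (\<forall>W\<in>Ob C. \<forall>X\<in>Ob C. \<forall>Y\<in>Ob C. \<forall>Z\<in>Ob C. \<forall>f\<in>Hom C W X. \<forall>g\<in>Hom C X Y. \<forall>h\<in>Hom C Y Z.
      Cmp C W Y Z h (Cmp C W X Y g f) = Cmp C W X Z (Cmp C X Y Z h g) f)"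

definition hom_group :: "('o, 'f) precat \<Rightarrow> 'o \<Rightarrow> 'o \<Rightarrow> 'f monoid" where
  "hom_group C X Y = \<lparr>carrier = Hom C X Y, mult = HAdd C X Y, one = HZero C X Y\<rparr>"

definition preadditive :: "('o, 'f) precat \<Rightarrow> bool" where
  "preadditive C \<longleftrightarrow> category C \<and>
    (\<forall>X\<in>Ob C. \<forall>Y\<in>Ob C. comm_group (hom_group C X Y)) \<and>
    (\<forall>X\<in>Ob C. \<forall>Y\<in>Ob C. \<forall>Z\<in>Ob C. \<forall>f\<in>Hom C X Y. \<forall>f'\<in>Hom C X Y. \<forall>g\<in>Hom C Y Z. \<forall>g'\<in>Hom C Y Z.
      Cmp C X Y Z g (HAdd C X Y f f') = HAdd C X Z (Cmp C X Y Z g f) (Cmp C X Y Z g f') \<and>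
      Cmp C X Y Z (HAdd C Y Z g g') f = HAdd C X Z (Cmp C X Y Z g f) (Cmp C X Y Z g' f))"

definition is_zero_object :: "('o, 'f) precat \<Rightarrow> 'o \<Rightarrow> bool" where
  "is_zero_object C Z \<longleftrightarrow>
    Z \<in> Ob C \<and> (\<forall>X\<in>Ob C. (\<exists>!f. f \<in> Hom C X Z) \<and> (\<exists>!f. f \<in> Hom C Z X))"

definition is_biproduct ::
    "('o, 'f) precat \<Rightarrow> 'o \<Rightarrow> 'o \<Rightarrow> 'o \<Rightarrow> 'f \<Rightarrow> 'f \<Rightarrow> 'f \<Rightarrow> 'f \<Rightarrow> bool" where
  "is_biproduct C X Y P i j p q \<longleftrightarrow>
    P \<in> Ob C \<and> i \<in> Hom C X P \<and> j \<in> Hom C Y P \<and> p \<in> Hom C P X \<and> q \<in> Hom C P Y \<and>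
    Cmp C X P X p i = Idn C X \<and> Cmp C Y P Y q j = Idn C Y \<and>
    Cmp C X P Y q i = HZero C X Y \<and> Cmp C Y P X p j = HZero C Y X \<and>
    HAdd C P P (Cmp C P X P i p) (Cmp C P Y P j q) = Idn C P"

definition is_kernel :: "('o, 'f) precat \<Rightarrow> 'o \<Rightarrow> 'o \<Rightarrow> 'f \<Rightarrow> 'o \<Rightarrow> 'f \<Rightarrow> bool" where
  "is_kernel C X Y f K k \<longleftrightarrow>
    K \<in> Ob C \<and> k \<in> Hom C K X \<and> Cmp C K X Y f k = HZero C K Y \<and>
    (\<forall>Z\<in>Ob C. \<forall>g\<in>Hom C Z X. Cmp C Z X Y f g = HZero C Z Y \<longrightarrow>
      (\<exists>!h. h \<in> Hom C Z K \<and> Cmp C Z K X k h = g))"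

definition is_cokernel :: "('o, 'f) precat \<Rightarrow> 'o \<Rightarrow> 'o \<Rightarrow> 'f \<Rightarrow> 'o \<Rightarrow> 'f \<Rightarrow> bool" where
  "is_cokernel C X Y f Q q \<longleftrightarrow>
    Q \<in> Ob C \<and> q \<in> Hom C Y Q \<and> Cmp C X Y Q q f = HZero C X Q \<and>
    (\<forall>Z\<in>Ob C. \<forall>g\<in>Hom C Y Z. Cmp C X Y Z g f = HZero C X Z \<longrightarrow>
      (\<exists>!h. h \<in> Hom C Q Z \<and> Cmp C Y Q Z h q = g))"

definition is_mono :: "('o, 'f) precat \<Rightarrow> 'o \<Rightarrow> 'o \<Rightarrow> 'f \<Rightarrow> bool" where
  "is_mono C X Y f \<longleftrightarrow> (\<forall>Z\<in>Ob C. \<forall>g\<in>Hom C Z X. \<forall>h\<in>Hom C Z X.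
    Cmp C Z X Y f g = Cmp C Z X Y f h \<longrightarrow> g = h)"

definition is_epi :: "('o, 'f) precat \<Rightarrow> 'o \<Rightarrow> 'o \<Rightarrow> 'f \<Rightarrow> bool" where
  "is_epi C X Y f \<longleftrightarrow> (\<forall>Z\<in>Ob C. \<forall>g\<in>Hom C Y Z. \<forall>h\<in>Hom C Y Z.
    Cmp C X Y Z g f = Cmp C X Y Z h f \<longrightarrow> g = h)"

definition abelian_category :: "('o, 'f) precat \<Rightarrow> bool" where
  "abelian_category C \<longleftrightarrow> preadditive C \<and>
    (\<exists>Z. is_zero_object C Z) \<and>
    (\<forall>X\<in>Ob C. \<forall>Y\<in>Ob C. \<exists>P i j p q. is_biproduct C X Y P i j p q) \<and>
    (\<forall>X\<in>Ob C. \<forall>Y\<in>Ob C. \<forall>f\<in>Hom C X Y.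
      (\<exists>K k. is_kernel C X Y f K k) \<and> (\<exists>Q q. is_cokernel C X Y f Q q)) \<and>
    (\<forall>X\<in>Ob C. \<forall>Y\<in>Ob C. \<forall>f\<in>Hom C X Y. is_mono C X Y f \<longrightarrow>
      (\<exists>Z\<in>Ob C. \<exists>g\<in>Hom C Y Z. is_kernel C Y Z g X f)) \<and>
    (\<forall>X\<in>Ob C. \<forall>Y\<in>Ob C. \<forall>f\<in>Hom C X Y. is_epi C X Y f \<longrightarrow>
      (\<exists>Z\<in>Ob C. \<exists>g\<in>Hom C Z X. is_cokernel C Z X g Y f))"

definition additive_functor ::
    "('o, 'f) precat \<Rightarrow> ('p, 'h) precat \<Rightarrow> ('o \<Rightarrow> 'p) \<Rightarrow> ('o \<Rightarrow> 'o \<Rightarrow> 'f \<Rightarrow> 'h) \<Rightarrow> bool" where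
  "additive_functor C D F Fm \<longleftrightarrow>
    (\<forall>X\<in>Ob C. F X \<in> Ob D \<and> Fm X X (Idn C X) = Idn D (F X)) \<and>
    (\<forall>X\<in>Ob C. \<forall>Y\<in>Ob C. \<forall>f\<in>Hom C X Y. Fm X Y f \<in> Hom D (F X) (F Y)) \<and>
    (\<forall>X\<in>Ob C. \<forall>Y\<in>Ob C. \<forall>Z\<in>Ob C. \<forall>f\<in>Hom C X Y. \<forall>g\<in>Hom C Y Z.
      Fm X Z (Cmp C X Y Z g f) = Cmp D (F X) (F Y) (F Z) (Fm Y Z g) (Fm X Y f)) \<and>
    (\<forall>X\<in>Ob C. \<forall>Y\<in>Ob C. \<forall>f\<in>Hom C X Y. \<forall>g\<in>Hom C X Y.
      Fm X Y (HAdd C X Y f g) = HAdd D (F X) (F Y) (Fm X Y f) (Fm X Y g))"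

definition is_iso :: "('o, 'f) precat \<Rightarrow> 'o \<Rightarrow> 'o \<Rightarrow> 'f \<Rightarrow> bool" where
  "is_iso C X Y f \<longleftrightarrow> f \<in> Hom C X Y \<and>
    (\<exists>g\<in>Hom C Y X. Cmp C X Y X g f = Idn C X \<and> Cmp C Y X Y f g = Idn C Y)"

definition natural_iso :: "('o, 'f) precat \<Rightarrow> ('p, 'h) precat \<Rightarrow>
    ('o \<Rightarrow> 'p) \<Rightarrow> ('o \<Rightarrow> 'o \<Rightarrow> 'f \<Rightarrow> 'h) \<Rightarrow> ('o \<Rightarrow> 'p) \<Rightarrow> ('o \<Rightarrow> 'o \<Rightarrow> 'f \<Rightarrow> 'h) \<Rightarrow> ('o \<Rightarrow> 'h) \<Rightarrow> bool" where
  "natural_iso C D F Fm G Gm \<eta> \<longleftrightarrow>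
    (\<forall>X\<in>Ob C. is_iso D (F X) (G X) (\<eta> X)) \<and>
    (\<forall>X\<in>Ob C. \<forall>Y\<in>Ob C. \<forall>f\<in>Hom C X Y.
      Cmp D (F X) (F Y) (G Y) (\<eta> Y) (Fm X Y f) = Cmp D (F X) (G X) (G Y) (Gm X Y f) (\<eta> X))"

definition abelian_equivalent :: "('o, 'f) precat \<Rightarrow> ('p, 'h) precat \<Rightarrow> bool" where
  "abelian_equivalent C D \<longleftrightarrow> abelian_category C \<and> abelian_category D \<and>
    (\<exists>F Fm G Gm \<eta> \<epsilon>. additive_functor C D F Fm \<and> additive_functor D C G Gm \<and>
      natural_iso C C (\<lambda>X. X) (\<lambda>X Y f. f) (\<lambda>X. G (F X)) (\<lambda>X Y f. Gm (F X) (F Y) (Fm X Y f)) \<eta> \<and>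
      natural_iso D D (\<lambda>X. F (G X)) (\<lambda>X Y f. Fm (G X) (G Y) (Gm X Y f)) (\<lambda>X. X) (\<lambda>X Y f. f) \<epsilon>)"

section \<open>Graded algebras and graded right modules\<close>

text \<open>
  The record serves both for \<open>'g\<close>-graded \<open>\<complex>\<close>-algebras (with \<open>'s = complex\<close>) and for \<open>'g\<close>-graded
  right modules over an algebra with elements of type \<open>'s\<close>. In the second case \<open>a \<odot> m\<close> denotes
  \<open>m \<cdot> a\<close>, and the fields \<open>mult\<close> and \<open>one\<close> inherited from the library's record are not used.
\<close>

record ('g, 's, 'x) graded = "('s, 'x) module" +
  homog :: "'g \<Rightarrow> 'x set"

locale graded_right_module = A?: ring A + M?: abelian_group M
  for A :: "('g::ab_group_add, complex, 'a) graded" (structure)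
    and M :: "('g, 'a, 'm) graded" (structure) +
  assumes act_closed: "\<lbrakk>a \<in> carrier A; m \<in> carrier M\<rbrakk> \<Longrightarrow> a \<odot>\<^bsub>M\<^esub> m \<in> carrier M"
    and act_add_left: "\<lbrakk>a \<in> carrier A; b \<in> carrier A; m \<in> carrier M\<rbrakk>
      \<Longrightarrow> (a \<oplus>\<^bsub>A\<^esub> b) \<odot>\<^bsub>M\<^esub> m = a \<odot>\<^bsub>M\<^esub> m \<oplus>\<^bsub>M\<^esub> b \<odot>\<^bsub>M\<^esub> m"
    and act_add_right: "\<lbrakk>a \<in> carrier A; m \<in> carrier M; n \<in> carrier M\<rbrakk>
      \<Longrightarrow> a \<odot>\<^bsub>M\<^esub> (m \<oplus>\<^bsub>M\<^esub> n) = a \<odot>\<^bsub>M\<^esub> m \<oplus>\<^bsub>M\<^esub> a \<odot>\<^bsub>M\<^esub> n"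
    and act_mult: "\<lbrakk>a \<in> carrier A; b \<in> carrier A; m \<in> carrier M\<rbrakk>
      \<Longrightarrow> (a \<otimes>\<^bsub>A\<^esub> b) \<odot>\<^bsub>M\<^esub> m = b \<odot>\<^bsub>M\<^esub> (a \<odot>\<^bsub>M\<^esub> m)"
    and act_one: "m \<in> carrier M \<Longrightarrow> \<one>\<^bsub>A\<^esub> \<odot>\<^bsub>M\<^esub> m = m"
    and homog_subgroup: "subgroup (homog M g) (add_monoid M)"
    and homog_decomposition: "m \<in> carrier M \<Longrightarrow>
      \<exists>!f. (\<forall>g. f g \<in> homog M g) \<and> finite {g. f g \<noteq> \<zero>\<^bsub>M\<^esub>} \<and>
        m = (\<Oplus>\<^bsub>M\<^esub>g\<in>{g. f g \<noteq> \<zero>\<^bsub>M\<^esub>}. f g)"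
    and homog_act: "\<lbrakk>a \<in> homog A g; m \<in> homog M h\<rbrakk> \<Longrightarrow> a \<odot>\<^bsub>M\<^esub> m \<in> homog M (h + g)"

definition finitely_generated_rmod ::
    "('g, complex, 'a) graded \<Rightarrow> ('g, 'a, 'm) graded \<Rightarrow> bool" where
  "finitely_generated_rmod A M \<longleftrightarrow> (\<exists>S. finite S \<and> S \<subseteq> carrier M \<and>
    (\<forall>m\<in>carrier M. \<exists>a\<in>S \<rightarrow> carrier A. m = (\<Oplus>\<^bsub>M\<^esub>s\<in>S. a s \<odot>\<^bsub>M\<^esub> s)))"

text \<open>Homomorphisms of degree \<open>0\<close>, as extensional functions so that equality of functions is
  equality of morphisms.\<close>

definition graded_hom :: "('g, complex, 'a) graded \<Rightarrow> ('g, 'a, 'm) graded \<Rightarrow> ('g, 'a, 'n) graded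
    \<Rightarrow> ('m \<Rightarrow> 'n) set" where
  "graded_hom A M N = {f \<in> carrier M \<rightarrow>\<^sub>E carrier N.
    (\<forall>m\<in>carrier M. \<forall>n\<in>carrier M. f (m \<oplus>\<^bsub>M\<^esub> n) = f m \<oplus>\<^bsub>N\<^esub> f n) \<and>
    (\<forall>a\<in>carrier A. \<forall>m\<in>carrier M. f (a \<odot>\<^bsub>M\<^esub> m) = a \<odot>\<^bsub>N\<^esub> f m) \<and>
    (\<forall>g. f ` homog M g \<subseteq> homog N g)}"

text \<open>The category of finitely generated graded right modules whose elements are taken from the
  type \<open>'u\<close>, which plays the role of a universe: a finitely generated module over an algebra of
  countable dimension has at most continuum many elements, so that every such module is isomorphic
  to an object if \<open>'u\<close> has at least the cardinality of \<open>\<complex>\<close>.\<close>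

definition gr_cat :: "('g::ab_group_add, complex, 'a) graded
    \<Rightarrow> (('g, 'a, 'u) graded, 'u \<Rightarrow> 'u) precat" where
  "gr_cat A = \<lparr>
    Ob = {M. graded_right_module A M \<and> finitely_generated_rmod A M},
    Hom = graded_hom A,
    Cmp = (\<lambda>L M N g f. compose (carrier L) g f),
    Idn = (\<lambda>M. \<lambda>m\<in>carrier M. m),
    HAdd = (\<lambda>M N f g. \<lambda>m\<in>carrier M. f m \<oplus>\<^bsub>N\<^esub> g m),
    HZero = (\<lambda>M N. \<lambda>m\<in>carrier M. \<zero>\<^bsub>N\<^esub>)\<rparr>"

definition shift_rmod :: "'g::ab_group_add \<Rightarrow> ('g, 'a, 'm) graded \<Rightarrow> ('g, 'a, 'm) graded" where
  "shift_rmod l M = M\<lparr>homog := \<lambda>g. homog M (g + l)\<rparr>"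

definition regular_rmod :: "('g, complex, 'a) graded \<Rightarrow> ('g, 'a, 'a) graded" where
  "regular_rmod A = \<lparr>carrier = carrier A, mult = undefined, one = undefined,
    zero = \<zero>\<^bsub>A\<^esub>, add = add A, smult = (\<lambda>a m. m \<otimes>\<^bsub>A\<^esub> a), homog = homog A\<rparr>"

text \<open>The free right module of rank \<open>b\<close> with basis in degree \<open>0\<close>, so that
  \<open>shift_rmod (- n) (free_rmod A b)\<close> is \<open>A(-n)\<^sup>b\<close>, with basis in degree \<open>n\<close>.\<close>

definition free_rmod :: "('g, complex, 'a) graded \<Rightarrow> nat \<Rightarrow> ('g, 'a, nat \<Rightarrow> 'a) graded" where
  "free_rmod A b = \<lparr>carrier = {..<b} \<rightarrow>\<^sub>E carrier A, mult = undefined, one = undefined,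
    zero = (\<lambda>i\<in>{..<b}. \<zero>\<^bsub>A\<^esub>), add = (\<lambda>m n. \<lambda>i\<in>{..<b}. m i \<oplus>\<^bsub>A\<^esub> n i),
    smult = (\<lambda>a m. \<lambda>i\<in>{..<b}. m i \<otimes>\<^bsub>A\<^esub> a), homog = (\<lambda>g. {..<b} \<rightarrow>\<^sub>E homog A g)\<rparr>"

definition finite_dimensional :: "('g, complex, 'a) graded \<Rightarrow> bool" where
  "finite_dimensional A \<longleftrightarrow> (\<exists>S. finite S \<and> S \<subseteq> carrier A \<and>
    (\<forall>x\<in>carrier A. \<exists>c. x = (\<Oplus>\<^bsub>A\<^esub>s\<in>S. c s \<odot>\<^bsub>A\<^esub> s)))"

text \<open>For a connected graded algebra \<open>A = \<complex> \<oplus> A\<^sub>1 \<oplus> A\<^sub>2 \<oplus> \<dots>\<close>: the ideal of elements of positive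
  degree, the augmentation \<open>A \<rightarrow> \<complex>\<close>, and the trivial module \<open>\<complex>\<close>.\<close>

definition positive_ideal :: "(int, complex, 'a) graded \<Rightarrow> 'a set" where
  "positive_ideal A = Idl\<^bsub>A\<^esub> (\<Union>n\<in>{0<..}. homog A n)"

definition augmentation :: "(int, complex, 'a) graded \<Rightarrow> 'a \<Rightarrow> complex" where
  "augmentation A a = (THE c. a \<ominus>\<^bsub>A\<^esub> (c \<odot>\<^bsub>A\<^esub> \<one>\<^bsub>A\<^esub>) \<in> positive_ideal A)"

definition trivial_rmod :: "(int, complex, 'a) graded \<Rightarrow> (int, 'a, complex) graded" where
  "trivial_rmod A = \<lparr>carrier = UNIV, mult = undefined, one = undefined, zero = 0, add = (+),
    smult = (\<lambda>a z. z * augmentation A a), homog = (\<lambda>n. if n = 0 then UNIV else {0})\<rparr>"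

text \<open>The trivial module has a linear free resolution
  \<open>\<dots> \<rightarrow> A(-2)\<^bsup>b 2\<^esup> \<rightarrow> A(-1)\<^bsup>b 1\<^esup> \<rightarrow> A\<^bsup>b 0\<^esup> \<rightarrow> \<complex> \<rightarrow> 0\<close>, the map \<open>d n\<close> going from the term with
  index \<open>n + 1\<close> to the term with index \<open>n\<close>. The terms may be taken of finite rank because the
  algebras considered are generated by finitely many elements of degree \<open>1\<close>.\<close>

definition koszul :: "(int, complex, 'a) graded \<Rightarrow> bool" where
  "koszul A \<longleftrightarrow> (\<exists>b d p. let P = (\<lambda>n. shift_rmod (- int n) (free_rmod A (b n))) in
    p \<in> graded_hom A (P 0) (trivial_rmod A) \<and>
    p ` carrier (P 0) = carrier (trivial_rmod A) \<and>
    (\<forall>n. d n \<in> graded_hom A (P (Suc n)) (P n)) \<and>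
    d 0 ` carrier (P 1) = {m \<in> carrier (P 0). p m = \<zero>\<^bsub>trivial_rmod A\<^esub>} \<and>
    (\<forall>n. d (Suc n) ` carrier (P (Suc (Suc n))) = {m \<in> carrier (P (Suc n)). d n m = \<zero>\<^bsub>P n\<^esub>}))"

text \<open>The dual \<open>A\<^sup>*\<close> of a finite dimensional graded algebra, with \<open>(\<phi> \<cdot> a)(x) = \<phi>(a x)\<close> and with
  \<open>(A\<^sup>*)\<^sub>n\<close> the dual of \<open>A\<^bsub>-n\<^esub>\<close>.\<close>

definition dual_rmod :: "(int, complex, 'a) graded \<Rightarrow> (int, 'a, 'a \<Rightarrow> complex) graded" where
  "dual_rmod A = (let D = {\<phi> \<in> extensional (carrier A).
      (\<forall>x\<in>carrier A. \<forall>y\<in>carrier A. \<phi> (x \<oplus>\<^bsub>A\<^esub> y) = \<phi> x + \<phi> y) \<and>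
      (\<forall>c. \<forall>x\<in>carrier A. \<phi> (c \<odot>\<^bsub>A\<^esub> x) = c * \<phi> x)} in
    \<lparr>carrier = D, mult = undefined, one = undefined,
     zero = (\<lambda>x\<in>carrier A. 0), add = (\<lambda>\<phi> \<psi>. \<lambda>x\<in>carrier A. \<phi> x + \<psi> x),
     smult = (\<lambda>a \<phi>. \<lambda>x\<in>carrier A. \<phi> (a \<otimes>\<^bsub>A\<^esub> x)),
     homog = (\<lambda>n. {\<phi> \<in> D. \<forall>k. k \<noteq> - n \<longrightarrow> (\<forall>x\<in>homog A k. \<phi> x = 0)})\<rparr>)"

definition graded_frobenius :: "(int, complex, 'a) graded \<Rightarrow> bool" where
  "graded_frobenius A \<longleftrightarrow> (\<exists>l. \<exists>f\<in>graded_hom A (regular_rmod A) (shift_rmod l (dual_rmod A)).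
    bij_betw f (carrier (regular_rmod A)) (carrier (shift_rmod l (dual_rmod A))))"

section \<open>Tensor algebras, quadratic algebras and Clifford deformations\<close>

datatype 'x word = Word (letters: "'x list")

instantiation word :: (type) monoid_add
begin

definition zero_word :: "'a word" where
  "0 = Word []"

definition plus_word :: "'a word \<Rightarrow> 'a word \<Rightarrow> 'a word" where
  "u + v = Word (letters u @ letters v)"

instance
  by standard (simp_all add: zero_word_def plus_word_def)

end

text \<open>
  A finite dimensional vector space \<open>V\<close> is given by a finite basis \<open>X\<close> (possibly empty), and
  \<open>T(V)\<close> is the free algebra on \<open>X\<close>: the elements of the monoid ring of the monoid of words
  that are supported on words with letters in \<open>X\<close>. The multiplication is concatenation, that is
  the tensor product.
\<close>

type_synonym 'x tensors = "'x word \<Rightarrow>\<^sub>0 complex"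

definition scal :: "complex \<Rightarrow> 'x tensors \<Rightarrow> 'x tensors" where
  "scal c p = Poly_Mapping.single 0 c * p"

definition gen :: "'x \<Rightarrow> 'x tensors" where
  "gen x = Poly_Mapping.single (Word [x]) 1"

definition tensor_power :: "'x set \<Rightarrow> nat \<Rightarrow> 'x tensors set" where
  "tensor_power X n = {p. \<forall>w\<in>Poly_Mapping.keys p. set (letters w) \<subseteq> X \<and> length (letters w) = n}"

text \<open>The grading type \<open>'g\<close> is \<open>int\<close> for the length grading of \<open>T(V)\<close> and \<open>bit\<close> for the induced
  \<open>\<int>\<^sub>2\<close>-grading.\<close>

definition tensor_algebra :: "'x set \<Rightarrow> ('g::semiring_1, complex, 'x tensors) graded" where
  "tensor_algebra X = \<lparr>carrier = {p. \<forall>w\<in>Poly_Mapping.keys p. set (letters w) \<subseteq> X},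
    mult = (*), one = 1, zero = 0, add = (+), smult = scal,
    homog = (\<lambda>g. {p. \<forall>w\<in>Poly_Mapping.keys p.
      set (letters w) \<subseteq> X \<and> of_nat (length (letters w)) = g})\<rparr>"

definition quotient_algebra ::
    "('g, complex, 'a) graded \<Rightarrow> 'a set \<Rightarrow> ('g, complex, 'a set) graded" where
  "quotient_algebra A I = \<lparr>carrier = carrier (A Quot I), mult = mult (A Quot I),
    one = one (A Quot I), zero = zero (A Quot I), add = add (A Quot I),
    smult = (\<lambda>c S. \<Union>s\<in>S. I +>\<^bsub>A\<^esub> (c \<odot>\<^bsub>A\<^esub> s)),
    homog = (\<lambda>g. (\<lambda>x. I +>\<^bsub>A\<^esub> x) ` homog A g)\<rparr>"

definition quadratic_data :: "'x set \<Rightarrow> 'x tensors set \<Rightarrow> bool" where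
  "quadratic_data X R \<longleftrightarrow> finite X \<and> R \<subseteq> tensor_power X 2 \<and>
    0 \<in> R \<and> (\<forall>r\<in>R. \<forall>s\<in>R. r + s \<in> R) \<and> (\<forall>c. \<forall>r\<in>R. scal c r \<in> R)"

definition quadratic_algebra ::
    "'x set \<Rightarrow> 'x tensors set \<Rightarrow> (int, complex, 'x tensors set) graded" where
  "quadratic_algebra X R = (let T = tensor_algebra X in quotient_algebra T (Idl\<^bsub>T\<^esub> R))"

definition koszul_frobenius :: "'x set \<Rightarrow> 'x tensors set \<Rightarrow> bool" where
  "koszul_frobenius X R \<longleftrightarrow> quadratic_data X R \<and>
    finite_dimensional (quadratic_algebra X R) \<and>
    koszul (quadratic_algebra X R) \<and>
    graded_frobenius (quadratic_algebra X R)"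

text \<open>An element of \<open>V \<otimes> R \<inter> R \<otimes> V\<close> is written both as \<open>\<Sum> v \<otimes> r\<close> and as \<open>\<Sum> s \<otimes> w\<close>; its images
  under \<open>1 \<otimes> \<theta>\<close> and \<open>\<theta> \<otimes> 1\<close> are \<open>\<Sum> \<theta>(r) v\<close> and \<open>\<Sum> \<theta>(s) w\<close>. Only the values of \<open>\<theta>\<close> on \<open>R\<close>
  matter.\<close>

definition clifford_map :: "'x set \<Rightarrow> 'x tensors set \<Rightarrow> ('x tensors \<Rightarrow> complex) \<Rightarrow> bool" where
  "clifford_map X R \<theta> \<longleftrightarrow>
    (\<forall>r\<in>R. \<forall>s\<in>R. \<theta> (r + s) = \<theta> r + \<theta> s) \<and> (\<forall>c. \<forall>r\<in>R. \<theta> (scal c r) = c * \<theta> r) \<and>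
    (\<forall>ps qs. set ps \<subseteq> tensor_power X 1 \<times> R \<longrightarrow> set qs \<subseteq> R \<times> tensor_power X 1 \<longrightarrow>
      (\<Sum>(v, r)\<leftarrow>ps. v * r) = (\<Sum>(s, w)\<leftarrow>qs. s * w) \<longrightarrow>
      (\<Sum>(s, w)\<leftarrow>qs. scal (\<theta> s) w) - (\<Sum>(v, r)\<leftarrow>ps. scal (\<theta> r) v) = 0)"

definition clifford_deformation :: "'x set \<Rightarrow> 'x tensors set \<Rightarrow> ('x tensors \<Rightarrow> complex)
    \<Rightarrow> (bit, complex, 'x tensors set) graded" where
  "clifford_deformation X R \<theta> = (let T = tensor_algebra X in
    quotient_algebra T (Idl\<^bsub>T\<^esub> ((\<lambda>r. r - scal (\<theta> r) 1) ` R)))"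

section \<open>The trivial extension and the induced Clifford map\<close>

text \<open>\<open>A \<oplus> \<epsilon>A(-1)\<close>, where \<open>\<epsilon>\<close> is multiplication by \<open>(-1)\<^sup>n\<close> in degree \<open>n\<close>: on
  \<open>\<epsilon>A\<close> the left action of \<open>x\<close> is left multiplication by \<open>\<epsilon>(x)\<close>.\<close>

definition sign_automorphism :: "(int, complex, 'a) graded \<Rightarrow> 'a \<Rightarrow> 'a" where
  "sign_automorphism A = (THE e. e \<in> carrier A \<rightarrow>\<^sub>E carrier A \<and>
    (\<forall>x\<in>carrier A. \<forall>y\<in>carrier A. e (x \<oplus>\<^bsub>A\<^esub> y) = e x \<oplus>\<^bsub>A\<^esub> e y) \<and>
    (\<forall>n. \<forall>x\<in>homog A n. e x = (if even n then x else \<ominus>\<^bsub>A\<^esub> x)))"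

definition trivial_extension :: "(int, complex, 'a) graded \<Rightarrow> (int, complex, 'a \<times> 'a) graded" where
  "trivial_extension A = \<lparr>carrier = carrier A \<times> carrier A,
    mult = (\<lambda>(x, m) (x', n).
      (x \<otimes>\<^bsub>A\<^esub> x', (sign_automorphism A x \<otimes>\<^bsub>A\<^esub> n) \<oplus>\<^bsub>A\<^esub> (m \<otimes>\<^bsub>A\<^esub> x'))),
    one = (\<one>\<^bsub>A\<^esub>, \<zero>\<^bsub>A\<^esub>), zero = (\<zero>\<^bsub>A\<^esub>, \<zero>\<^bsub>A\<^esub>),
    add = (\<lambda>(x, m) (x', n). (x \<oplus>\<^bsub>A\<^esub> x', m \<oplus>\<^bsub>A\<^esub> n)),
    smult = (\<lambda>c (x, m). (c \<odot>\<^bsub>A\<^esub> x, c \<odot>\<^bsub>A\<^esub> m)),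
    homog = (\<lambda>k. homog A k \<times> homog A (k - 1))\<rparr>"

text \<open>
  The trivial extension of \<open>T(V)/(R)\<close> is presented by generators and relations: the basis of
  \<open>V \<oplus> \<complex>y\<close> consists of the \<open>Some x\<close> with \<open>x \<in> X\<close> and of \<open>y = None\<close>, the map \<open>emb\<close> is the
  inclusion \<open>T(V) \<rightarrow> T(V \<oplus> \<complex>y)\<close>, and the relations are the elements
  \<open>r + (v y + y v) + c y y\<close> with \<open>r \<in> R\<close>, \<open>v \<in> V\<close> and \<open>c \<in> \<complex>\<close>. That this presents
  \<open>trivial_extension (quadratic_algebra X R)\<close> is lemma \<open>trivial_extension_presentation\<close> below.
\<close>

definition ext_basis :: "'x set \<Rightarrow> 'x option set" where
  "ext_basis X = insert None (Some ` X)"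

definition emb :: "'x tensors \<Rightarrow> 'x option tensors" where
  "emb p = (\<Sum>w\<in>Poly_Mapping.keys p.
    Poly_Mapping.single (map_word Some w) (Poly_Mapping.lookup p w))"

abbreviation y_gen :: "'x option tensors" where
  "y_gen \<equiv> gen None"

definition ext_elem ::
    "'x tensors \<Rightarrow> 'x tensors \<Rightarrow> complex \<Rightarrow> 'x option tensors" where
  "ext_elem r v c = emb r + (emb v * y_gen + y_gen * emb v) + scal c (y_gen * y_gen)"

definition ext_rel :: "'x set \<Rightarrow> 'x tensors set \<Rightarrow> 'x option tensors set" where
  "ext_rel X R = {ext_elem r v c | r v c. r \<in> R \<and> v \<in> tensor_power X 1}"

text \<open>\<open>r\<close> and \<open>c\<close> are determined by the element \<open>ext_elem r v c\<close>; see \<open>ext_map_ext_elem\<close> and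
  \<open>ext_map_values\<close>.\<close>

definition ext_map :: "'x set \<Rightarrow> 'x tensors set \<Rightarrow> ('x tensors \<Rightarrow> complex)
    \<Rightarrow> 'x option tensors \<Rightarrow> complex" where
  "ext_map X R \<theta> p = (THE t. \<exists>r\<in>R. \<exists>v\<in>tensor_power X 1. \<exists>c. p = ext_elem r v c \<and> t = \<theta> r + c)"

section \<open>Auxiliary facts\<close>


definition lin :: "('x word \<Rightarrow> 'y tensors) \<Rightarrow> 'x tensors \<Rightarrow> 'y tensors" where
  "lin g p = (\<Sum>w\<in>Poly_Mapping.keys p. scal (Poly_Mapping.lookup p w) (g w))"

lemma scal_0 [simp]: "scal 0 p = 0" "scal c 0 = 0"
  and scal_1 [simp]: "scal 1 p = p"
  and scal_add_left: "scal (c + d) p = scal c p + scal d p"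
  and scal_add_right: "scal c (p + q) = scal c p + scal c q"
  and scal_scal [simp]: "scal c (scal d p) = scal (c * d) p"
  and scal_mult_left: "scal c p * q = scal c (p * q)"
  by (simp_all add: scal_def single_add distrib_left distrib_right mult_single mult.assoc[symmetric])

lemma scal_single: "scal c (Poly_Mapping.single w d) = Poly_Mapping.single w (c * d)"
  by (simp add: scal_def mult_single)

lemma lookup_scal [simp]: "Poly_Mapping.lookup (scal c p) w = c * Poly_Mapping.lookup p w"
  unfolding scal_def mult_map_scale_conv_mult[symmetric] by (simp add: Poly_Mapping.map.rep_eq when_def)

lemma scal_sum: "scal c (sum f S) = (\<Sum>s\<in>S. scal c (f s))"
  by (simp add: scal_def sum_distrib_left)

lemma keys_scal: "Poly_Mapping.keys (scal c p) \<subseteq> Poly_Mapping.keys p"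
  by (auto simp: in_keys_iff)

lemma scal_minus_one: "scal (- 1) p = - p"
  by (rule poly_mapping_eqI) simp

lemma lin_add: "lin g (p + q) = lin g p + lin g q"
  unfolding lin_def by (rule setsum_keys_plus_distrib) (simp_all add: scal_add_left)

lemma lin_single [simp]: "lin g (Poly_Mapping.single w c) = scal c (g w)"
  by (simp add: lin_def)

lemma lin_0 [simp]: "lin g 0 = 0"
  by (simp add: lin_def)

lemma tensor_induct [consumes 1, case_names zero single add]:
  fixes p :: "'x tensors"
  assumes "Poly_Mapping.keys p \<subseteq> S"
    and "P 0" and "\<And>w c. w \<in> S \<Longrightarrow> P (Poly_Mapping.single w c)"
    and "\<And>p q. P p \<Longrightarrow> P q \<Longrightarrow> P (p + q)"
  shows "P p"
proof -
  have "p = (\<Sum>w\<in>Poly_Mapping.keys p. Poly_Mapping.single w (Poly_Mapping.lookup p w))"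
    by (rule poly_mapping_eqI)
      (simp add: lookup_sum lookup_single when_def sum.delta' in_keys_iff)
  moreover have "P (\<Sum>w\<in>A. Poly_Mapping.single w (Poly_Mapping.lookup p w))"
    if "finite A" "A \<subseteq> Poly_Mapping.keys p" for A
    using that by (induction A) (use assms in auto)
  ultimately show ?thesis
    by (metis finite_keys order_refl)
qed

lemma tensor_induct_UNIV [case_names zero single add]:
  fixes p :: "'x tensors"
  assumes "P 0" and "\<And>w c. P (Poly_Mapping.single w c)"
    and "\<And>p q. P p \<Longrightarrow> P q \<Longrightarrow> P (p + q)"
  shows "P p"
  by (rule tensor_induct[of p UNIV]) (use assms in auto)

lemma lin_scal: "lin g (scal c p) = scal c (lin g p)"
proof (induction p rule: tensor_induct_UNIV)
  case (single w d)
  then show ?case by (simp add: scal_single)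
qed (simp_all add: lin_add scal_add_right)

lemma emb_lin: "emb = lin (\<lambda>w. Poly_Mapping.single (map_word Some w) 1)"
  by (simp add: fun_eq_iff emb_def lin_def scal_single)

lemma emb_add: "emb (p + q) = emb p + emb q"
  and emb_scal: "emb (scal c p) = scal c (emb p)"
  and emb_0 [simp]: "emb 0 = 0"
  and emb_single: "emb (Poly_Mapping.single w c) = Poly_Mapping.single (map_word Some w) c"
  by (simp_all add: emb_lin lin_add lin_scal scal_single)

lemma emb_1 [simp]: "emb 1 = 1"
  unfolding single_one[symmetric] emb_single by (simp add: zero_word_def)

lemma map_word_add: "map_word f (u + v) = map_word f u + map_word f v"
  by (simp add: plus_word_def word.map_sel)

lemma emb_mult: "emb (p * q) = emb p * emb q"
proof (induction p rule: tensor_induct_UNIV)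
  case (single w c)
  show ?case
  proof (induction q rule: tensor_induct_UNIV)
    case (single v d)
    then show ?case by (simp add: mult_single emb_single map_word_add)
  qed (simp_all add: emb_add distrib_left)
qed (simp_all add: emb_add distrib_right)

lemma emb_gen [simp]: "emb (gen x) = gen (Some x)"
  by (simp add: gen_def emb_single)


lemma gen_single: "gen x * Poly_Mapping.single (Word xs) c = Poly_Mapping.single (Word (x # xs)) c"
  and single_gen: "Poly_Mapping.single (Word xs) c * gen x = Poly_Mapping.single (Word (xs @ [x])) c"
  by (simp_all add: gen_def mult_single plus_word_def)

lemma scal_mult_right: "p * scal c q = scal c (p * q)"
proof (induction p rule: tensor_induct_UNIV)
  case (single w d)
  then show ?case by (simp add: scal_def mult.assoc[symmetric] mult_single mult.commute)
qed (simp_all add: distrib_right scal_add_right)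

subsection \<open>Coordinates with respect to \<open>T(V) \<oplus> y T(V)\<close>\<close>

fun nf1 :: "'x option list \<Rightarrow> 'x tensors" where
  "nf1 [] = 1"
| "nf1 (None # w) = 0"
| "nf1 (Some x # w) = gen x * nf1 w"

fun nf2 :: "'x option list \<Rightarrow> 'x tensors" where
  "nf2 [] = 0"
| "nf2 (None # w) = nf1 w"
| "nf2 (Some x # w) = - (gen x * nf2 w)"

definition pr1 :: "'x option tensors \<Rightarrow> 'x tensors" where
  "pr1 = lin (\<lambda>w. nf1 (letters w))"

definition pr2 :: "'x option tensors \<Rightarrow> 'x tensors" where
  "pr2 = lin (\<lambda>w. nf2 (letters w))"

definition sgn_twist :: "'x tensors \<Rightarrow> 'x tensors" where
  "sgn_twist = lin (\<lambda>w. Poly_Mapping.single w ((- 1) ^ length (letters w)))"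

lemma word_0 [simp]: "letters 0 = []"
  and word_plus [simp]: "letters (u + v) = letters u @ letters v"
  by (simp_all add: zero_word_def plus_word_def)

lemma sgn_twist_add: "sgn_twist (p + q) = sgn_twist p + sgn_twist q"
  and sgn_twist_scal: "sgn_twist (scal c p) = scal c (sgn_twist p)"
  and sgn_twist_0 [simp]: "sgn_twist 0 = 0"
  and sgn_twist_single: "sgn_twist (Poly_Mapping.single w c) =
    Poly_Mapping.single w (c * (- 1) ^ length (letters w))"
  by (simp_all add: sgn_twist_def lin_add lin_scal scal_single)

lemma sgn_twist_1 [simp]: "sgn_twist 1 = 1"
  unfolding single_one[symmetric] sgn_twist_single by simp

lemma sgn_twist_gen [simp]: "sgn_twist (gen x) = - gen x"
  by (simp add: gen_def sgn_twist_single single_uminus)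

lemma sgn_twist_mult: "sgn_twist (p * q) = sgn_twist p * sgn_twist q"
proof (induction p rule: tensor_induct_UNIV)
  case (single w c)
  show ?case
  proof (induction q rule: tensor_induct_UNIV)
    case (single v d)
    then show ?case by (simp add: mult_single sgn_twist_single power_add algebra_simps)
  qed (simp_all add: sgn_twist_add distrib_left)
qed (simp_all add: sgn_twist_add distrib_right)

lemma pr_add: "pr1 (p + q) = pr1 p + pr1 q" "pr2 (p + q) = pr2 p + pr2 q"
  and pr_scal: "pr1 (scal c p) = scal c (pr1 p)" "pr2 (scal c p) = scal c (pr2 p)"
  and pr_0 [simp]: "pr1 0 = 0" "pr2 0 = 0"
  and pr_single: "pr1 (Poly_Mapping.single w c) = scal c (nf1 (letters w))"
    "pr2 (Poly_Mapping.single w c) = scal c (nf2 (letters w))"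
  by (simp_all add: pr1_def pr2_def lin_add lin_scal)

lemma pr_1 [simp]: "pr1 1 = 1" "pr2 1 = 0"
  unfolding single_one[symmetric] pr_single by simp_all

lemma pr_Some: "pr1 (gen (Some x) * p) = gen x * pr1 p" "pr2 (gen (Some x) * p) = - (gen x * pr2 p)"
  and pr_y: "pr1 (y_gen * p) = 0" "pr2 (y_gen * p) = pr1 p"
proof -
  have "pr1 (gen (Some x) * p) = gen x * pr1 p \<and> pr2 (gen (Some x) * p) = - (gen x * pr2 p) \<and>
    pr1 (y_gen * p) = 0 \<and> pr2 (y_gen * p) = pr1 p"
  proof (induction p rule: tensor_induct_UNIV)
    case (single w c)
    show ?case
      by (cases w) (auto simp: gen_single pr_single scal_mult_right scal_minus_one[symmetric])
  qed (simp_all add: pr_add distrib_left)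
  then show "pr1 (gen (Some x) * p) = gen x * pr1 p" "pr2 (gen (Some x) * p) = - (gen x * pr2 p)"
    "pr1 (y_gen * p) = 0" "pr2 (y_gen * p) = pr1 p" by auto
qed

lemma nf1_append: "nf1 (u @ v) = nf1 u * nf1 v"
  by (induction u rule: nf1.induct) (auto simp: mult.assoc)

lemma nf2_append: "nf2 (u @ v) = nf2 u * nf1 v + sgn_twist (nf1 u) * nf2 v"
  by (induction u rule: nf2.induct) (auto simp: mult.assoc nf1_append sgn_twist_mult algebra_simps)

lemma pr1_mult: "pr1 (p * q) = pr1 p * pr1 q"
  and pr2_mult: "pr2 (p * q) = pr2 p * pr1 q + sgn_twist (pr1 p) * pr2 q"
proof -
  have "pr1 (p * q) = pr1 p * pr1 q \<and> pr2 (p * q) = pr2 p * pr1 q + sgn_twist (pr1 p) * pr2 q"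
  proof (induction p rule: tensor_induct_UNIV)
    case (single w c)
    show ?case
    proof (induction q rule: tensor_induct_UNIV)
      case (single v d)
      then show ?case
        by (simp add: mult_single pr_single nf1_append nf2_append scal_mult_left scal_mult_right
            sgn_twist_scal scal_add_right mult.commute)
    qed (simp_all add: pr_add algebra_simps)
  qed (simp_all add: pr_add sgn_twist_add algebra_simps)
  then show "pr1 (p * q) = pr1 p * pr1 q" "pr2 (p * q) = pr2 p * pr1 q + sgn_twist (pr1 p) * pr2 q"
    by auto
qed

lemma pr_emb [simp]: "pr1 (emb p) = p" "pr2 (emb p) = 0"
proof -
  have *: "nf1 (map Some xs) = Poly_Mapping.single (Word xs) 1" for xs :: "'a list"
    by (induction xs) (auto simp: gen_single zero_word_def[symmetric])
  have "nf2 (map Some xs) = 0" for xs :: "'a list"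
    by (induction xs) auto
  then have "pr1 (emb p) = p \<and> pr2 (emb p) = 0"
    by (induction p rule: tensor_induct_UNIV)
      (auto simp: emb_single pr_single emb_add pr_add word.map_sel * scal_single)
  then show "pr1 (emb p) = p" "pr2 (emb p) = 0" by auto
qed

lemma pr_gen [simp]: "pr1 y_gen = 0" "pr2 y_gen = 1" 
  by (simp_all add: gen_def pr_single)

lemma pr_ext_elem: "pr1 (ext_elem r v c) = r" "pr2 (ext_elem r v c) = sgn_twist v + v"
  by (simp_all add: ext_elem_def pr_add pr_scal pr1_mult pr2_mult)

lemma lookup_ext_elem: "Poly_Mapping.lookup (ext_elem r v c) (Word [None, None]) = c"
proof -
  have a: "Poly_Mapping.lookup (emb p) (Word [None, None]) = 0" for p :: "'a tensors"
    by (induction p rule: tensor_induct_UNIV)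
      (auto simp: emb_single lookup_single emb_add lookup_add when_def word.map_sel
        dest!: arg_cong[where f = letters])
  have b: "Poly_Mapping.lookup (emb p * y_gen) (Word [None, None]) = 0 \<and>
      Poly_Mapping.lookup (y_gen * emb p) (Word [None, None]) = 0" for p :: "'a tensors"
    by (induction p rule: tensor_induct_UNIV)
      (auto simp: emb_single lookup_single emb_add lookup_add when_def word.map_sel gen_def
        mult_single algebra_simps append_eq_Cons_conv dest!: arg_cong[where f = letters])
  show ?thesis
    using a b by (simp add: ext_elem_def lookup_add gen_def mult_single plus_word_def)
qed

lemma ext_map_ext_elem:
  assumes "r \<in> R" "v \<in> tensor_power X 1"
  shows "ext_map X R \<theta> (ext_elem r v c) = \<theta> r + c"
  unfolding ext_map_def
proof (rule the_equality)
  fix t assume "\<exists>r'\<in>R. \<exists>v'\<in>tensor_power X 1. \<exists>c'. ext_elem r v c = ext_elem r' v' c' \<and> t = \<theta> r' + c'"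
  then show "t = \<theta> r + c"
    by (metis pr_ext_elem(1) lookup_ext_elem)
qed (use assms in blast)


lemma ext_map_values:
  assumes "quadratic_data X R" "clifford_map X R \<theta>"
  shows "r \<in> R \<Longrightarrow> ext_map X R \<theta> (emb r) = \<theta> r"
    and "ext_map X R \<theta> (y_gen * y_gen) = 1"
    and "v \<in> tensor_power X 1 \<Longrightarrow> ext_map X R \<theta> (emb v * y_gen + y_gen * emb v) = 0"
proof -
  have R: "0 \<in> R" and V: "0 \<in> tensor_power X 1"
    using assms(1) by (auto simp: quadratic_data_def tensor_power_def)
  have "\<theta> (0 + 0) = \<theta> 0 + \<theta> 0"
    using assms(2) R unfolding clifford_map_def by blast
  then have \<theta>: "\<theta> 0 = 0" by simp
  show "r \<in> R \<Longrightarrow> ext_map X R \<theta> (emb r) = \<theta> r"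
    using ext_map_ext_elem[of r R 0 X \<theta> 0] V by (simp add: ext_elem_def)
  show "ext_map X R \<theta> (y_gen * y_gen) = 1"
    using ext_map_ext_elem[OF R V, of \<theta> 1] \<theta> by (simp add: ext_elem_def)
  show "v \<in> tensor_power X 1 \<Longrightarrow> ext_map X R \<theta> (emb v * y_gen + y_gen * emb v) = 0"
    using ext_map_ext_elem[OF R, of v X \<theta> 0] \<theta> by (simp add: ext_elem_def)
qed

subsection \<open>Quotients of the tensor algebra\<close>

definition tens :: "'x set \<Rightarrow> 'x tensors set" where
  "tens X = {p. Poly_Mapping.keys p \<subseteq> {w. set (letters w) \<subseteq> X}}"

lemma tensor_carrier: "p \<in> tens X \<longleftrightarrow>
    Poly_Mapping.keys p \<subseteq> {w. set (letters w) \<subseteq> X}"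
  by (simp add: tens_def)

lemma tensor_simps [simp]:
  "mult (tensor_algebra X) = (*)" "one (tensor_algebra X) = 1" "zero (tensor_algebra X) = 0"
  "add (tensor_algebra X) = (+)" "smult (tensor_algebra X) = scal"
    "carrier (tensor_algebra X) = tens X"
  by (auto simp: tensor_algebra_def tens_def)

lemma tensor_single [simp]:
  "set (letters w) \<subseteq> X \<Longrightarrow> Poly_Mapping.single w c \<in> tens X"
  by (auto simp: tensor_carrier)

lemma tensor_add [simp, intro]:
  assumes "p \<in> tens X" "q \<in> tens X"
  shows "p + q \<in> tens X"
  using assms keys_add[of p q] by (auto simp: tensor_carrier)

lemma tensor_mult [simp, intro]:
  assumes "p \<in> tens X" "q \<in> tens X"
  shows "p * q \<in> tens X"
  using assms keys_mult[of p q] by (force simp: tensor_carrier)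

lemma tensor_scal [simp, intro]:
  "p \<in> tens X \<Longrightarrow> scal c p \<in> tens X"
  using keys_scal[of c p] by (auto simp: tensor_carrier)

lemma tensor_0 [simp]: "0 \<in> tens X"
  and tensor_1 [simp]: "1 \<in> tens X"
  by (simp_all add: tensor_carrier)

lemma tensor_gen [simp]: "x \<in> X \<Longrightarrow> gen x \<in> tens X"
  by (simp add: gen_def)

lemma tensor_uminus [simp, intro]:
  "p \<in> tens X \<Longrightarrow> - p \<in> tens X"
  using tensor_scal[of p X "- 1"] by (simp add: scal_minus_one)

lemma tensor_diff [simp, intro]:
  assumes "p \<in> tens X" "q \<in> tens X"
  shows "p - q \<in> tens X"
  using tensor_add[OF assms(1) tensor_uminus[OF assms(2)]] by simp

lemma ring_tensor_algebra: "ring (tensor_algebra X)"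
  by (intro ringI abelian_groupI monoidI)
    (auto simp: algebra_simps intro!: bexI[where x = "- x" for x])

lemma ideal_tensorI:
  fixes T :: "('g::semiring_1, complex, 'x tensors) graded"
  assumes T: "T = tensor_algebra X"
    and "I \<subseteq> carrier T" "0 \<in> I" "\<And>p q. p \<in> I \<Longrightarrow> q \<in> I \<Longrightarrow> p + q \<in> I"
    and "\<And>p a. p \<in> I \<Longrightarrow> a \<in> carrier T \<Longrightarrow> a * p \<in> I"
    and "\<And>p a. p \<in> I \<Longrightarrow> a \<in> carrier T \<Longrightarrow> p * a \<in> I"
  shows "ideal I T"
proof -
  interpret ring T unfolding T by (rule ring_tensor_algebra)
  have minus: "- p \<in> I" if "p \<in> I" for p
    using assms(5)[OF that, of "- 1"] by (simp add: T)
  have neg: "\<ominus>\<^bsub>T\<^esub> p = - p" if "p \<in> I" for p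
    by (rule minus_equality) (use assms(2) that in \<open>auto simp: T intro!: tensor_uminus\<close>)
  show ?thesis
  proof (rule idealI[OF ring_axioms])
    show "subgroup I (add_monoid T)"
      by (rule add.subgroupI) (use assms(2-4) minus neg in \<open>auto simp: a_inv_def[symmetric] T\<close>)
  qed (use assms(5-6) in \<open>auto simp: T\<close>)
qed

locale tensor_ideal =
  fixes X :: "'x set" and I :: "'x tensors set"
    and T :: "('g::semiring_1, complex, 'x tensors) graded"
    and cl :: "'x tensors \<Rightarrow> 'x tensors set"
    and Q :: "('g, complex, 'x tensors set) graded"
  defines "T \<equiv> tensor_algebra X"
    and "cl \<equiv> \<lambda>p. I +>\<^bsub>T\<^esub> p"
    and "Q \<equiv> quotient_algebra T I"
  assumes ideal: "ideal I T"
begin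

lemma T_carrier [simp]: "carrier T = tens X"
  by (simp add: T_def)

lemma T_simps [simp]: "mult T = (*)" "one T = 1" "zero T = 0" "add T = (+)" "smult T = scal"
  by (simp_all add: T_def)

sublocale ring T
  unfolding T_def by (rule ring_tensor_algebra)

sublocale ideal I T
  by (rule ideal)

lemma I_closed: "0 \<in> I" "p \<in> I \<Longrightarrow> q \<in> I \<Longrightarrow> p + q \<in> I"
  "p \<in> I \<Longrightarrow> a \<in> carrier T \<Longrightarrow> a * p \<in> I" "p \<in> I \<Longrightarrow> a \<in> carrier T \<Longrightarrow> p * a \<in> I"
  "p \<in> I \<Longrightarrow> p \<in> carrier T"
  using zero_closed a_closed[of p q] I_l_closed[of p a] I_r_closed[of p a] Icarr[of p]
    additive_subgroup.zero_closed[OF is_additive_subgroup]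
    additive_subgroup.a_closed[OF is_additive_subgroup, of p q] by simp_all

lemma I_uminus: "p \<in> I \<Longrightarrow> - p \<in> I"
  using I_closed(3)[of p "- 1"] by simp

lemma I_scal: "p \<in> I \<Longrightarrow> scal c p \<in> I"
  using I_closed(3)[of p "Poly_Mapping.single 0 c"] by (simp add: scal_def)

lemma cl_eq: 
  assumes "p \<in> carrier T" "q \<in> carrier T"
  shows "cl p = cl q \<longleftrightarrow> p - q \<in> I"
proof -
  have "\<ominus>\<^bsub>T\<^esub> q = - q"
    by (rule minus_equality) (use assms in \<open>auto intro!: tensor_uminus\<close>)
  then show ?thesis
    using quotient_eq_iff_same_a_r_cos[OF ideal assms] by (simp add: cl_def a_minus_def)
qed

lemma Q_carrier: "carrier Q = cl ` carrier T"
  by (auto simp: Q_def quotient_algebra_def FactRing_def A_RCOSETS_def' cl_def)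

lemma Q_mult: "p \<in> carrier T \<Longrightarrow> q \<in> carrier T \<Longrightarrow> cl p \<otimes>\<^bsub>Q\<^esub> cl q = cl (p * q)"
  using rcoset_mult_add[of p q] by (simp add: Q_def quotient_algebra_def FactRing_def cl_def)

lemma Q_add: "p \<in> carrier T \<Longrightarrow> q \<in> carrier T \<Longrightarrow> cl p \<oplus>\<^bsub>Q\<^esub> cl q = cl (p + q)"
  using a_rcos_sum[of p q] by (simp add: Q_def quotient_algebra_def FactRing_def cl_def)

lemma Q_one: "\<one>\<^bsub>Q\<^esub> = cl 1"
  by (simp add: Q_def quotient_algebra_def FactRing_def cl_def)

lemma Q_zero: "\<zero>\<^bsub>Q\<^esub> = cl 0"
  using a_rcos_zero[OF ideal I_closed(1)] 
  by (simp add: Q_def quotient_algebra_def FactRing_def cl_def)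

lemma Q_homog: "homog Q g = cl ` homog T g"
  by (simp add: Q_def quotient_algebra_def cl_def)

lemma Q_smult:
  assumes "p \<in> carrier T" shows "c \<odot>\<^bsub>Q\<^esub> cl p = cl (scal c p)"
proof -
  have "cl (scal c s) = cl (scal c p)" if "s \<in> cl p" for s
  proof -
    have s: "s \<in> carrier T"
      using a_elemrcos_carrier[OF assms] that by (simp add: cl_def)
    have "cl p = cl s"
      using a_repr_independence'[OF _ assms] that by (simp add: cl_def)
    then have "p - s \<in> I"
      unfolding cl_eq[OF assms s] .
    then have "scal c s - scal c p \<in> I"
      using I_scal[of "p - s" "- c"] by (simp add: scal_def algebra_simps single_uminus)
    moreover have "scal c s \<in> carrier T" "scal c p \<in> carrier T"
      using s assms by simp_all
    ultimately show ?thesis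
      using cl_eq by blast
  qed
  moreover have "p \<in> cl p"
    using a_rcos_self[OF assms] by (simp add: cl_def)
  ultimately have "(\<Union>s\<in>cl p. cl (scal c s)) = cl (scal c p)"
    by blast
  then show ?thesis
    by (simp add: Q_def quotient_algebra_def cl_def)
qed

lemma Q_ring: "ring Q"
proof -
  note closed = tensor_add[where X = X] tensor_mult[where X = X] tensor_uminus[where X = X] tensor_0 tensor_1
  note rules = T_carrier Q_add Q_mult Q_zero Q_one closed
    Groups.add.assoc Groups.mult.assoc Rings.distrib_left Rings.distrib_right
    Groups.add_0_left Groups.mult_1_left Groups.mult_1_right
  have closed_Q: "cl p \<in> carrier Q" if "p \<in> carrier T" for p
    using that unfolding Q_carrier by blast
  show ?thesis
  proof (intro ringI abelian_groupI monoidI)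
    fix x y z assume x: "x \<in> carrier Q" and y: "y \<in> carrier Q" and z: "z \<in> carrier Q"
    obtain p q r where pqr: "p \<in> tens X" "x = cl p" "q \<in> tens X" "y = cl q" "r \<in> tens X" "z = cl r"
      using x y z unfolding Q_carrier T_carrier by blast
    show "x \<oplus>\<^bsub>Q\<^esub> y \<oplus>\<^bsub>Q\<^esub> z = x \<oplus>\<^bsub>Q\<^esub> (y \<oplus>\<^bsub>Q\<^esub> z)" "x \<otimes>\<^bsub>Q\<^esub> y \<otimes>\<^bsub>Q\<^esub> z = x \<otimes>\<^bsub>Q\<^esub> (y \<otimes>\<^bsub>Q\<^esub> z)"
      "(x \<oplus>\<^bsub>Q\<^esub> y) \<otimes>\<^bsub>Q\<^esub> z = x \<otimes>\<^bsub>Q\<^esub> z \<oplus>\<^bsub>Q\<^esub> y \<otimes>\<^bsub>Q\<^esub> z"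
      "z \<otimes>\<^bsub>Q\<^esub> (x \<oplus>\<^bsub>Q\<^esub> y) = z \<otimes>\<^bsub>Q\<^esub> x \<oplus>\<^bsub>Q\<^esub> z \<otimes>\<^bsub>Q\<^esub> y"
      using pqr by (simp_all only: rules)
  next
    fix x y assume x: "x \<in> carrier Q" and y: "y \<in> carrier Q"
    obtain p q where pq: "p \<in> tens X" "x = cl p" "q \<in> tens X" "y = cl q"
      using x y unfolding Q_carrier T_carrier by blast
    show "x \<oplus>\<^bsub>Q\<^esub> y \<in> carrier Q" "x \<otimes>\<^bsub>Q\<^esub> y \<in> carrier Q"
      using pq by (simp_all only: rules closed_Q)
    show "x \<oplus>\<^bsub>Q\<^esub> y = y \<oplus>\<^bsub>Q\<^esub> x"
      using pq by (simp only: rules) (rule arg_cong[OF Groups.add.commute])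
  next
    fix x assume x: "x \<in> carrier Q"
    obtain p where p: "p \<in> tens X" "x = cl p"
      using x unfolding Q_carrier T_carrier by blast
    show "\<zero>\<^bsub>Q\<^esub> \<oplus>\<^bsub>Q\<^esub> x = x" "\<one>\<^bsub>Q\<^esub> \<otimes>\<^bsub>Q\<^esub> x = x" "x \<otimes>\<^bsub>Q\<^esub> \<one>\<^bsub>Q\<^esub> = x"
      using p by (simp_all only: rules)
    show "\<exists>y\<in>carrier Q. y \<oplus>\<^bsub>Q\<^esub> x = \<zero>\<^bsub>Q\<^esub>"
      using p by (intro bexI[of _ "cl (- p)"]) (simp_all only: rules closed_Q Groups.left_minus)
  next
    show "\<zero>\<^bsub>Q\<^esub> \<in> carrier Q" "\<one>\<^bsub>Q\<^esub> \<in> carrier Q"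
      by (simp_all only: rules closed_Q)
  qed
qed

lemma Q_uminus:
  assumes "p \<in> carrier T" shows "\<ominus>\<^bsub>Q\<^esub> cl p = cl (- p)"
proof -
  have m: "- p \<in> carrier T"
    using assms unfolding T_carrier by (rule tensor_uminus)
  have a: "cl (- p) \<oplus>\<^bsub>Q\<^esub> cl p = \<zero>\<^bsub>Q\<^esub>"
    unfolding Q_add[OF m assms] Q_zero by (subst Groups.left_minus) (rule refl)
  have b: "cl p \<in> carrier Q" "cl (- p) \<in> carrier Q"
    unfolding Q_carrier using m assms by blast+
  show ?thesis
    by (rule abelian_group.minus_equality[OF ring.is_abelian_group[OF Q_ring] a b])
qed

end


subsection \<open>The presentation of the trivial extension\<close>

lemma emb_diff: "emb (p - q) = emb p - emb q"
  and sgn_twist_diff: "sgn_twist (p - q) = sgn_twist p - sgn_twist q"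
  and pr_diff: "pr1 (a - b) = pr1 a - pr1 b" "pr2 (a - b) = pr2 a - pr2 b"
  using emb_add[of "p - q" q] sgn_twist_add[of "p - q" q] pr_add[of "a - b" b] by simp_all

lemma emb_tens: "p \<in> tens X \<Longrightarrow> emb p \<in> tens (ext_basis X)"
  unfolding tensor_carrier[of p]
  by (induction rule: tensor_induct)
    (auto simp: emb_single emb_add word.map_sel ext_basis_def image_iff subset_iff intro!: tensor_single)

lemma sgn_twist_tens: "p \<in> tens X \<Longrightarrow> sgn_twist p \<in> tens X"
  unfolding tensor_carrier[of p]
  by (induction rule: tensor_induct) (auto simp: sgn_twist_single sgn_twist_add)

definition hom_tens :: "'x set \<Rightarrow> int \<Rightarrow> 'x tensors set" where
  "hom_tens X n = {p. Poly_Mapping.keys p \<subseteq> {w. set (letters w) \<subseteq> X \<and> int (length (letters w)) = n}}"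

lemma homog_tensor_algebra: "homog (tensor_algebra X) n = hom_tens X n"
  by (auto simp: tensor_algebra_def hom_tens_def)

lemma hom_tens_0 [simp]: "0 \<in> hom_tens X n"
  and hom_tens_tens: "p \<in> hom_tens X n \<Longrightarrow> p \<in> tens X"
  by (auto simp: hom_tens_def tens_def)

lemma hom_tens_single:
  "set (letters w) \<subseteq> X \<Longrightarrow> int (length (letters w)) = n \<Longrightarrow> Poly_Mapping.single w c \<in> hom_tens X n"
  by (auto simp: hom_tens_def)

lemma hom_tens_add: "p \<in> hom_tens X n \<Longrightarrow> q \<in> hom_tens X n \<Longrightarrow> p + q \<in> hom_tens X n"
  using keys_add[of p q] by (force simp: hom_tens_def)

lemma hom_tens_scal: "p \<in> hom_tens X n \<Longrightarrow> scal c p \<in> hom_tens X n"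
  using keys_scal[of c p] by (force simp: hom_tens_def)

lemma hom_tens_uminus: "p \<in> hom_tens X n \<Longrightarrow> - p \<in> hom_tens X n"
  using hom_tens_scal[of p X n "- 1"] by (simp add: scal_minus_one)

lemma hom_tens_mult: "p \<in> hom_tens X m \<Longrightarrow> q \<in> hom_tens X n \<Longrightarrow> p * q \<in> hom_tens X (m + n)"
  using keys_mult[of p q] by (force simp: hom_tens_def)

lemma hom_tens_gen: "x \<in> X \<Longrightarrow> gen x \<in> hom_tens X 1"
  by (simp add: gen_def hom_tens_single)

lemma emb_hom_tens: "p \<in> hom_tens X n \<Longrightarrow> emb p \<in> hom_tens (ext_basis X) n"
  unfolding hom_tens_def[of X] mem_Collect_eq
  by (induction rule: tensor_induct)
    (auto simp: emb_single emb_add word.map_sel ext_basis_def image_iff subset_iff intro!: hom_tens_single hom_tens_add)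

lemma sgn_twist_hom_tens: "p \<in> hom_tens X n \<Longrightarrow> sgn_twist p = (if even n then p else - p)"
  unfolding hom_tens_def mem_Collect_eq
  by (induction rule: tensor_induct) (auto simp: sgn_twist_single sgn_twist_add single_uminus)

lemma nf_hom_tens:
  assumes "set xs \<subseteq> ext_basis X"
  shows "nf1 xs \<in> hom_tens X (int (length xs)) \<and> nf2 xs \<in> hom_tens X (int (length xs) - 1)"
  using assms
proof (induction xs)
  case Nil
  have "1 \<in> hom_tens X 0"
    unfolding single_one[symmetric] by (rule hom_tens_single) auto
  then show ?case by simp
next
  case (Cons a xs)
  then show ?case
    using hom_tens_mult[OF hom_tens_gen, of _ X "nf1 xs" "int (length xs)"]
      hom_tens_mult[OF hom_tens_gen, of _ X "nf2 xs" "int (length xs) - 1"]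
    by (cases a) (auto simp: ext_basis_def intro: hom_tens_uminus)
qed

lemma pr_hom_tens:
  assumes "p \<in> hom_tens (ext_basis X) n"
  shows "pr1 p \<in> hom_tens X n" "pr2 p \<in> hom_tens X (n - 1)"
proof -
  have "pr1 p \<in> hom_tens X n \<and> pr2 p \<in> hom_tens X (n - 1)"
    using assms unfolding hom_tens_def[of "ext_basis X"] mem_Collect_eq
  proof (induction rule: tensor_induct)
    case (single w c)
    then show ?case
      using nf_hom_tens[of "letters w" X] by (auto simp: pr_single intro: hom_tens_scal)
  qed (auto simp: pr_add intro: hom_tens_add)
  then show "pr1 p \<in> hom_tens X n" "pr2 p \<in> hom_tens X (n - 1)" by auto
qed

lemma pr_tens:
  assumes "p \<in> tens (ext_basis X)" shows "pr1 p \<in> tens X" "pr2 p \<in> tens X"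
proof -
  have "pr1 p \<in> tens X \<and> pr2 p \<in> tens X"
    using assms unfolding tensor_carrier[of p]
  proof (induction rule: tensor_induct)
    case (single w c)
    then show ?case
      using nf_hom_tens[of "letters w" X] by (auto simp: pr_single dest: hom_tens_tens)
  qed (auto simp: pr_add)
  then show "pr1 p \<in> tens X" "pr2 p \<in> tens X" by auto
qed

lemma tensor_power_hom_tens: "tensor_power X n = hom_tens X (int n)"
  by (auto simp: tensor_power_def hom_tens_def)

lemma Idl_tensor:
  fixes T :: "('g::semiring_1, complex, 'x tensors) graded"
  assumes "T = tensor_algebra X" "S \<subseteq> tens X"
  shows "ideal (Idl\<^bsub>T\<^esub> S) T" "S \<subseteq> Idl\<^bsub>T\<^esub> S" "ideal K T \<Longrightarrow> S \<subseteq> K \<Longrightarrow> Idl\<^bsub>T\<^esub> S \<subseteq> K"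
proof -
  interpret ring T unfolding assms(1) by (rule ring_tensor_algebra)
  show "ideal (Idl\<^bsub>T\<^esub> S) T" "S \<subseteq> Idl\<^bsub>T\<^esub> S" "ideal K T \<Longrightarrow> S \<subseteq> K \<Longrightarrow> Idl\<^bsub>T\<^esub> S \<subseteq> K"
    using assms genideal_ideal[of S] genideal_self[of S] genideal_minimal[of K S] by simp_all
qed

lemma ext_rel_quadratic_data:
  assumes "quadratic_data X R"
  shows "quadratic_data (ext_basis X) (ext_rel X R)"
proof -
  have *: "ext_elem r v c \<in> tensor_power (ext_basis X) 2" if "r \<in> R" "v \<in> tensor_power X 1" for r v c
  proof -
    have "emb r \<in> hom_tens (ext_basis X) 2" "emb v \<in> hom_tens (ext_basis X) 1"
      using assms that emb_hom_tens[of r X 2] emb_hom_tens[of v X 1]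
      by (auto simp: quadratic_data_def tensor_power_hom_tens)
    moreover have "y_gen \<in> hom_tens (ext_basis X) 1"
      by (rule hom_tens_gen) (simp add: ext_basis_def)
    ultimately show ?thesis
      unfolding ext_elem_def tensor_power_hom_tens
      using hom_tens_mult[where m = 1 and n = 1] by (auto intro!: hom_tens_add hom_tens_scal)
  qed
  have "finite (ext_basis X)"
    using assms by (simp add: quadratic_data_def ext_basis_def)
  moreover have "0 \<in> ext_rel X R"
    using assms unfolding ext_rel_def quadratic_data_def tensor_power_hom_tens
    by (intro CollectI exI[of _ 0]) (simp add: ext_elem_def)
  moreover have "p + q \<in> ext_rel X R" if "p \<in> ext_rel X R" "q \<in> ext_rel X R" for p q
  proof -
    obtain r v c r' v' c' where "p = ext_elem r v c" "q = ext_elem r' v' c'"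
      and m: "r \<in> R" "v \<in> tensor_power X 1" "r' \<in> R" "v' \<in> tensor_power X 1"
      using \<open>p \<in> _\<close> \<open>q \<in> _\<close> by (auto simp: ext_rel_def)
    then have "p + q = ext_elem (r + r') (v + v') (c + c')"
      by (simp add: ext_elem_def emb_add scal_add_left algebra_simps)
    moreover have "r + r' \<in> R" "v + v' \<in> tensor_power X 1"
      using assms m by (auto simp: quadratic_data_def tensor_power_hom_tens hom_tens_add)
    ultimately show ?thesis
      unfolding ext_rel_def by blast
  qed
  moreover have "scal d p \<in> ext_rel X R" if "p \<in> ext_rel X R" for d p
  proof -
    obtain r v c where "p = ext_elem r v c" and m: "r \<in> R" "v \<in> tensor_power X 1"
      using \<open>p \<in> _\<close> by (auto simp: ext_rel_def)
    then have "scal d p = ext_elem (scal d r) (scal d v) (d * c)"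
      by (simp add: ext_elem_def emb_scal scal_add_right scal_mult_left scal_mult_right)
    moreover have "scal d r \<in> R" "scal d v \<in> tensor_power X 1"
      using assms m by (auto simp: quadratic_data_def tensor_power_hom_tens hom_tens_scal)
    ultimately show ?thesis
      unfolding ext_rel_def by blast
  qed
  ultimately show ?thesis
    using * unfolding quadratic_data_def by (auto simp: ext_rel_def)
qed


lemma ext_relI: "r \<in> R \<Longrightarrow> v \<in> hom_tens X 1 \<Longrightarrow> ext_elem r v c \<in> ext_rel X R"
  unfolding ext_rel_def tensor_power_hom_tens by auto

lemma trivial_extension_presentation:
  fixes X :: "'x set" and R :: "'x tensors set"
  defines "T \<equiv> tensor_algebra X :: (int, complex, 'x tensors) graded"
    and "T' \<equiv> tensor_algebra (ext_basis X) :: (int, complex, 'x option tensors) graded"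
    and "E \<equiv> quadratic_algebra X R"
    and "E' \<equiv> quadratic_algebra (ext_basis X) (ext_rel X R)"
  assumes qd: "quadratic_data X R"
  obtains f where "f \<in> ring_iso (trivial_extension E) E'"
    and "\<And>c x. x \<in> carrier (trivial_extension E)
      \<Longrightarrow> f (c \<odot>\<^bsub>trivial_extension E\<^esub> x) = c \<odot>\<^bsub>E'\<^esub> f x"
    and "\<And>n. f ` homog (trivial_extension E) n = homog E' n"
    and "\<And>p q. p \<in> carrier T \<Longrightarrow> q \<in> carrier T \<Longrightarrow>
      f (Idl\<^bsub>T\<^esub> R +>\<^bsub>T\<^esub> p, Idl\<^bsub>T\<^esub> R +>\<^bsub>T\<^esub> q) =
        Idl\<^bsub>T'\<^esub> (ext_rel X R) +>\<^bsub>T'\<^esub> (emb p + y_gen * emb q)"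
proof -
  define I where "I = Idl\<^bsub>T\<^esub> R"
  define J where "J = Idl\<^bsub>T'\<^esub> (ext_rel X R)"
  define cl where "cl = (\<lambda>p. I +>\<^bsub>T\<^esub> p)"
  define cl' where "cl' = (\<lambda>p. J +>\<^bsub>T'\<^esub> p)"
  let ?X' = "ext_basis X"
  have R: "R \<subseteq> hom_tens X 2" and R': "ext_rel X R \<subseteq> hom_tens ?X' 2"
    using qd ext_rel_quadratic_data[OF qd] by (auto simp: quadratic_data_def tensor_power_hom_tens)
  have R_sub: "R \<subseteq> tens X" and R'_sub: "ext_rel X R \<subseteq> tens ?X'"
    using R R' hom_tens_tens by blast+
  note I = Idl_tensor[OF T_def[THEN meta_eq_to_obj_eq] R_sub, folded I_def]
  note J = Idl_tensor[OF T'_def[THEN meta_eq_to_obj_eq] R'_sub, folded J_def]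
  interpret E: tensor_ideal X I T cl E
    by (rule tensor_ideal.intro)
      (use I(1) in \<open>simp_all add: T_def cl_def E_def quadratic_algebra_def I_def Let_def\<close>)
  interpret E': tensor_ideal ?X' J T' cl' E'
    by (rule tensor_ideal.intro)
      (use J(1) in \<open>simp_all add: T'_def cl'_def E'_def quadratic_algebra_def J_def Let_def\<close>)
  note Ic = E.I_closed[unfolded E.T_carrier] and Jc = E'.I_closed[unfolded E'.T_carrier]
  have y: "y_gen \<in> tens ?X'"
    by (simp add: ext_basis_def)

  have emb_I: "emb p \<in> J" if "p \<in> I" for p
  proof -
    have "ideal {p \<in> tens X. emb p \<in> J} T"
      by (rule ideal_tensorI) (auto simp: T_def emb_add emb_mult emb_tens Jc)
    moreover have "R \<subseteq> {p \<in> tens X. emb p \<in> J}"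
    proof
      fix r assume r: "r \<in> R"
      have "ext_elem r 0 0 \<in> ext_rel X R"
        using r by (simp add: ext_relI)
      then show "r \<in> {p \<in> tens X. emb p \<in> J}"
        using J(2) R_sub r by (auto simp: ext_elem_def)
    qed
    ultimately show ?thesis using I(3) that by blast
  qed
  have sgn_I: "sgn_twist p \<in> I" if "p \<in> I" for p
  proof -
    have "ideal {p \<in> tens X. sgn_twist p \<in> I} T"
      by (rule ideal_tensorI) (auto simp: T_def sgn_twist_add sgn_twist_mult sgn_twist_tens Ic)
    moreover have "R \<subseteq> {p \<in> tens X. sgn_twist p \<in> I}"
      using R_sub I(2) sgn_twist_hom_tens[OF subsetD[OF R]] by auto
    ultimately show ?thesis using I(3) that by blast
  qed
  have pr_J: "pr1 p \<in> I \<and> pr2 p \<in> I" if "p \<in> J" for p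
  proof -
    have "ideal {p \<in> tens ?X'. pr1 p \<in> I \<and> pr2 p \<in> I} T'"
      by (rule ideal_tensorI)
        (auto simp: T'_def pr_add pr1_mult pr2_mult pr_tens sgn_twist_tens sgn_I Ic)
    moreover have "ext_rel X R \<subseteq> {p \<in> tens ?X'. pr1 p \<in> I \<and> pr2 p \<in> I}"
    proof
      fix s assume s: "s \<in> ext_rel X R"
      then obtain r v c where "s = ext_elem r v c" "r \<in> R" "v \<in> hom_tens X 1"
        by (auto simp: ext_rel_def tensor_power_hom_tens)
      then show "s \<in> {p \<in> tens ?X'. pr1 p \<in> I \<and> pr2 p \<in> I}"
        using R'_sub s I(2) Ic(1) sgn_twist_hom_tens[of v X 1] by (auto simp: pr_ext_elem)
    qed
    ultimately show ?thesis using J(3) that by blast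
  qed
  have anticomm: "gen (Some x) * y_gen + y_gen * gen (Some x) \<in> J" if "x \<in> X" for x
  proof -
    have "ext_elem 0 (gen x) 0 \<in> ext_rel X R"
      using qd that by (auto simp: quadratic_data_def intro!: ext_relI hom_tens_gen)
    then show ?thesis using J(2) by (auto simp: ext_elem_def)
  qed
  have yy: "y_gen * y_gen \<in> J"
  proof -
    have "ext_elem 0 0 1 \<in> ext_rel X R"
      using qd by (auto simp: quadratic_data_def intro!: ext_relI)
    then show ?thesis using J(2) by (auto simp: ext_elem_def)
  qed
  have comm_y: "emb p * y_gen - y_gen * emb (sgn_twist p) \<in> J" if "p \<in> tens X" for p
    using that unfolding tensor_carrier[of p]
  proof (induction rule: tensor_induct)
    case zero
    then show ?case by (simp add: Jc)
  next
    case (add p q)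
    then show ?case
      using Jc(2)[OF add] by (simp add: emb_add sgn_twist_add algebra_simps)
  next
    case (single w c)
    have "set xs \<subseteq> X \<Longrightarrow> emb (Poly_Mapping.single (Word xs) c) * y_gen -
      y_gen * emb (sgn_twist (Poly_Mapping.single (Word xs) c)) \<in> J" for xs
    proof (induction xs)
      case Nil
      have "emb (Poly_Mapping.single (Word [] :: 'x word) c) * y_gen =
          y_gen * emb (sgn_twist (Poly_Mapping.single (Word []) c))"
        by (simp add: gen_def emb_single sgn_twist_single mult_single plus_word_def)
      then show ?case by (simp add: Jc)
    next
      case (Cons x xs)
      define p where "p = Poly_Mapping.single (Word xs) c"
      define z where "z = (gen (Some x) :: 'x option tensors)"
      have "gen x * p = Poly_Mapping.single (Word (x # xs)) c"
        by (simp add: p_def gen_single)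
      moreover have "emb (gen x * p) * y_gen - y_gen * emb (sgn_twist (gen x * p)) =
        z * (emb p * y_gen - y_gen * emb (sgn_twist p)) + (z * y_gen + y_gen * z) * emb (sgn_twist p)"
        using emb_scal[of "- 1" "gen x * sgn_twist p"]
        by (simp add: emb_mult sgn_twist_mult algebra_simps z_def scal_minus_one)
      moreover have "z \<in> tens ?X'" "emb (sgn_twist p) \<in> tens ?X'"
        using Cons.prems by (simp_all add: z_def p_def emb_tens sgn_twist_tens)
          (simp add: ext_basis_def)
      ultimately show ?case
        using Cons anticomm[of x] by (simp add: p_def[symmetric] z_def[symmetric] Jc)
    qed
    from this[of "letters w"] single show ?case by simp
  qed
  have decomp: "s - (emb (pr1 s) + y_gen * emb (pr2 s)) \<in> J" if "s \<in> tens ?X'" for s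
    using that unfolding tensor_carrier[of s]
  proof (induction rule: tensor_induct)
    case zero
    then show ?case by (simp add: Jc)
  next
    case (add p q)
    then show ?case
      using Jc(2)[OF add] by (simp add: emb_add pr_add algebra_simps)
  next
    case (single w c)
    have "set xs \<subseteq> ?X' \<Longrightarrow> Poly_Mapping.single (Word xs) c - (emb (pr1 (Poly_Mapping.single (Word xs) c))
      + y_gen * emb (pr2 (Poly_Mapping.single (Word xs) c))) \<in> J" for xs
    proof (induction xs)
      case Nil
      have "Poly_Mapping.single (Word []) c = scal c (1 :: 'x option tensors)"
        by (simp add: scal_def zero_word_def)
      then show ?case by (simp add: pr_scal emb_scal Jc)
    next
      case (Cons x xs)
      define p where "p = Poly_Mapping.single (Word xs) c"
      have p: "gen x * p = Poly_Mapping.single (Word (x # xs)) c"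
        by (simp add: p_def gen_single)
      have pt: "p \<in> tens ?X'"
        using Cons.prems by (simp add: p_def)
      have e: "emb (pr2 p) \<in> tens ?X'"
        by (intro emb_tens pr_tens pt)
      have IH: "p - (emb (pr1 p) + y_gen * emb (pr2 p)) \<in> J"
        using Cons by (simp add: p_def)
      have gx: "gen x \<in> tens ?X'"
        using Cons.prems by simp
      have "gen x * p - (emb (pr1 (gen x * p)) + y_gen * emb (pr2 (gen x * p))) \<in> J"
      proof (cases x)
        case None
        have "gen x * p - (emb (pr1 (gen x * p)) + y_gen * emb (pr2 (gen x * p))) =
          gen x * (p - (emb (pr1 p) + y_gen * emb (pr2 p))) + (y_gen * y_gen) * emb (pr2 p)"
          unfolding None by (simp add: pr_y algebra_simps)
        then show ?thesis
          using Jc(2)[OF Jc(3)[OF IH gx] Jc(4)[OF yy e]] by simp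
      next
        case (Some z)
        then have z: "z \<in> X"
          using Cons.prems by (auto simp: ext_basis_def)
        have "gen x * p - (emb (pr1 (gen x * p)) + y_gen * emb (pr2 (gen x * p))) =
          gen x * (p - (emb (pr1 p) + y_gen * emb (pr2 p))) +
          (gen (Some z) * y_gen + y_gen * gen (Some z)) * emb (pr2 p)"
          unfolding Some using emb_scal[of "- 1" "gen z * pr2 p"]
          by (simp add: pr_Some emb_mult algebra_simps scal_minus_one)
        then show ?thesis
          using Jc(2)[OF Jc(3)[OF IH gx] Jc(4)[OF anticomm[OF z] e]] by simp
      qed
      then show ?case
        by (simp only: p)
    qed
    from this[of "letters w"] single show ?case by simp
  qed

  define rep where "rep = (\<lambda>C. SOME p. p \<in> tens X \<and> cl p = C)"
  have rep: "rep (cl p) \<in> tens X \<and> cl (rep (cl p)) = cl p" if "p \<in> tens X" for p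
    unfolding rep_def by (rule someI[of _ p]) (use that in simp)
  have sgn_cl: "sign_automorphism E (cl p) = cl (sgn_twist p)" if "p \<in> tens X" for p
  proof -
    define e where "e = (\<lambda>C\<in>carrier E. cl (sgn_twist (rep C)))"
    have cl_in: "cl p \<in> carrier E" if "p \<in> tens X" for p
      using that by (auto simp: E.Q_carrier)
    have e_cl: "e (cl p) = cl (sgn_twist p)" if "p \<in> tens X" for p
    proof -
      have "rep (cl p) - p \<in> I"
        using rep[OF that] that E.cl_eq by auto
      then have "sgn_twist (rep (cl p)) - sgn_twist p \<in> I"
        using sgn_I unfolding sgn_twist_diff[symmetric] by blast
      then show ?thesis
        using that rep[OF that] cl_in[OF that] by (simp add: e_def E.cl_eq sgn_twist_tens)
    qed
    define P where "P = (\<lambda>e. e \<in> carrier E \<rightarrow>\<^sub>E carrier E \<and>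
      (\<forall>x\<in>carrier E. \<forall>y\<in>carrier E. e (x \<oplus>\<^bsub>E\<^esub> y) = e x \<oplus>\<^bsub>E\<^esub> e y) \<and>
      (\<forall>n. \<forall>x\<in>homog E n. e x = (if even n then x else \<ominus>\<^bsub>E\<^esub> x)))"
    have uminus: "\<ominus>\<^bsub>E\<^esub> cl p = cl (- p)" if "p \<in> tens X" for p
      using that E.Q_uminus by simp
    have hom: "homog E n = cl ` hom_tens X n" for n
      unfolding E.Q_homog by (simp add: T_def homog_tensor_algebra)
    have "P e"
      unfolding P_def
    proof (intro conjI ballI allI)
      show "e \<in> carrier E \<rightarrow>\<^sub>E carrier E"
        using rep by (auto simp: e_def E.Q_carrier intro!: imageI sgn_twist_tens)
    next
      fix x y assume "x \<in> carrier E" "y \<in> carrier E"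
      then show "e (x \<oplus>\<^bsub>E\<^esub> y) = e x \<oplus>\<^bsub>E\<^esub> e y"
        by (auto simp: E.Q_carrier E.Q_add e_cl sgn_twist_add sgn_twist_tens)
    next
      fix n x assume "x \<in> homog E n"
      then show "e x = (if even n then x else \<ominus>\<^bsub>E\<^esub> x)"
        by (auto simp: hom e_cl sgn_twist_hom_tens uminus hom_tens_tens)
    qed
    moreover have "e1 = e2" if "P e1" "P e2" for e1 e2
    proof
      fix C
      show "e1 C = e2 C"
      proof (cases "C \<in> carrier E")
        case False
        then show ?thesis using that by (auto simp: P_def PiE_def extensional_def)
      next
        case True
        then obtain q where q: "q \<in> tens X" "C = cl q"
          by (auto simp: E.Q_carrier)
        have "q \<in> tens X \<and> e1 (cl q) = e2 (cl q)"
          using q(1)[unfolded tensor_carrier]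
        proof (induction rule: tensor_induct)
          case zero
          have "cl 0 \<in> homog E 0" by (auto simp: hom)
          then show ?case using that by (simp add: P_def)
        next
          case (single w c)
          then have "cl (Poly_Mapping.single w c) \<in> homog E (int (length (letters w)))"
            by (auto simp: hom intro!: imageI hom_tens_single)
          then show ?case using that single by (simp add: P_def)
        next
          case (add p q)
          then show ?case
            using that by (simp add: P_def E.Q_add[symmetric] cl_in)
        qed
        then show ?thesis using q by simp
      qed
    qed
    ultimately have "(THE e. P e) = e"
      by (intro the_equality) auto
    then show ?thesis
      using e_cl[OF that] by (simp add: sign_automorphism_def P_def)
  qed

  define f where "f = (\<lambda>(C, D). cl' (emb (rep C) + y_gen * emb (rep D)))"
  have f_cl: "f (cl p, cl q) = cl' (emb p + y_gen * emb q)" if "p \<in> tens X" "q \<in> tens X" for p q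
  proof -
    have *: "emb (rep (cl p)) - emb p \<in> J" if "p \<in> tens X" for p
    proof -
      have "rep (cl p) - p \<in> I"
        using rep[OF that] that E.cl_eq by auto
      then show ?thesis
        using emb_I unfolding emb_diff[symmetric] by blast
    qed
    have "(emb (rep (cl p)) - emb p) + y_gen * (emb (rep (cl q)) - emb q) \<in> J"
      by (intro Jc(2,3) * that y)
    then show ?thesis
      using that rep y by (simp add: f_def E'.cl_eq emb_tens algebra_simps)
  qed
  have carr: "x \<in> carrier (trivial_extension E) \<longleftrightarrow> (\<exists>p\<in>tens X. \<exists>q\<in>tens X. x = (cl p, cl q))" for x
    by (auto simp: trivial_extension_def E.Q_carrier)
  have elem: "emb p + y_gen * emb q \<in> tens ?X'" if "p \<in> tens X" "q \<in> tens X" for p q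
    using that y by (simp add: emb_tens)
  have surj: "cl' s = f (cl (pr1 s), cl (pr2 s))" if "s \<in> tens ?X'" for s
    using decomp[OF that] that by (simp add: f_cl pr_tens E'.cl_eq elem)
  have pr_elem: "pr1 (emb p + y_gen * emb q) = p" "pr2 (emb p + y_gen * emb q) = q" for p q
    by (simp_all add: pr_add pr_y)
  have iso: "f \<in> ring_iso (trivial_extension E) E'"
  proof (rule ring_iso_memI)
    fix x x' assume "x \<in> carrier (trivial_extension E)" "x' \<in> carrier (trivial_extension E)"
    then obtain p q p' q' where x: "x = (cl p, cl q)" "x' = (cl p', cl q')"
      and t: "p \<in> tens X" "q \<in> tens X" "p' \<in> tens X" "q' \<in> tens X"
      unfolding carr by blast
    show "f x \<in> carrier E'"
      using t by (auto simp: x f_cl E'.Q_carrier elem)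
    show "f (x \<oplus>\<^bsub>trivial_extension E\<^esub> x') = f x \<oplus>\<^bsub>E'\<^esub> f x'"
      using t by (simp add: x trivial_extension_def E.Q_add f_cl E'.Q_add elem emb_add algebra_simps)
    have "x \<otimes>\<^bsub>trivial_extension E\<^esub> x' = (cl (p * p'), cl (sgn_twist p * q' + q * p'))"
      using t by (simp add: x trivial_extension_def sgn_cl E.Q_add E.Q_mult sgn_twist_tens)
    then have "f (x \<otimes>\<^bsub>trivial_extension E\<^esub> x') =
        cl' (emb (p * p') + y_gen * emb (sgn_twist p * q' + q * p'))"
      using t by (simp add: f_cl sgn_twist_tens)
    also have "\<dots> = cl' ((emb p + y_gen * emb q) * (emb p' + y_gen * emb q'))"
    proof -
      let ?d = "\<lambda>p. emb p * y_gen - y_gen * emb (sgn_twist p)"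
      have "?d p * emb q' + y_gen * (?d q * emb q') + (y_gen * y_gen) * (emb (sgn_twist q) * emb q') \<in> J"
        using t y
        by (intro Jc(2) Jc(3)[OF Jc(4)[OF comm_y]] Jc(4)[OF comm_y] Jc(4)[OF yy])
          (auto intro!: emb_tens sgn_twist_tens)
      moreover have "(emb p + y_gen * emb q) * (emb p' + y_gen * emb q') -
          (emb (p * p') + y_gen * emb (sgn_twist p * q' + q * p')) =
        ?d p * emb q' + y_gen * (?d q * emb q') + (y_gen * y_gen) * (emb (sgn_twist q) * emb q')"
        by (simp add: emb_add emb_mult algebra_simps)
      ultimately have "cl' ((emb p + y_gen * emb q) * (emb p' + y_gen * emb q')) =
          cl' (emb (p * p') + y_gen * emb (sgn_twist p * q' + q * p'))"
        using t y by (subst E'.cl_eq) (simp_all add: emb_tens sgn_twist_tens)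
      then show ?thesis by simp
    qed
    also have "\<dots> = f x \<otimes>\<^bsub>E'\<^esub> f x'"
      using t by (simp add: x f_cl E'.Q_mult elem)
    finally show "f (x \<otimes>\<^bsub>trivial_extension E\<^esub> x') = f x \<otimes>\<^bsub>E'\<^esub> f x'" .
  next
    show "f \<one>\<^bsub>trivial_extension E\<^esub> = \<one>\<^bsub>E'\<^esub>"
      by (simp add: trivial_extension_def E.Q_one E.Q_zero E'.Q_one f_cl)
  next
    show "bij_betw f (carrier (trivial_extension E)) (carrier E')"
    proof (rule bij_betw_imageI)
      show "inj_on f (carrier (trivial_extension E))"
      proof (rule inj_onI)
        fix x x' assume "x \<in> carrier (trivial_extension E)" "x' \<in> carrier (trivial_extension E)"
          and eq: "f x = f x'"
        then obtain p q p' q' where x: "x = (cl p, cl q)" "x' = (cl p', cl q')"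
          and t: "p \<in> tens X" "q \<in> tens X" "p' \<in> tens X" "q' \<in> tens X"
          unfolding carr by blast
        have "(emb p + y_gen * emb q) - (emb p' + y_gen * emb q') \<in> J"
          using eq t by (simp add: x f_cl E'.cl_eq elem)
        from pr_J[OF this] have "p - p' \<in> I" "q - q' \<in> I"
          unfolding pr_diff pr_elem by simp_all
        then show "x = x'"
          using t by (simp add: x E.cl_eq)
      qed
      show "f ` carrier (trivial_extension E) = carrier E'"
      proof
        show "f ` carrier (trivial_extension E) \<subseteq> carrier E'"
          by (auto simp: carr f_cl E'.Q_carrier elem)
        show "carrier E' \<subseteq> f ` carrier (trivial_extension E)"
          using surj pr_tens by (fastforce simp: carr E'.Q_carrier image_iff)
      qed
    qed
  qed
  have smult: "f (c \<odot>\<^bsub>trivial_extension E\<^esub> x) = c \<odot>\<^bsub>E'\<^esub> f x"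
    if "x \<in> carrier (trivial_extension E)" for c x
    using that unfolding carr
    by (auto simp: trivial_extension_def E.Q_smult E'.Q_smult f_cl elem emb_scal
        scal_add_right scal_mult_right)
  have homog: "f ` homog (trivial_extension E) n = homog E' n" for n
  proof -
    have hom: "homog (trivial_extension E) n = {(cl p, cl q) | p q. p \<in> hom_tens X n \<and> q \<in> hom_tens X (n - 1)}"
      by (auto simp: trivial_extension_def E.Q_homog T_def homog_tensor_algebra)
    have hom': "homog E' n = cl' ` hom_tens ?X' n"
      by (simp add: E'.Q_homog T'_def homog_tensor_algebra)
    have yh: "y_gen \<in> hom_tens ?X' 1"
      by (rule hom_tens_gen) (simp add: ext_basis_def)
    have "emb p + y_gen * emb q \<in> hom_tens ?X' n" if "p \<in> hom_tens X n" "q \<in> hom_tens X (n - 1)" for p q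
      using hom_tens_mult[OF yh emb_hom_tens[OF that(2)]] emb_hom_tens[OF that(1)]
      by (simp add: hom_tens_add)
    then have "f ` homog (trivial_extension E) n \<subseteq> homog E' n"
      by (auto simp: hom hom' f_cl hom_tens_tens)
    moreover have "homog E' n \<subseteq> f ` homog (trivial_extension E) n"
    proof
      fix C assume "C \<in> homog E' n"
      then obtain s where s: "s \<in> hom_tens ?X' n" "C = cl' s"
        by (auto simp: hom')
      then have "C = f (cl (pr1 s), cl (pr2 s))"
        using surj hom_tens_tens by blast
      then show "C \<in> f ` homog (trivial_extension E) n"
        using pr_hom_tens[OF s(1)] by (auto simp: hom)
    qed
    ultimately show ?thesis by blast
  qed
  show thesis
    by (rule that[OF iso smult homog])
      (use f_cl in \<open>simp_all add: cl_def cl'_def I_def J_def\<close>)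
qed


end

theory Submission
  imports Defs
begin

text \<open>
  Let \<open>B = E(\<theta>)\<close> and let \<open>y\<close>, \<open>z\<close> be the two adjoined odd generators of the double extension. They
  satisfy \<open>y\<^sup>2 = z\<^sup>2 = 1\<close> and anticommute with each other and with \<open>V\<close>, so that \<open>\<i>yz\<close> is an even
  involution commuting with \<open>V\<close>, while \<open>y\<close> exchanges the even idempotents \<open>e = (1 + \<i>yz)/2\<close> and
  \<open>1 - e\<close>. Hence the deformed double extension is the algebra of \<open>2 \<times> 2\<close> matrices over \<open>B\<close> with
  off-diagonal entries of odd degree, and \<open>N \<mapsto> Ne\<close> and \<open>M \<mapsto> M \<oplus> M(1)\<close> are quasi-inverse functors.
  Both categories are abelian: as \<open>E\<close> is finite dimensional, \<open>B\<close> is spanned by words of bounded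
  length, hence noetherian, and the noetherian property passes to matrices.
\<close>

section \<open>Modules graded by \<open>\<int>\<^sub>2\<close>\<close>

text \<open>The factor \<i> compensates (yz)^2 = - y^2 z^2 = -1. In terms of Pauli matrices, y is
  represented by sigma_x, z by - sigma_y and x in V by x sigma_z. This explains the anticommutation
  relations, and \<i>yz becomes diag(1, -1). No basis of E or B is available, so the matrix algebra
  cannot be recognised by comparing bases. Instead \<open>entry\<close> is an algebra map from the
  free algebra to matrices over T(V) that sends the relations of the double extension to matrices
  over the ideal defining B; conversely every tensor is, modulo the relations, the sum of its
  entries placed at matrix units. The first fact makes the map to matrices over B well defined, the
  second makes it injective, and the matrix units make it surjective. Words of bounded length span B
  because long words lie in (R), as E is graded and finite dimensional, and modulo the elements r -
  \<theta>(r) every use of a relation lowers the length. The objects of both categories have their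
  elements in one type, so new modules must be encoded there: quotients by representatives, pairs by
  an injection.\<close>

declare add_bit_eq_xor [simp del]

lemma bit_cases [case_names 0 1]:
  fixes g :: bit
  obtains "g = 0" | "g = 1"
  by (cases "g = 0") (auto simp: bit_not_zero_iff)

lemma all_bit: "(\<forall>g :: bit. P g) \<longleftrightarrow> P 0 \<and> P 1"
  by (metis bit_cases)

lemma UNIV_bit: "(UNIV :: bit set) = {0, 1}"
  by (auto elim: bit_cases)

text \<open>The rewriting of sums in \<open>bit\<close> to exclusive or is switched off above, so
  that degrees are compared by the laws of an abelian group together with this one.\<close>

lemma bit_add_self [simp]: "g + g = (0 :: bit)"
  by (cases g rule: bit_cases) (simp_all add: add_bit_eq_xor)

text \<open>A grading by two degrees without families of finite support: the splitting gives
  existence of components, the trivial intersection gives uniqueness. The group is kept apart from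
  the action because subsets and pairs are later equipped with an action of another ring.\<close>

locale z2_group = abelian_group M for M :: "(bit, 's, 'm) graded" (structure) +
  assumes homog_closed: "x \<in> homog M g \<Longrightarrow> x \<in> carrier M"
    and homog_zero: "\<zero> \<in> homog M g"
    and homog_add: "\<lbrakk>x \<in> homog M g; y \<in> homog M g\<rbrakk> \<Longrightarrow> x \<oplus> y \<in> homog M g"
    and homog_minus: "x \<in> homog M g \<Longrightarrow> \<ominus> x \<in> homog M g"
    and homog_split: "x \<in> carrier M \<Longrightarrow> \<exists>x0\<in>homog M 0. \<exists>x1\<in>homog M 1. x = x0 \<oplus> x1"
    and homog_disjoint: "\<lbrakk>x \<in> homog M 0; x \<in> homog M 1\<rbrakk> \<Longrightarrow> x = \<zero>"
begin

lemma homog_splitE: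
  assumes "x \<in> carrier M"
  obtains x0 x1 where "x0 \<in> homog M 0" "x1 \<in> homog M 1" "x0 \<in> carrier M" "x1 \<in> carrier M"
    "x = x0 \<oplus> x1"
  using homog_split[OF assms] homog_closed by blast

lemma homog_splitE':
  assumes "x \<in> carrier M"
  obtains y z where "y \<in> homog M g" "z \<in> homog M (g + 1)" "y \<in> carrier M" "z \<in> carrier M"
    "x = y \<oplus> z"
proof -
  from homog_splitE[OF assms] obtain x0 x1 where *: "x0 \<in> homog M 0" "x1 \<in> homog M 1"
    "x0 \<in> carrier M" "x1 \<in> carrier M" "x = x0 \<oplus> x1" .
  show thesis
    by (cases g rule: bit_cases) (use * that[of x0 x1] that[of x1 x0] in \<open>auto simp: a_comm\<close>)
qed

lemma homog_disjoint': "x \<in> homog M g \<Longrightarrow> x \<in> homog M (g + 1) \<Longrightarrow> x = \<zero>"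
  by (cases g rule: bit_cases) (auto intro: homog_disjoint)

lemma homog_diff: "\<lbrakk>x \<in> homog M g; y \<in> homog M g\<rbrakk> \<Longrightarrow> x \<ominus> y \<in> homog M g"
  by (simp add: a_minus_def homog_add homog_minus)

lemma add_diff_cancel: "\<lbrakk>a \<in> carrier M; b \<in> carrier M\<rbrakk> \<Longrightarrow> (a \<oplus> b) \<ominus> a = b"
  by (simp add: a_minus_def a_comm[of a b] a_assoc r_neg)

lemma group_minus_zero: "\<ominus> \<zero> = \<zero>"
  by (rule minus_equality) simp_all

lemma diff_diff_sum:
  "\<lbrakk>a \<in> carrier M; b \<in> carrier M; c \<in> carrier M; d \<in> carrier M\<rbrakk> \<Longrightarrow>
    (a \<oplus> b) \<ominus> (c \<oplus> d) = (a \<ominus> c) \<oplus> (b \<ominus> d)"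
  by (simp add: a_minus_def minus_add a_ac)

lemma diff_eq_zero: "\<lbrakk>a \<in> carrier M; b \<in> carrier M\<rbrakk> \<Longrightarrow> a \<ominus> b = \<zero> \<longleftrightarrow> a = b"
  by (metis a_minus_def minus_equality minus_minus r_neg a_inv_closed)

lemma homog_unique:
  assumes "x \<in> homog M 0" "y \<in> homog M 1" "x' \<in> homog M 0" "y' \<in> homog M 1"
    and eq: "x \<oplus> y = x' \<oplus> y'"
  shows "x = x'" "y = y'"
proof -
  have c: "x \<in> carrier M" "y \<in> carrier M" "x' \<in> carrier M" "y' \<in> carrier M"
    using assms homog_closed by blast+
  have "(x \<ominus> x') \<oplus> (y \<ominus> y') = \<zero>"
    using eq c diff_diff_sum[of x y x' y'] diff_eq_zero[of "x \<oplus> y" "x' \<oplus> y'"] by simp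
  then have e: "x \<ominus> x' = \<ominus> (y \<ominus> y')"
    using c minus_equality[of "x \<ominus> x'" "y \<ominus> y'"] by simp
  have d: "x \<ominus> x' \<in> homog M 0" "\<ominus> (y \<ominus> y') \<in> homog M 1"
    using assms by (auto intro: homog_diff homog_minus)
  then have "x \<ominus> x' = \<zero>"
    using homog_disjoint[OF d(1)] e by simp
  then show "x = x'" using c diff_eq_zero by simp
  then have "y \<ominus> y' = \<zero>"
    using \<open>(x \<ominus> x') \<oplus> (y \<ominus> y') = \<zero>\<close> \<open>x \<ominus> x' = \<zero>\<close> c by simp
  then show "y = y'" using c diff_eq_zero by simp
qed

end

text \<open>Negatives are requested as mere existence: for a newly built record
  \<open>\<ominus>\<close> can be computed only once the group laws are established.\<close>

lemma z2_groupI: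
  fixes M :: "(bit, 's, 'm) graded" (structure)
  assumes "\<And>x y. \<lbrakk>x \<in> carrier M; y \<in> carrier M\<rbrakk> \<Longrightarrow> x \<oplus> y \<in> carrier M"
    and "\<And>x y z. \<lbrakk>x \<in> carrier M; y \<in> carrier M; z \<in> carrier M\<rbrakk> \<Longrightarrow> (x \<oplus> y) \<oplus> z = x \<oplus> (y \<oplus> z)"
    and "\<And>x y. \<lbrakk>x \<in> carrier M; y \<in> carrier M\<rbrakk> \<Longrightarrow> x \<oplus> y = y \<oplus> x"
    and "\<And>x. x \<in> carrier M \<Longrightarrow> \<zero> \<oplus> x = x"
    and inv: "\<And>x. x \<in> carrier M \<Longrightarrow> \<exists>y \<in> carrier M. y \<oplus> x = \<zero>"
    and homog: "\<And>x g. x \<in> homog M g \<Longrightarrow> x \<in> carrier M"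
    and zero: "\<And>g. \<zero> \<in> homog M g"
    and "\<And>x y g. \<lbrakk>x \<in> homog M g; y \<in> homog M g\<rbrakk> \<Longrightarrow> x \<oplus> y \<in> homog M g"
    and minus: "\<And>x g. x \<in> homog M g \<Longrightarrow> \<exists>y\<in>homog M g. y \<oplus> x = \<zero>"
    and "\<And>x. x \<in> carrier M \<Longrightarrow> \<exists>x0\<in>homog M 0. \<exists>x1\<in>homog M 1. x = x0 \<oplus> x1"
    and "\<And>x. \<lbrakk>x \<in> homog M 0; x \<in> homog M 1\<rbrakk> \<Longrightarrow> x = \<zero>"
  shows "z2_group M"
proof -
  interpret abelian_group M
    by (rule abelian_groupI) (use assms in auto)
  show ?thesis
  proof
    fix x g assume "x \<in> homog M g"
    with minus obtain y where "y \<in> homog M g" "y \<oplus> x = \<zero>" by blast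
    then show "\<ominus> x \<in> homog M g"
      using minus_equality homog \<open>x \<in> homog M g\<close> by metis
  qed (use assms in auto)
qed

locale z2_rmod = A?: ring A + M?: z2_group M
  for A :: "(bit, complex, 'a) graded" (structure)
    and M :: "(bit, 'a, 'm) graded" (structure) +
  assumes act_closed: "\<lbrakk>a \<in> carrier A; m \<in> carrier M\<rbrakk> \<Longrightarrow> a \<odot>\<^bsub>M\<^esub> m \<in> carrier M"
    and act_add_left: "\<lbrakk>a \<in> carrier A; b \<in> carrier A; m \<in> carrier M\<rbrakk>
      \<Longrightarrow> (a \<oplus>\<^bsub>A\<^esub> b) \<odot>\<^bsub>M\<^esub> m = a \<odot>\<^bsub>M\<^esub> m \<oplus>\<^bsub>M\<^esub> b \<odot>\<^bsub>M\<^esub> m"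
    and act_add_right: "\<lbrakk>a \<in> carrier A; m \<in> carrier M; n \<in> carrier M\<rbrakk>
      \<Longrightarrow> a \<odot>\<^bsub>M\<^esub> (m \<oplus>\<^bsub>M\<^esub> n) = a \<odot>\<^bsub>M\<^esub> m \<oplus>\<^bsub>M\<^esub> a \<odot>\<^bsub>M\<^esub> n"
    and act_mult: "\<lbrakk>a \<in> carrier A; b \<in> carrier A; m \<in> carrier M\<rbrakk>
      \<Longrightarrow> (a \<otimes>\<^bsub>A\<^esub> b) \<odot>\<^bsub>M\<^esub> m = b \<odot>\<^bsub>M\<^esub> (a \<odot>\<^bsub>M\<^esub> m)"
    and act_one: "m \<in> carrier M \<Longrightarrow> \<one>\<^bsub>A\<^esub> \<odot>\<^bsub>M\<^esub> m = m"
    and homog_act: "\<lbrakk>a \<in> homog A g; m \<in> homog M h\<rbrakk> \<Longrightarrow> a \<odot>\<^bsub>M\<^esub> m \<in> homog M (h + g)"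

text \<open>The sum runs over an unknown subset of the two degrees; the degrees left out contribute
  zero.\<close>

lemma finsum_bit_support:
  fixes f :: "bit \<Rightarrow> 'm"
  assumes "abelian_monoid M" "\<And>g. f g \<in> carrier M"
  shows "(\<Oplus>\<^bsub>M\<^esub>g\<in>{g. f g \<noteq> \<zero>\<^bsub>M\<^esub>}. f g) = f 0 \<oplus>\<^bsub>M\<^esub> f 1"
proof -
  interpret abelian_monoid M by fact
  have "{g. f g \<noteq> \<zero>\<^bsub>M\<^esub>} = (if f 0 = \<zero>\<^bsub>M\<^esub> then {} else {0}) \<union> (if f 1 = \<zero>\<^bsub>M\<^esub> then {} else {1})"
    unfolding set_eq_iff all_bit by simp
  moreover have "(\<Oplus>\<^bsub>M\<^esub>g\<in>{0, 1}. f g) = f 0 \<oplus>\<^bsub>M\<^esub> f 1"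
    using assms(2) by simp
  ultimately show ?thesis
    using assms(2) by (auto simp: a_comm)
qed

lemma graded_right_module_iff:
  fixes A :: "(bit, complex, 'a) graded" and M :: "(bit, 'a, 'm) graded"
  shows "graded_right_module A M \<longleftrightarrow> z2_rmod A M"
proof
  assume "graded_right_module A M"
  then interpret graded_right_module A M .
  have h: "homog M g \<subseteq> carrier M" "\<zero>\<^bsub>M\<^esub> \<in> homog M g" for g
    using subgroup.subset[OF homog_subgroup[of g]] subgroup.one_closed[OF homog_subgroup[of g]]
    by auto
  have dec: "\<exists>!f. (\<forall>g. f g \<in> homog M g) \<and> m = f 0 \<oplus>\<^bsub>M\<^esub> f 1" if "m \<in> carrier M" for m
  proof -
    have "(\<forall>g. f g \<in> homog M g) \<and> finite {g. f g \<noteq> \<zero>\<^bsub>M\<^esub>} \<and>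
        m = (\<Oplus>\<^bsub>M\<^esub>g\<in>{g. f g \<noteq> \<zero>\<^bsub>M\<^esub>}. f g) \<longleftrightarrow>
      (\<forall>g. f g \<in> homog M g) \<and> m = f 0 \<oplus>\<^bsub>M\<^esub> f 1" for f
      using finsum_bit_support[OF M.abelian_monoid_axioms, of f] h
      by (metis (no_types, lifting) finite.simps UNIV_bit finite_subset subset_UNIV subsetD)
    then show ?thesis
      using homog_decomposition[OF that] by simp
  qed
  show "z2_rmod A M"
  proof (intro z2_rmod.intro z2_group.intro z2_group_axioms.intro z2_rmod_axioms.intro)
    fix x assume "x \<in> carrier M"
    from ex1_implies_ex[OF dec[OF this]]
    show "\<exists>x0\<in>homog M 0. \<exists>x1\<in>homog M 1. x = x0 \<oplus>\<^bsub>M\<^esub> x1" by blast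
  next
    fix x assume x: "x \<in> homog M 0" "x \<in> homog M 1"
    then have c: "x \<in> carrier M" using h by blast
    \<comment> \<open>An element of both degrees has the two decompositions x + 0 and 0 + x, which
      must coincide.\<close>
    define f1 where "f1 = (\<lambda>g::bit. if g = 0 then x else \<zero>\<^bsub>M\<^esub>)"
    define f2 where "f2 = (\<lambda>g::bit. if g = 0 then \<zero>\<^bsub>M\<^esub> else x)"
    have "f1 = f2"
    proof (rule ex1E[OF dec[OF c]])
      fix f assume u: "\<forall>f'. (\<forall>g. f' g \<in> homog M g) \<and> x = f' 0 \<oplus>\<^bsub>M\<^esub> f' 1 \<longrightarrow> f' = f"
      have "f1 = f" using u x h c by (auto simp: f1_def)
      moreover have "f2 = f" using u x h c by (auto simp: f2_def)
      ultimately show ?thesis by simp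
    qed
    then have "f1 0 = f2 0" by simp
    then show "x = \<zero>\<^bsub>M\<^esub>" by (simp add: f1_def f2_def)
  next
    fix x g assume x: "x \<in> homog M g"
    show "\<ominus>\<^bsub>M\<^esub> x \<in> homog M g"
      using subgroup.m_inv_closed[OF homog_subgroup x] by (simp add: a_inv_def)
  next
    fix x y g assume "x \<in> homog M g" "y \<in> homog M g"
    then show "x \<oplus>\<^bsub>M\<^esub> y \<in> homog M g"
      using subgroup.m_closed[OF homog_subgroup] by fastforce
  qed (use h act_closed act_add_left act_add_right act_mult act_one homog_act in
      \<open>auto intro: A.ring_axioms M.abelian_group_axioms\<close>)
next
  assume "z2_rmod A M"
  then interpret z2_rmod A M .
  show "graded_right_module A M"
  proof (intro graded_right_module.intro graded_right_module_axioms.intro)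
    fix g
    have "homog M g \<noteq> {}"
      using homog_zero by blast
    then show "subgroup (homog M g) (add_monoid M)"
      by (intro M.add.subgroupI)
        (use homog_closed homog_zero homog_add homog_minus in \<open>auto simp: a_inv_def[symmetric]\<close>)
  next
    fix m assume m: "m \<in> carrier M"
    have iff: "(\<forall>g. f g \<in> homog M g) \<and> finite {g. f g \<noteq> \<zero>\<^bsub>M\<^esub>} \<and>
        m = (\<Oplus>\<^bsub>M\<^esub>g\<in>{g. f g \<noteq> \<zero>\<^bsub>M\<^esub>}. f g) \<longleftrightarrow>
      (\<forall>g. f g \<in> homog M g) \<and> m = f 0 \<oplus>\<^bsub>M\<^esub> f 1" for f
      using finsum_bit_support[OF M.abelian_monoid_axioms, of f] homog_closed
      by (metis (no_types, lifting) finite.simps UNIV_bit finite_subset subset_UNIV)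
    from homog_splitE[OF m] obtain x0 x1 where x: "x0 \<in> homog M 0" "x1 \<in> homog M 1"
      "x0 \<in> carrier M" "x1 \<in> carrier M" "m = x0 \<oplus>\<^bsub>M\<^esub> x1" .
    show "\<exists>!f. (\<forall>g. f g \<in> homog M g) \<and> finite {g. f g \<noteq> \<zero>\<^bsub>M\<^esub>} \<and>
        m = (\<Oplus>\<^bsub>M\<^esub>g\<in>{g. f g \<noteq> \<zero>\<^bsub>M\<^esub>}. f g)"
      unfolding iff
    proof (rule ex1I[of _ "\<lambda>g. if g = 0 then x0 else x1"])
      show "(\<forall>g. (if g = 0 then x0 else x1) \<in> homog M g) \<and>
          m = (if (0::bit) = 0 then x0 else x1) \<oplus>\<^bsub>M\<^esub> (if (1::bit) = 0 then x0 else x1)"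
        using x by (auto simp: bit_not_zero_iff)
    next
      fix f assume f: "(\<forall>g. f g \<in> homog M g) \<and> m = f 0 \<oplus>\<^bsub>M\<^esub> f 1"
      have "f 0 = x0" "f 1 = x1"
        using homog_unique[of "f 0" "f 1" x0 x1] f x by auto
      then show "f = (\<lambda>g. if g = 0 then x0 else x1)"
        by (auto elim: bit_cases)
    qed
  qed (use act_closed act_add_left act_add_right act_mult act_one homog_act in
      \<open>auto intro: A.ring_axioms M.abelian_group_axioms\<close>)
qed

section \<open>Submodules and generation\<close>

definition submod ::
    "('g, complex, 'a) graded \<Rightarrow> ('g, 'a, 'm) graded \<Rightarrow> 'm set \<Rightarrow> bool" where
  "submod A M L \<longleftrightarrow> L \<subseteq> carrier M \<and> \<zero>\<^bsub>M\<^esub> \<in> L \<and> (\<forall>x\<in>L. \<forall>y\<in>L. x \<oplus>\<^bsub>M\<^esub> y \<in> L) \<and>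
    (\<forall>a\<in>carrier A. \<forall>x\<in>L. a \<odot>\<^bsub>M\<^esub> x \<in> L)"

text \<open>Phrased through submodules rather than linear combinations: generation then passes to
  images, direct sums, corners and pairs by pulling submodules back, with no finite sums to handle.
  \<open>finitely_generated_iff\<close> connects the two descriptions.\<close>

definition generates ::
    "('g, complex, 'a) graded \<Rightarrow> ('g, 'a, 'm) graded \<Rightarrow> 'm set \<Rightarrow> 'm set \<Rightarrow> bool" where
  "generates A M S N \<longleftrightarrow> S \<subseteq> N \<and> (\<forall>L. submod A M L \<longrightarrow> S \<subseteq> L \<longrightarrow> N \<subseteq> L)"

definition graded_subset :: "(bit, 'a, 'm) graded \<Rightarrow> 'm set \<Rightarrow> bool" where
  "graded_subset M L \<longleftrightarrow> (\<forall>x\<in>homog M 0. \<forall>y\<in>homog M 1. x \<oplus>\<^bsub>M\<^esub> y \<in> L \<longrightarrow> x \<in> L \<and> y \<in> L)"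

context z2_rmod
begin

lemma act_zero_right: "a \<in> carrier A \<Longrightarrow> a \<odot>\<^bsub>M\<^esub> \<zero>\<^bsub>M\<^esub> = \<zero>\<^bsub>M\<^esub>"
  using act_add_right[of a "\<zero>\<^bsub>M\<^esub>" "\<zero>\<^bsub>M\<^esub>"] act_closed[of a "\<zero>\<^bsub>M\<^esub>"]
  by (metis M.add.l_cancel_one' M.l_zero M.zero_closed)

lemma act_zero_left: "m \<in> carrier M \<Longrightarrow> \<zero>\<^bsub>A\<^esub> \<odot>\<^bsub>M\<^esub> m = \<zero>\<^bsub>M\<^esub>"
  using act_add_left[of "\<zero>\<^bsub>A\<^esub>" "\<zero>\<^bsub>A\<^esub>" m] act_closed[of "\<zero>\<^bsub>A\<^esub>" m]
  by (metis M.add.l_cancel_one' A.l_zero A.zero_closed)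

lemma act_minus_left: "\<lbrakk>a \<in> carrier A; m \<in> carrier M\<rbrakk> \<Longrightarrow> (\<ominus>\<^bsub>A\<^esub> a) \<odot>\<^bsub>M\<^esub> m = \<ominus>\<^bsub>M\<^esub> (a \<odot>\<^bsub>M\<^esub> m)"
  using act_add_left[of "\<ominus>\<^bsub>A\<^esub> a" a m] act_zero_left[of m]
  by (metis A.a_inv_closed A.l_neg M.minus_equality act_closed)

lemma act_minus_right: "\<lbrakk>a \<in> carrier A; m \<in> carrier M\<rbrakk> \<Longrightarrow> a \<odot>\<^bsub>M\<^esub> (\<ominus>\<^bsub>M\<^esub> m) = \<ominus>\<^bsub>M\<^esub> (a \<odot>\<^bsub>M\<^esub> m)"
  using act_add_right[of a "\<ominus>\<^bsub>M\<^esub> m" m] act_zero_right[of a]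
  by (metis M.a_inv_closed M.l_neg M.minus_equality act_closed)

lemma act_diff: "\<lbrakk>a \<in> carrier A; m \<in> carrier M; n \<in> carrier M\<rbrakk>
    \<Longrightarrow> a \<odot>\<^bsub>M\<^esub> (m \<ominus>\<^bsub>M\<^esub> n) = a \<odot>\<^bsub>M\<^esub> m \<ominus>\<^bsub>M\<^esub> a \<odot>\<^bsub>M\<^esub> n"
  by (simp add: a_minus_def act_add_right act_minus_right)

text \<open>Negatives come from the scalar -1, which is why \<open>submod\<close> does not list
  them.\<close>

lemma submod_minus: "\<lbrakk>submod A M L; x \<in> L\<rbrakk> \<Longrightarrow> \<ominus>\<^bsub>M\<^esub> x \<in> L"
  using act_minus_left[of "\<one>\<^bsub>A\<^esub>" x] act_one[of x] unfolding submod_def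
  by (metis A.a_inv_closed A.one_closed subsetD)

lemma submod_carrier: "submod A M (carrier M)"
  by (simp add: submod_def act_closed)

lemma submod_finsum:
  assumes "submod A M L" "finite S" "\<And>s. s \<in> S \<Longrightarrow> f s \<in> L"
  shows "(\<Oplus>\<^bsub>M\<^esub>s\<in>S. f s) \<in> L"
  using assms(2,3)
proof (induction S)
  case empty
  then show ?case using assms(1) by (simp add: submod_def)
next
  case (insert s S)
  moreover have "f \<in> S \<rightarrow> carrier M" "f s \<in> carrier M"
    using insert assms(1) by (auto simp: submod_def)
  ultimately show ?case using assms(1) by (simp add: submod_def)
qed

lemma act_finsum:
  assumes "a \<in> carrier A" "finite S" "f \<in> S \<rightarrow> carrier M"
  shows "a \<odot>\<^bsub>M\<^esub> (\<Oplus>\<^bsub>M\<^esub>s\<in>S. f s) = (\<Oplus>\<^bsub>M\<^esub>s\<in>S. a \<odot>\<^bsub>M\<^esub> f s)"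
  using assms(2,3)
proof (induction S)
  case empty
  then show ?case using assms(1) by (simp add: act_zero_right)
next
  case (insert s S)
  moreover have "(\<lambda>s. a \<odot>\<^bsub>M\<^esub> f s) \<in> S \<rightarrow> carrier M" "a \<odot>\<^bsub>M\<^esub> f s \<in> carrier M"
    using insert assms(1) by (auto intro: act_closed)
  ultimately show ?case using assms(1) by (simp add: act_add_right)
qed

text \<open>The linear combinations of \<open>S\<close> form a submodule that contains
  \<open>S\<close> and lies in every submodule containing \<open>S\<close>.\<close>

lemma finitely_generated_iff:
  "finitely_generated_rmod A M \<longleftrightarrow> (\<exists>S. finite S \<and> generates A M S (carrier M))"
proof
  assume "finitely_generated_rmod A M"
  then obtain S where S: "finite S" "S \<subseteq> carrier M"
    "\<And>m. m \<in> carrier M \<Longrightarrow> \<exists>a\<in>S \<rightarrow> carrier A. m = (\<Oplus>\<^bsub>M\<^esub>s\<in>S. a s \<odot>\<^bsub>M\<^esub> s)"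
    unfolding finitely_generated_rmod_def by blast
  have "m \<in> L" if L: "submod A M L" "S \<subseteq> L" and m: "m \<in> carrier M" for m L
  proof -
    obtain a where a: "a \<in> S \<rightarrow> carrier A" "m = (\<Oplus>\<^bsub>M\<^esub>s\<in>S. a s \<odot>\<^bsub>M\<^esub> s)"
      using S(3)[OF m] by blast
    show ?thesis
      unfolding a(2) using L a(1) S(1) by (intro submod_finsum) (auto simp: submod_def Pi_iff subset_iff)
  qed
  then show "\<exists>S. finite S \<and> generates A M S (carrier M)"
    unfolding generates_def using S by blast
next
  assume "\<exists>S. finite S \<and> generates A M S (carrier M)"
  then obtain S where S: "finite S" "S \<subseteq> carrier M"
    "\<And>L. submod A M L \<Longrightarrow> S \<subseteq> L \<Longrightarrow> carrier M \<subseteq> L"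
    unfolding generates_def by blast
  define L where "L = {(\<Oplus>\<^bsub>M\<^esub>s\<in>S. a s \<odot>\<^bsub>M\<^esub> s) | a. a \<in> S \<rightarrow> carrier A}"
  have c: "(\<lambda>s. a s \<odot>\<^bsub>M\<^esub> s) \<in> S \<rightarrow> carrier M" if "a \<in> S \<rightarrow> carrier A" for a
    using that S(2) by (auto intro: act_closed)
  have "submod A M L"
    unfolding submod_def
  proof (intro conjI ballI)
    show "L \<subseteq> carrier M"
      unfolding L_def using c by (auto intro!: M.finsum_closed)
    have "(\<Oplus>\<^bsub>M\<^esub>s\<in>S. \<zero>\<^bsub>A\<^esub> \<odot>\<^bsub>M\<^esub> s) = (\<Oplus>\<^bsub>M\<^esub>s\<in>S. \<zero>\<^bsub>M\<^esub>)"
      using S(2) by (intro M.finsum_cong') (auto simp: act_zero_left)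
    then have "\<zero>\<^bsub>M\<^esub> = (\<Oplus>\<^bsub>M\<^esub>s\<in>S. (\<lambda>_. \<zero>\<^bsub>A\<^esub>) s \<odot>\<^bsub>M\<^esub> s)"
      by simp
    then show "\<zero>\<^bsub>M\<^esub> \<in> L"
      unfolding L_def mem_Collect_eq by (intro exI conjI) auto
  next
    fix x y assume "x \<in> L" "y \<in> L"
    then obtain a b where ab: "a \<in> S \<rightarrow> carrier A" "b \<in> S \<rightarrow> carrier A"
      and xy: "x = (\<Oplus>\<^bsub>M\<^esub>s\<in>S. a s \<odot>\<^bsub>M\<^esub> s)" "y = (\<Oplus>\<^bsub>M\<^esub>s\<in>S. b s \<odot>\<^bsub>M\<^esub> s)"
      unfolding L_def by blast
    have "x \<oplus>\<^bsub>M\<^esub> y = (\<Oplus>\<^bsub>M\<^esub>s\<in>S. a s \<odot>\<^bsub>M\<^esub> s \<oplus>\<^bsub>M\<^esub> b s \<odot>\<^bsub>M\<^esub> s)"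
      unfolding xy using c[OF ab(1)] c[OF ab(2)] by (rule M.finsum_addf[symmetric])
    also have "\<dots> = (\<Oplus>\<^bsub>M\<^esub>s\<in>S. (\<lambda>s. a s \<oplus>\<^bsub>A\<^esub> b s) s \<odot>\<^bsub>M\<^esub> s)"
    proof (rule M.finsum_cong')
      show "(\<lambda>s. (\<lambda>s. a s \<oplus>\<^bsub>A\<^esub> b s) s \<odot>\<^bsub>M\<^esub> s) \<in> S \<rightarrow> carrier M"
        by (rule c) (use ab in auto)
      show "a s \<odot>\<^bsub>M\<^esub> s \<oplus>\<^bsub>M\<^esub> b s \<odot>\<^bsub>M\<^esub> s = (a s \<oplus>\<^bsub>A\<^esub> b s) \<odot>\<^bsub>M\<^esub> s" if "s \<in> S" for s
        using that ab S(2) by (subst act_add_left) auto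
    qed simp
    finally show "x \<oplus>\<^bsub>M\<^esub> y \<in> L"
      unfolding L_def mem_Collect_eq
      by (intro exI[of _ "\<lambda>s. a s \<oplus>\<^bsub>A\<^esub> b s"] conjI) (use ab in auto)
  next
    fix b x assume b: "b \<in> carrier A" and "x \<in> L"
    then obtain a where a: "a \<in> S \<rightarrow> carrier A" and x: "x = (\<Oplus>\<^bsub>M\<^esub>s\<in>S. a s \<odot>\<^bsub>M\<^esub> s)"
      unfolding L_def by blast
    have "b \<odot>\<^bsub>M\<^esub> x = (\<Oplus>\<^bsub>M\<^esub>s\<in>S. b \<odot>\<^bsub>M\<^esub> (a s \<odot>\<^bsub>M\<^esub> s))"
      unfolding x by (rule act_finsum[OF b S(1) c[OF a]])
    also have "\<dots> = (\<Oplus>\<^bsub>M\<^esub>s\<in>S. (\<lambda>s. a s \<otimes>\<^bsub>A\<^esub> b) s \<odot>\<^bsub>M\<^esub> s)"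
    proof (rule M.finsum_cong')
      show "(\<lambda>s. (\<lambda>s. a s \<otimes>\<^bsub>A\<^esub> b) s \<odot>\<^bsub>M\<^esub> s) \<in> S \<rightarrow> carrier M"
        by (rule c) (use a b in auto)
      show "b \<odot>\<^bsub>M\<^esub> (a s \<odot>\<^bsub>M\<^esub> s) = (a s \<otimes>\<^bsub>A\<^esub> b) \<odot>\<^bsub>M\<^esub> s" if "s \<in> S" for s
        using that a b S(2) by (subst act_mult) auto
    qed simp
    finally show "b \<odot>\<^bsub>M\<^esub> x \<in> L"
      unfolding L_def mem_Collect_eq by (intro exI[of _ "\<lambda>s. a s \<otimes>\<^bsub>A\<^esub> b"] conjI) (use a b in auto)
  qed
  moreover have "S \<subseteq> L"
  proof
    fix s assume s: "s \<in> S"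
    have "s = (\<Oplus>\<^bsub>M\<^esub>t\<in>S. if s = t then t else \<zero>\<^bsub>M\<^esub>)"
      using s S(1,2) by (subst M.add.finprod_singleton[of s S "\<lambda>t. t"]) auto
    also have "\<dots> = (\<Oplus>\<^bsub>M\<^esub>t\<in>S. (\<lambda>t. if s = t then \<one>\<^bsub>A\<^esub> else \<zero>\<^bsub>A\<^esub>) t \<odot>\<^bsub>M\<^esub> t)"
      using S(2) by (intro M.finsum_cong') (auto simp: act_zero_left act_one subset_iff)
    finally show "s \<in> L"
      unfolding L_def mem_Collect_eq
      by (intro exI[of _ "\<lambda>t. if s = t then \<one>\<^bsub>A\<^esub> else \<zero>\<^bsub>A\<^esub>"] conjI) auto
  qed
  ultimately have "carrier M \<subseteq> L" by (rule S(3))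
  then show "finitely_generated_rmod A M"
    unfolding finitely_generated_rmod_def using S(1,2) unfolding L_def
    by (intro exI[of _ S]) blast
qed

end

subsection \<open>Homomorphisms\<close>

lemma graded_homI:
  assumes "f \<in> extensional (carrier M)"
    and "\<And>m. m \<in> carrier M \<Longrightarrow> f m \<in> carrier N"
    and "\<And>m n. \<lbrakk>m \<in> carrier M; n \<in> carrier M\<rbrakk> \<Longrightarrow> f (m \<oplus>\<^bsub>M\<^esub> n) = f m \<oplus>\<^bsub>N\<^esub> f n"
    and "\<And>a m. \<lbrakk>a \<in> carrier A; m \<in> carrier M\<rbrakk> \<Longrightarrow> f (a \<odot>\<^bsub>M\<^esub> m) = a \<odot>\<^bsub>N\<^esub> f m"
    and "\<And>g m. m \<in> homog M g \<Longrightarrow> f m \<in> homog N g"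
  shows "f \<in> graded_hom A M N"
  using assms by (auto simp: graded_hom_def PiE_def)

lemma graded_homD:
  assumes "f \<in> graded_hom A M N"
  shows "f \<in> extensional (carrier M)"
    and "m \<in> carrier M \<Longrightarrow> f m \<in> carrier N"
    and "\<lbrakk>m \<in> carrier M; n \<in> carrier M\<rbrakk> \<Longrightarrow> f (m \<oplus>\<^bsub>M\<^esub> n) = f m \<oplus>\<^bsub>N\<^esub> f n"
    and "\<lbrakk>a \<in> carrier A; m \<in> carrier M\<rbrakk> \<Longrightarrow> f (a \<odot>\<^bsub>M\<^esub> m) = a \<odot>\<^bsub>N\<^esub> f m"
    and "m \<in> homog M g \<Longrightarrow> f m \<in> homog N g"
  using assms by (auto simp: graded_hom_def PiE_def image_subset_iff)

locale z2_hom = X: z2_rmod A X + Y: z2_rmod A Y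
  for A :: "(bit, complex, 'a) graded" and X :: "(bit, 'a, 'm) graded"
    and Y :: "(bit, 'a, 'n) graded" +
  fixes f :: "'m \<Rightarrow> 'n"
  assumes graded_hom: "f \<in> graded_hom A X Y"
begin

lemma hom_closed: "x \<in> carrier X \<Longrightarrow> f x \<in> carrier Y"
  and hom_add: "\<lbrakk>x \<in> carrier X; y \<in> carrier X\<rbrakk> \<Longrightarrow> f (x \<oplus>\<^bsub>X\<^esub> y) = f x \<oplus>\<^bsub>Y\<^esub> f y"
  and hom_act: "\<lbrakk>a \<in> carrier A; x \<in> carrier X\<rbrakk> \<Longrightarrow> f (a \<odot>\<^bsub>X\<^esub> x) = a \<odot>\<^bsub>Y\<^esub> f x"
  and hom_homog: "x \<in> homog X g \<Longrightarrow> f x \<in> homog Y g"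
  and hom_ext: "f \<in> extensional (carrier X)"
  using graded_homD[OF graded_hom] by auto

lemma hom_zero: "f \<zero>\<^bsub>X\<^esub> = \<zero>\<^bsub>Y\<^esub>"
  using hom_act[of "\<zero>\<^bsub>A\<^esub>" "\<zero>\<^bsub>X\<^esub>"] hom_closed[of "\<zero>\<^bsub>X\<^esub>"]
  by (simp add: X.act_zero_left Y.act_zero_left)

lemma hom_minus: "x \<in> carrier X \<Longrightarrow> f (\<ominus>\<^bsub>X\<^esub> x) = \<ominus>\<^bsub>Y\<^esub> f x"
  using hom_add[of "\<ominus>\<^bsub>X\<^esub> x" x]
  by (metis X.M.a_inv_closed X.M.l_neg Y.M.minus_equality hom_closed hom_zero)

lemma hom_diff: "\<lbrakk>x \<in> carrier X; y \<in> carrier X\<rbrakk> \<Longrightarrow> f (x \<ominus>\<^bsub>X\<^esub> y) = f x \<ominus>\<^bsub>Y\<^esub> f y"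
  by (simp add: a_minus_def hom_add hom_minus)

lemma homog_preimage:
  assumes x: "x \<in> carrier X" and h: "f x \<in> homog Y g"
  shows "\<exists>y\<in>homog X g. f y = f x"
proof -
  from X.homog_splitE'[OF x, of g] obtain y z where yz: "y \<in> homog X g" "z \<in> homog X (g + 1)"
    "y \<in> carrier X" "z \<in> carrier X" "x = y \<oplus>\<^bsub>X\<^esub> z" .
  then have e: "f x = f y \<oplus>\<^bsub>Y\<^esub> f z" by (simp add: hom_add)
  then have "f z = f x \<ominus>\<^bsub>Y\<^esub> f y"
    using Y.add_diff_cancel[of "f y" "f z"] yz hom_closed[of y] hom_closed[of z] by simp
  then have "f z \<in> homog Y g"
    using h yz(1) by (auto intro: Y.homog_diff hom_homog)
  then have "f z = \<zero>\<^bsub>Y\<^esub>"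
    using hom_homog[OF yz(2)] Y.homog_disjoint' by blast
  then show ?thesis
    using e yz hom_closed[of y] by auto
qed

lemma submod_kernel: "submod A X {x \<in> carrier X. f x = \<zero>\<^bsub>Y\<^esub>}"
  by (auto simp: submod_def hom_zero hom_add hom_act X.act_closed Y.act_zero_right)

lemma graded_kernel: "graded_subset X {x \<in> carrier X. f x = \<zero>\<^bsub>Y\<^esub>}"
  unfolding graded_subset_def
proof (intro ballI impI)
  fix x y assume xy: "x \<in> homog X 0" "y \<in> homog X 1" and "x \<oplus>\<^bsub>X\<^esub> y \<in> {x \<in> carrier X. f x = \<zero>\<^bsub>Y\<^esub>}"
  then have c: "x \<in> carrier X" "y \<in> carrier X" and "f x \<oplus>\<^bsub>Y\<^esub> f y = \<zero>\<^bsub>Y\<^esub> \<oplus>\<^bsub>Y\<^esub> \<zero>\<^bsub>Y\<^esub>"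
    using X.homog_closed by (auto simp: hom_add)
  from Y.homog_unique[OF hom_homog[OF xy(1)] hom_homog[OF xy(2)] Y.homog_zero Y.homog_zero this(3)]
  show "x \<in> {x \<in> carrier X. f x = \<zero>\<^bsub>Y\<^esub>} \<and> y \<in> {x \<in> carrier X. f x = \<zero>\<^bsub>Y\<^esub>}"
    using c by simp
qed

lemma submod_image:
  assumes "submod A X L" shows "submod A Y (f ` L)"
  unfolding submod_def
proof (intro conjI ballI)
  have L: "L \<subseteq> carrier X" using assms by (simp add: submod_def)
  show "f ` L \<subseteq> carrier Y" using L hom_closed by auto
  show "\<zero>\<^bsub>Y\<^esub> \<in> f ` L" using assms hom_zero unfolding submod_def by (metis imageI)
  show "u \<oplus>\<^bsub>Y\<^esub> v \<in> f ` L" if uv: "u \<in> f ` L" "v \<in> f ` L" for u v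
  proof -
    obtain x y where xy: "x \<in> L" "y \<in> L" "u = f x" "v = f y" using uv by blast
    then have "u \<oplus>\<^bsub>Y\<^esub> v = f (x \<oplus>\<^bsub>X\<^esub> y)" using L by (simp add: hom_add subset_iff)
    moreover have "x \<oplus>\<^bsub>X\<^esub> y \<in> L" using assms xy by (simp add: submod_def)
    ultimately show ?thesis by simp
  qed
  show "a \<odot>\<^bsub>Y\<^esub> u \<in> f ` L" if au: "a \<in> carrier A" "u \<in> f ` L" for a u
  proof -
    obtain x where x: "x \<in> L" "u = f x" using au by blast
    then have "a \<odot>\<^bsub>Y\<^esub> u = f (a \<odot>\<^bsub>X\<^esub> x)" using L au by (simp add: hom_act subset_iff)
    moreover have "a \<odot>\<^bsub>X\<^esub> x \<in> L" using assms au x by (simp add: submod_def)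
    ultimately show ?thesis by simp
  qed
qed

lemma submod_preimage:
  assumes "submod A Y L" shows "submod A X {x \<in> carrier X. f x \<in> L}"
  using assms by (auto simp: submod_def hom_zero hom_add hom_act X.act_closed)

lemma graded_image: "graded_subset Y (f ` carrier X)"
  unfolding graded_subset_def
proof (intro ballI impI)
  fix u v assume uv: "u \<in> homog Y 0" "v \<in> homog Y 1" and "u \<oplus>\<^bsub>Y\<^esub> v \<in> f ` carrier X"
  then obtain x where x: "x \<in> carrier X" "u \<oplus>\<^bsub>Y\<^esub> v = f x" by auto
  from X.homog_splitE[OF x(1)] obtain x0 x1 where xs: "x0 \<in> homog X 0" "x1 \<in> homog X 1"
    "x0 \<in> carrier X" "x1 \<in> carrier X" "x = x0 \<oplus>\<^bsub>X\<^esub> x1" .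
  then have "u \<oplus>\<^bsub>Y\<^esub> v = f x0 \<oplus>\<^bsub>Y\<^esub> f x1" using x by (simp add: hom_add)
  from Y.homog_unique[OF uv hom_homog[OF xs(1)] hom_homog[OF xs(2)] this]
  show "u \<in> f ` carrier X \<and> v \<in> f ` carrier X" using xs by simp
qed

lemma inj_on_iff_kernel: "inj_on f (carrier X) \<longleftrightarrow> (\<forall>x\<in>carrier X. f x = \<zero>\<^bsub>Y\<^esub> \<longrightarrow> x = \<zero>\<^bsub>X\<^esub>)"
proof
  assume inj: "inj_on f (carrier X)"
  show "\<forall>x\<in>carrier X. f x = \<zero>\<^bsub>Y\<^esub> \<longrightarrow> x = \<zero>\<^bsub>X\<^esub>"
  proof (intro ballI impI)
    fix x assume "x \<in> carrier X" "f x = \<zero>\<^bsub>Y\<^esub>"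
    then show "x = \<zero>\<^bsub>X\<^esub>"
      by (intro inj_onD[OF inj]) (simp_all add: hom_zero)
  qed
next
  assume *: "\<forall>x\<in>carrier X. f x = \<zero>\<^bsub>Y\<^esub> \<longrightarrow> x = \<zero>\<^bsub>X\<^esub>"
  show "inj_on f (carrier X)"
  proof (rule inj_onI)
    fix x y assume c: "x \<in> carrier X" "y \<in> carrier X" and e: "f x = f y"
    have "f (x \<ominus>\<^bsub>X\<^esub> y) = \<zero>\<^bsub>Y\<^esub>"
      unfolding hom_diff[OF c] Y.diff_eq_zero[OF hom_closed[OF c(1)] hom_closed[OF c(2)]] by (rule e)
    then have "x \<ominus>\<^bsub>X\<^esub> y = \<zero>\<^bsub>X\<^esub>" using * c by simp
    then show "x = y" unfolding X.diff_eq_zero[OF c] .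
  qed
qed

lemma generates_image:
  assumes S: "generates A X S (carrier X)" and "f ` carrier X = carrier Y"
  shows "generates A Y (f ` S) (carrier Y)"
  unfolding generates_def
proof (intro conjI allI impI)
  have c: "S \<subseteq> carrier X"
    using S unfolding generates_def by (rule conjunct1)
  have min: "carrier X \<subseteq> L" if "submod A X L" "S \<subseteq> L" for L
    using S that unfolding generates_def by simp
  show "f ` S \<subseteq> carrier Y" by (rule image_subsetI) (use c in \<open>auto intro: hom_closed\<close>)
  fix L assume L: "submod A Y L" "f ` S \<subseteq> L"
  have "carrier X \<subseteq> {x \<in> carrier X. f x \<in> L}"
    by (rule min[OF submod_preimage[OF L(1)]]) (use c L(2) in \<open>simp add: image_subset_iff subset_iff\<close>)
  then show "carrier Y \<subseteq> L" unfolding assms(2)[symmetric] by auto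
qed

end

lemma z2_hom_iff: "z2_hom A X Y f \<longleftrightarrow> z2_rmod A X \<and> z2_rmod A Y \<and> f \<in> graded_hom A X Y"
  by (auto simp: z2_hom_def z2_hom_axioms_def)

lemma graded_hom_eqI:
  assumes "f \<in> graded_hom A M N" "f' \<in> graded_hom A M N"
    and "\<And>x. x \<in> carrier M \<Longrightarrow> f x = f' x"
  shows "f = f'"
  using assms by (intro extensionalityI[of f "carrier M"]) (auto simp: graded_hom_def PiE_def)

lemma graded_hom_compose:
  assumes "f \<in> graded_hom A L M" "g \<in> graded_hom A M N" "z2_rmod A L"
  shows "compose (carrier L) g f \<in> graded_hom A L N"
proof -
  interpret L: z2_rmod A L by fact
  note f = graded_homD[OF assms(1)] and g = graded_homD[OF assms(2)]
  show ?thesis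
    by (rule graded_homI)
      (simp_all add: compose_def f g L.act_closed L.homog_closed)
qed

lemma graded_hom_zero:
  assumes "z2_rmod A M" "z2_rmod A N"
  shows "(\<lambda>m\<in>carrier M. \<zero>\<^bsub>N\<^esub>) \<in> graded_hom A M N"
proof -
  interpret M: z2_rmod A M by fact
  interpret N: z2_rmod A N by fact
  show ?thesis
    by (rule graded_homI) (auto simp: M.act_closed N.act_zero_right M.homog_closed N.homog_zero)
qed

subsection \<open>Submodules, images and direct sums\<close>

text \<open>The action is a parameter: a submodule keeps \<open>smult M\<close>, whereas the corner
  of a module becomes a module over a different ring.\<close>

definition sub_rmod :: "('g, 's, 'm) graded \<Rightarrow> 'm set \<Rightarrow> ('t \<Rightarrow> 'm \<Rightarrow> 'm) \<Rightarrow> ('g, 't, 'm) graded" where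
  "sub_rmod M L act = \<lparr>carrier = L, mult = undefined, one = undefined, zero = \<zero>\<^bsub>M\<^esub>, add = add M,
    smult = act, homog = (\<lambda>g. homog M g \<inter> L)\<rparr>"

lemma sub_rmod_simps [simp]:
  "carrier (sub_rmod M L act) = L" "zero (sub_rmod M L act) = \<zero>\<^bsub>M\<^esub>"
  "add (sub_rmod M L act) = add M" "smult (sub_rmod M L act) = act"
  "homog (sub_rmod M L act) g = homog M g \<inter> L"
  by (simp_all add: sub_rmod_def)

lemma (in z2_group) z2_group_sub_rmod:
  assumes L: "L \<subseteq> carrier M" "\<zero> \<in> L" "\<And>x y. \<lbrakk>x \<in> L; y \<in> L\<rbrakk> \<Longrightarrow> x \<oplus> y \<in> L"
    "\<And>x. x \<in> L \<Longrightarrow> \<ominus> x \<in> L" and "graded_subset M L"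
  shows "z2_group (sub_rmod M L act)"
proof (rule z2_groupI)
  fix x assume "x \<in> carrier (sub_rmod M L act)"
  then have x: "x \<in> L" "x \<in> carrier M" using L by auto
  from homog_splitE[OF x(2)] obtain x0 x1 where xs: "x0 \<in> homog M 0" "x1 \<in> homog M 1" "x = x0 \<oplus> x1" .
  then have "x0 \<in> L" "x1 \<in> L" using assms(5) x by (auto simp: graded_subset_def)
  then show "\<exists>x0\<in>homog (sub_rmod M L act) 0. \<exists>x1\<in>homog (sub_rmod M L act) 1.
      x = x0 \<oplus>\<^bsub>sub_rmod M L act\<^esub> x1"
    using xs by auto
  show "\<exists>y\<in>carrier (sub_rmod M L act). y \<oplus>\<^bsub>sub_rmod M L act\<^esub> x = \<zero>\<^bsub>sub_rmod M L act\<^esub>"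
    by (rule bexI[of _ "\<ominus> x"]) (use L(4)[OF x(1)] x in \<open>auto simp: l_neg\<close>)
next
  fix x g assume "x \<in> homog (sub_rmod M L act) g"
  then show "\<exists>y\<in>homog (sub_rmod M L act) g. y \<oplus>\<^bsub>sub_rmod M L act\<^esub> x = \<zero>\<^bsub>sub_rmod M L act\<^esub>"
    by (intro bexI[of _ "\<ominus> x"])
      (use L(4)[of x] homog_minus[of x g] homog_closed[of x g] in \<open>auto simp: l_neg\<close>)
qed (use L homog_zero homog_add homog_disjoint in \<open>auto simp: subset_iff a_ac\<close>)

lemma (in z2_rmod) z2_rmod_sub_rmod:
  assumes "\<And>g. homog A g \<subseteq> carrier A" "submod A M L" "graded_subset M L"
  shows "z2_rmod A (sub_rmod M L (smult M))"
proof (intro z2_rmod.intro z2_rmod_axioms.intro)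
  show "z2_group (sub_rmod M L (smult M))"
    by (rule z2_group_sub_rmod) (use assms submod_minus in \<open>auto simp: submod_def\<close>)
  show "a \<odot>\<^bsub>sub_rmod M L (smult M)\<^esub> m \<in> homog (sub_rmod M L (smult M)) (h + g)"
    if "a \<in> homog A g" "m \<in> homog (sub_rmod M L (smult M)) h" for a m g h
    using that assms(1)[of g] assms(2) homog_act[of a g m h] by (auto simp: submod_def)
qed (use assms in \<open>auto simp: submod_def subset_iff act_add_left act_add_right act_mult act_one
    intro: A.ring_axioms\<close>)

lemma (in z2_rmod) generates_sub_rmod:
  assumes "submod A M L" "generates A M S L"
  shows "generates A (sub_rmod M L (smult M)) S L"
  unfolding generates_def
proof (intro conjI allI impI)
  show "S \<subseteq> L" using assms(2) by (simp add: generates_def)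
  fix K assume "submod A (sub_rmod M L (smult M)) K" "S \<subseteq> K"
  moreover from this have "submod A M K"
    using assms(1) by (auto simp: submod_def)
  ultimately show "L \<subseteq> K" using assms(2) by (simp add: generates_def)
qed

text \<open>The image of a module under a map whose fibres are the cosets of a graded submodule: this
  gives quotients inside the same type (\<open>\<pi>\<close> chooses representatives) as well as isomorphic copies
  in another type (\<open>\<pi>\<close> injective).\<close>

definition image_rmod :: "('m \<Rightarrow> 'n) \<Rightarrow> ('g, 's, 'm) graded \<Rightarrow> ('g, 's, 'n) graded" where
  "image_rmod \<pi> M = (let iv = inv_into (carrier M) \<pi> in
    \<lparr>carrier = \<pi> ` carrier M, mult = undefined, one = undefined, zero = \<pi> \<zero>\<^bsub>M\<^esub>,
    add = (\<lambda>p q. \<pi> (iv p \<oplus>\<^bsub>M\<^esub> iv q)), smult = (\<lambda>a p. \<pi> (a \<odot>\<^bsub>M\<^esub> iv p)), homog = (\<lambda>g. \<pi> ` homog M g)\<rparr>)"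

lemma image_rmod_simps:
  "carrier (image_rmod \<pi> M) = \<pi> ` carrier M" "zero (image_rmod \<pi> M) = \<pi> \<zero>\<^bsub>M\<^esub>"
  "homog (image_rmod \<pi> M) g = \<pi> ` homog M g"
  by (simp_all add: image_rmod_def Let_def)

locale rmod_image = z2_rmod A M
  for A :: "(bit, complex, 'a) graded" and M :: "(bit, 'a, 'm) graded" +
  fixes \<pi> :: "'m \<Rightarrow> 'n" and K :: "'m set"
  assumes homog_subset: "homog A g \<subseteq> carrier A"
    and K: "submod A M K" "graded_subset M K"
    and \<pi>_eq: "\<lbrakk>m \<in> carrier M; n \<in> carrier M\<rbrakk> \<Longrightarrow> \<pi> m = \<pi> n \<longleftrightarrow> m \<ominus>\<^bsub>M\<^esub> n \<in> K"
begin

text \<open>The operations of \<open>image_rmod\<close> are computed at representatives chosen by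
  \<open>inv_into\<close>. These differ from the given ones by elements of K, and a submodule
  absorbs such differences.\<close>

lemma inv_\<pi>:
  assumes "m \<in> carrier M"
  defines "m' \<equiv> inv_into (carrier M) \<pi> (\<pi> m)"
  shows "m' \<in> carrier M" "m' \<ominus>\<^bsub>M\<^esub> m \<in> K"
proof -
  show "m' \<in> carrier M" unfolding m'_def by (rule inv_into_into) (use assms in auto)
  moreover have "\<pi> m' = \<pi> m" unfolding m'_def by (rule f_inv_into_f) (use assms in auto)
  ultimately show "m' \<ominus>\<^bsub>M\<^esub> m \<in> K" using \<pi>_eq assms(1) by blast
qed

lemma \<pi>_add:
  assumes "m \<in> carrier M" "n \<in> carrier M"
  shows "\<pi> m \<oplus>\<^bsub>image_rmod \<pi> M\<^esub> \<pi> n = \<pi> (m \<oplus>\<^bsub>M\<^esub> n)"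
proof -
  let ?iv = "\<lambda>m. inv_into (carrier M) \<pi> (\<pi> m)"
  have "(?iv m \<oplus>\<^bsub>M\<^esub> ?iv n) \<ominus>\<^bsub>M\<^esub> (m \<oplus>\<^bsub>M\<^esub> n) = (?iv m \<ominus>\<^bsub>M\<^esub> m) \<oplus>\<^bsub>M\<^esub> (?iv n \<ominus>\<^bsub>M\<^esub> n)"
    using assms inv_\<pi> by (intro diff_diff_sum)
  also have "\<dots> \<in> K" using K(1) inv_\<pi> assms unfolding submod_def by blast
  finally show ?thesis
    using assms inv_\<pi> by (simp add: image_rmod_def Let_def \<pi>_eq)
qed

lemma \<pi>_act:
  assumes "a \<in> carrier A" "m \<in> carrier M"
  shows "a \<odot>\<^bsub>image_rmod \<pi> M\<^esub> \<pi> m = \<pi> (a \<odot>\<^bsub>M\<^esub> m)"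
proof -
  let ?iv = "\<lambda>m. inv_into (carrier M) \<pi> (\<pi> m)"
  have "(a \<odot>\<^bsub>M\<^esub> ?iv m) \<ominus>\<^bsub>M\<^esub> (a \<odot>\<^bsub>M\<^esub> m) = a \<odot>\<^bsub>M\<^esub> (?iv m \<ominus>\<^bsub>M\<^esub> m)"
    using assms inv_\<pi> by (intro act_diff[symmetric])
  also have "\<dots> \<in> K" using K(1) inv_\<pi> assms unfolding submod_def by blast
  finally show ?thesis
    using assms inv_\<pi> by (simp add: image_rmod_def Let_def \<pi>_eq act_closed)
qed

lemma z2_rmod_image: "z2_rmod A (image_rmod \<pi> M)"
proof (intro z2_rmod.intro z2_rmod_axioms.intro)
  show "z2_group (image_rmod \<pi> M)"
  proof (rule z2_groupI)
    fix p assume "p \<in> carrier (image_rmod \<pi> M)"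
    then obtain m where m: "m \<in> carrier M" "p = \<pi> m" by (auto simp: image_rmod_simps)
    show "\<exists>q\<in>carrier (image_rmod \<pi> M). q \<oplus>\<^bsub>image_rmod \<pi> M\<^esub> p = \<zero>\<^bsub>image_rmod \<pi> M\<^esub>"
      using m unfolding image_rmod_simps
      by (intro bexI[of _ "\<pi> (\<ominus>\<^bsub>M\<^esub> m)"]) (auto simp: \<pi>_add M.l_neg)
    from homog_splitE[OF m(1)] obtain x0 x1 where xs: "x0 \<in> homog M 0" "x1 \<in> homog M 1"
      "x0 \<in> carrier M" "x1 \<in> carrier M" "m = x0 \<oplus>\<^bsub>M\<^esub> x1" .
    then show "\<exists>x0\<in>homog (image_rmod \<pi> M) 0. \<exists>x1\<in>homog (image_rmod \<pi> M) 1. p = x0 \<oplus>\<^bsub>image_rmod \<pi> M\<^esub> x1"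
      using m unfolding image_rmod_simps
      by (intro bexI[of _ "\<pi> x0"] bexI[of _ "\<pi> x1"]) (auto simp: \<pi>_add)
  next
    fix p g assume "p \<in> homog (image_rmod \<pi> M) g"
    then obtain m where m: "m \<in> homog M g" "p = \<pi> m" by (auto simp: image_rmod_simps)
    then show "\<exists>q\<in>homog (image_rmod \<pi> M) g. q \<oplus>\<^bsub>image_rmod \<pi> M\<^esub> p = \<zero>\<^bsub>image_rmod \<pi> M\<^esub>"
      using homog_closed[OF m(1)] homog_minus[OF m(1)] unfolding image_rmod_simps
      by (intro bexI[of _ "\<pi> (\<ominus>\<^bsub>M\<^esub> m)"]) (auto simp: \<pi>_add M.l_neg)
  next
    fix p assume "p \<in> homog (image_rmod \<pi> M) 0" "p \<in> homog (image_rmod \<pi> M) 1"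
    then obtain m n where mn: "m \<in> homog M 0" "p = \<pi> m" "n \<in> homog M 1" "p = \<pi> n"
      by (auto simp: image_rmod_simps)
    \<comment> \<open>A class that is both even and odd has representatives m and n with m - n in K;
      as K contains the components of its elements, m itself lies in K.\<close>
    then have "m \<oplus>\<^bsub>M\<^esub> (\<ominus>\<^bsub>M\<^esub> n) \<in> K"
      using \<pi>_eq[of m n] homog_closed by (auto simp: a_minus_def)
    then have "m \<in> K" using K(2) mn homog_minus unfolding graded_subset_def by blast
    then have "\<pi> m = \<pi> \<zero>\<^bsub>M\<^esub>"
      using mn(1) homog_closed[of m 0] by (subst \<pi>_eq) (auto simp: a_minus_def group_minus_zero)
    then show "p = \<zero>\<^bsub>image_rmod \<pi> M\<^esub>"
      using mn by (simp add: image_rmod_simps)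
  qed (auto simp: image_rmod_simps \<pi>_add M.a_ac homog_closed homog_zero homog_add)
  show "a \<odot>\<^bsub>image_rmod \<pi> M\<^esub> p \<in> homog (image_rmod \<pi> M) (h + g)"
    if a: "a \<in> homog A g" and p: "p \<in> homog (image_rmod \<pi> M) h" for a p g h
  proof -
    obtain m where m: "m \<in> homog M h" "p = \<pi> m" using p by (auto simp: image_rmod_simps)
    then show ?thesis
      using \<pi>_act[of a m] a homog_subset homog_closed homog_act[OF a m(1)]
      by (auto simp: image_rmod_simps)
  qed
qed (auto simp: image_rmod_simps \<pi>_add \<pi>_act act_closed act_add_left act_add_right act_mult act_one
    intro: A.ring_axioms)

lemma \<pi>_hom: "(\<lambda>m\<in>carrier M. \<pi> m) \<in> graded_hom A M (image_rmod \<pi> M)"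
  by (rule graded_homI) (auto simp: image_rmod_simps \<pi>_add \<pi>_act act_closed homog_closed)

lemma finitely_generated_image:
  assumes "finitely_generated_rmod A M"
  shows "finitely_generated_rmod A (image_rmod \<pi> M)"
proof -
  interpret I: z2_rmod A "image_rmod \<pi> M" by (rule z2_rmod_image)
  interpret h: z2_hom A M "image_rmod \<pi> M" "\<lambda>m\<in>carrier M. \<pi> m"
    by unfold_locales (rule \<pi>_hom)
  have "(\<lambda>m\<in>carrier M. \<pi> m) ` carrier M = carrier (image_rmod \<pi> M)"
    by (auto simp: image_rmod_simps)
  moreover obtain S where "finite S" "generates A M S (carrier M)"
    using assms unfolding finitely_generated_iff by blast
  ultimately show ?thesis
    unfolding I.finitely_generated_iff using h.generates_image finite_imageI by metis
qed

end

lemma (in z2_rmod) rmod_image_inj: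
  assumes "\<And>g. homog A g \<subseteq> carrier A" "inj_on \<pi> (carrier M)"
  shows "rmod_image A M \<pi> {\<zero>\<^bsub>M\<^esub>}"
proof
  show "submod A M {\<zero>\<^bsub>M\<^esub>}" by (simp add: submod_def act_zero_right)
  show "graded_subset M {\<zero>\<^bsub>M\<^esub>}"
    unfolding graded_subset_def
  proof (intro ballI impI)
    fix x y assume xy: "x \<in> homog M 0" "y \<in> homog M 1" "x \<oplus>\<^bsub>M\<^esub> y \<in> {\<zero>\<^bsub>M\<^esub>}"
    then show "x \<in> {\<zero>\<^bsub>M\<^esub>} \<and> y \<in> {\<zero>\<^bsub>M\<^esub>}"
      using homog_unique[OF xy(1,2) homog_zero homog_zero] by simp
  qed
  show "\<pi> m = \<pi> n \<longleftrightarrow> m \<ominus>\<^bsub>M\<^esub> n \<in> {\<zero>\<^bsub>M\<^esub>}" if "m \<in> carrier M" "n \<in> carrier M" for m n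
    using that diff_eq_zero inj_on_eq_iff[OF assms(2)] by simp
qed (rule assms(1))

text \<open>The action is left open because two kinds are needed: the componentwise one for
  biproducts, and one in which a matrix mixes the components.\<close>

definition dsum_rmod :: "('g, 's, 'm) graded \<Rightarrow> ('g, 't, 'n) graded \<Rightarrow> ('r \<Rightarrow> 'm \<times> 'n \<Rightarrow> 'm \<times> 'n)
    \<Rightarrow> ('g, 'r, 'm \<times> 'n) graded" where
  "dsum_rmod M N act = \<lparr>carrier = carrier M \<times> carrier N, mult = undefined, one = undefined,
    zero = (\<zero>\<^bsub>M\<^esub>, \<zero>\<^bsub>N\<^esub>), add = (\<lambda>p q. (fst p \<oplus>\<^bsub>M\<^esub> fst q, snd p \<oplus>\<^bsub>N\<^esub> snd q)),
    smult = act, homog = (\<lambda>g. homog M g \<times> homog N g)\<rparr>"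

lemma dsum_rmod_simps [simp]:
  "carrier (dsum_rmod M N act) = carrier M \<times> carrier N" "zero (dsum_rmod M N act) = (\<zero>\<^bsub>M\<^esub>, \<zero>\<^bsub>N\<^esub>)"
  "add (dsum_rmod M N act) p q = (fst p \<oplus>\<^bsub>M\<^esub> fst q, snd p \<oplus>\<^bsub>N\<^esub> snd q)"
  "smult (dsum_rmod M N act) = act" "homog (dsum_rmod M N act) g = homog M g \<times> homog N g"
  by (simp_all add: dsum_rmod_def)

lemma z2_group_dsum_rmod:
  assumes "z2_group M" "z2_group N"
  shows "z2_group (dsum_rmod M N act)"
proof -
  interpret M: z2_group M by fact
  interpret N: z2_group N by fact
  show ?thesis
  proof (rule z2_groupI)
    fix x assume "x \<in> carrier (dsum_rmod M N act)"
    then obtain m n where x: "m \<in> carrier M" "n \<in> carrier N" "x = (m, n)" by auto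
    from M.homog_splitE[OF x(1)] obtain m0 m1 where m: "m0 \<in> homog M 0" "m1 \<in> homog M 1" "m = m0 \<oplus>\<^bsub>M\<^esub> m1" .
    from N.homog_splitE[OF x(2)] obtain n0 n1 where n: "n0 \<in> homog N 0" "n1 \<in> homog N 1" "n = n0 \<oplus>\<^bsub>N\<^esub> n1" .
    show "\<exists>x0\<in>homog (dsum_rmod M N act) 0. \<exists>x1\<in>homog (dsum_rmod M N act) 1.
        x = x0 \<oplus>\<^bsub>dsum_rmod M N act\<^esub> x1"
      by (rule bexI[of _ "(m0, n0)"], rule bexI[of _ "(m1, n1)"]) (use x m n in auto)
    show "\<exists>y\<in>carrier (dsum_rmod M N act). y \<oplus>\<^bsub>dsum_rmod M N act\<^esub> x = \<zero>\<^bsub>dsum_rmod M N act\<^esub>"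
      by (rule bexI[of _ "(\<ominus>\<^bsub>M\<^esub> m, \<ominus>\<^bsub>N\<^esub> n)"]) (use x in \<open>auto simp: M.l_neg N.l_neg\<close>)
  next
    fix x g assume "x \<in> homog (dsum_rmod M N act) g"
    then obtain m n where x: "m \<in> homog M g" "n \<in> homog N g" "x = (m, n)" by auto
    show "\<exists>y\<in>homog (dsum_rmod M N act) g. y \<oplus>\<^bsub>dsum_rmod M N act\<^esub> x = \<zero>\<^bsub>dsum_rmod M N act\<^esub>"
      by (rule bexI[of _ "(\<ominus>\<^bsub>M\<^esub> m, \<ominus>\<^bsub>N\<^esub> n)"])
        (use x in \<open>auto simp: M.l_neg N.l_neg M.homog_closed N.homog_closed M.homog_minus N.homog_minus\<close>)
  qed (auto simp: M.a_ac N.a_ac M.homog_closed N.homog_closed M.homog_zero N.homog_zero M.homog_add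
      N.homog_add M.homog_disjoint N.homog_disjoint)
qed

lemma z2_rmod_dsum_rmod:
  assumes "z2_rmod A M" "z2_rmod A N"
  shows "z2_rmod A (dsum_rmod M N (\<lambda>a p. (a \<odot>\<^bsub>M\<^esub> fst p, a \<odot>\<^bsub>N\<^esub> snd p)))"
proof -
  interpret M: z2_rmod A M by fact
  interpret N: z2_rmod A N by fact
  show ?thesis
    by (intro z2_rmod.intro z2_rmod_axioms.intro z2_group_dsum_rmod)
      (auto intro: M.A.ring_axioms M.z2_group_axioms N.z2_group_axioms
        simp: M.act_closed N.act_closed M.act_add_left N.act_add_left M.act_add_right N.act_add_right
        M.act_mult N.act_mult M.act_one N.act_one M.homog_act N.homog_act)
qed

lemma finitely_generated_dsum_rmod:
  assumes "z2_rmod A M" "z2_rmod A N" "finitely_generated_rmod A M" "finitely_generated_rmod A N"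
  shows "finitely_generated_rmod A (dsum_rmod M N (\<lambda>a p. (a \<odot>\<^bsub>M\<^esub> fst p, a \<odot>\<^bsub>N\<^esub> snd p)))"
    (is "finitely_generated_rmod A ?D")
proof -
  interpret M: z2_rmod A M by fact
  interpret N: z2_rmod A N by fact
  interpret D: z2_rmod A ?D using assms by (intro z2_rmod_dsum_rmod)
  interpret i: z2_hom A M ?D "\<lambda>m\<in>carrier M. (m, \<zero>\<^bsub>N\<^esub>)"
    by unfold_locales
      (rule graded_homI; simp add: M.act_closed M.homog_closed N.act_zero_right N.homog_zero)
  interpret i': z2_hom A N ?D "\<lambda>n\<in>carrier N. (\<zero>\<^bsub>M\<^esub>, n)"
    by unfold_locales
      (rule graded_homI; simp add: N.act_closed N.homog_closed M.act_zero_right M.homog_zero)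
  obtain S T where S: "finite S" "generates A M S (carrier M)" and T: "finite T" "generates A N T (carrier N)"
    using assms M.finitely_generated_iff N.finitely_generated_iff by blast
  let ?U = "(\<lambda>s. (s, \<zero>\<^bsub>N\<^esub>)) ` S \<union> (\<lambda>t. (\<zero>\<^bsub>M\<^esub>, t)) ` T"
  have "generates A ?D ?U (carrier ?D)"
    unfolding generates_def
  proof (intro conjI allI impI)
    show "?U \<subseteq> carrier ?D" using S T by (auto simp: generates_def)
    fix L assume L: "submod A ?D L" "?U \<subseteq> L"
    have "S \<subseteq> {m \<in> carrier M. (\<lambda>m\<in>carrier M. (m, \<zero>\<^bsub>N\<^esub>)) m \<in> L}"
      using S(2) L(2) by (auto simp: generates_def)
    then have "carrier M \<subseteq> {m \<in> carrier M. (\<lambda>m\<in>carrier M. (m, \<zero>\<^bsub>N\<^esub>)) m \<in> L}"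
      using S(2) i.submod_preimage[OF L(1)] unfolding generates_def by blast
    then have 1: "(m, \<zero>\<^bsub>N\<^esub>) \<in> L" if "m \<in> carrier M" for m using that by auto
    have "T \<subseteq> {n \<in> carrier N. (\<lambda>n\<in>carrier N. (\<zero>\<^bsub>M\<^esub>, n)) n \<in> L}"
      using T(2) L(2) by (auto simp: generates_def)
    then have "carrier N \<subseteq> {n \<in> carrier N. (\<lambda>n\<in>carrier N. (\<zero>\<^bsub>M\<^esub>, n)) n \<in> L}"
      using T(2) i'.submod_preimage[OF L(1)] unfolding generates_def by blast
    then have 2: "(\<zero>\<^bsub>M\<^esub>, n) \<in> L" if "n \<in> carrier N" for n using that by auto
    have add: "p \<oplus>\<^bsub>?D\<^esub> q \<in> L" if "p \<in> L" "q \<in> L" for p q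
      using L(1) that unfolding submod_def by blast
    show "carrier ?D \<subseteq> L"
    proof
      fix p assume "p \<in> carrier ?D"
      then show "p \<in> L"
        using add[OF 1[of "fst p"] 2[of "snd p"]] by (auto simp: mem_Times_iff)
    qed
  qed
  then show ?thesis
    unfolding D.finitely_generated_iff using S(1) T(1) by (intro exI[of _ ?U]) auto
qed

subsection \<open>The category of finitely generated graded modules\<close>

definition fg_rmod :: "(bit, complex, 'a) graded \<Rightarrow> (bit, 'a, 'm) graded \<Rightarrow> bool" where
  "fg_rmod A M \<longleftrightarrow> z2_rmod A M \<and> finitely_generated_rmod A M"

lemma gr_cat_simps [simp]:
  fixes A :: "(bit, complex, 'a) graded"
  shows "M \<in> Ob (gr_cat A) \<longleftrightarrow> fg_rmod A M"
    and "Hom (gr_cat A) = graded_hom A"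
    and "Cmp (gr_cat A) X Y Z g f = compose (carrier X) g f"
    and "Idn (gr_cat A) X = (\<lambda>m\<in>carrier X. m)"
    and "HAdd (gr_cat A) X Y f g = (\<lambda>m\<in>carrier X. f m \<oplus>\<^bsub>Y\<^esub> g m)"
    and "HZero (gr_cat A) X Y = (\<lambda>m\<in>carrier X. \<zero>\<^bsub>Y\<^esub>)"
  by (simp_all add: gr_cat_def fg_rmod_def graded_right_module_iff)

lemma z2_homI: "\<lbrakk>fg_rmod A X; fg_rmod A Y; f \<in> graded_hom A X Y\<rbrakk> \<Longrightarrow> z2_hom A X Y f"
  by (simp add: z2_hom_iff fg_rmod_def)

lemma graded_hom_id:
  assumes "z2_rmod A M" shows "(\<lambda>m\<in>carrier M. m) \<in> graded_hom A M M"
proof -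
  interpret z2_rmod A M by fact
  show ?thesis by (rule graded_homI) (auto simp: act_closed homog_closed)
qed

section \<open>Composition, addition and exactness of morphisms\<close>

lemma category_gr_cat:
  fixes A :: "(bit, complex, 'a) graded"
  shows "category (gr_cat A)"
  unfolding category_def
proof (intro conjI ballI)
  fix W X Y Z :: "(bit, 'a, 'b) graded" and f g h
  assume o: "W \<in> Ob (gr_cat A)" "X \<in> Ob (gr_cat A)" "Y \<in> Ob (gr_cat A)" "Z \<in> Ob (gr_cat A)"
    and f: "f \<in> Hom (gr_cat A) W X" and g: "g \<in> Hom (gr_cat A) X Y" and h: "h \<in> Hom (gr_cat A) Y Z"
  note * = graded_homD(2)[OF f[unfolded gr_cat_simps]]
  show "Cmp (gr_cat A) W Y Z h (Cmp (gr_cat A) W X Y g f) =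
      Cmp (gr_cat A) W X Z (Cmp (gr_cat A) X Y Z h g) f"
    by (auto simp: compose_def * intro!: restrict_ext)
next
  fix X Y :: "(bit, 'a, 'b) graded" and f
  assume o: "X \<in> Ob (gr_cat A)" "Y \<in> Ob (gr_cat A)" and f: "f \<in> Hom (gr_cat A) X Y"
  note * = graded_homD(1,2)[OF f[unfolded gr_cat_simps]]
  show "Cmp (gr_cat A) X X Y f (Idn (gr_cat A) X) = f"
    "Cmp (gr_cat A) X Y Y (Idn (gr_cat A) Y) f = f"
    using * by (auto simp: compose_def extensional_def)
qed (auto simp: fg_rmod_def graded_hom_id graded_hom_compose)

lemma preadditive_gr_cat:
  fixes A :: "(bit, complex, 'a) graded"
  shows "preadditive (gr_cat A)"
  unfolding preadditive_def
proof (intro conjI ballI)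
  fix X Y :: "(bit, 'a, 'b) graded"
  assume o: "X \<in> Ob (gr_cat A)" "Y \<in> Ob (gr_cat A)"
  interpret X: z2_rmod A X using o by (simp add: fg_rmod_def)
  interpret Y: z2_rmod A Y using o by (simp add: fg_rmod_def)
  show "comm_group (hom_group (gr_cat A) X Y)"
  proof (rule comm_groupI)
    fix f assume "f \<in> carrier (hom_group (gr_cat A) X Y)"
    then have f: "f \<in> graded_hom A X Y" by (simp add: hom_group_def)
    note F = graded_homD[OF f]
    have "(\<lambda>m\<in>carrier X. \<ominus>\<^bsub>Y\<^esub> f m) \<in> graded_hom A X Y"
      by (rule graded_homI)
        (auto simp: F X.act_closed X.homog_closed Y.act_minus_right Y.M.minus_add Y.homog_minus)
    then show "\<exists>g\<in>carrier (hom_group (gr_cat A) X Y).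
        g \<otimes>\<^bsub>hom_group (gr_cat A) X Y\<^esub> f = \<one>\<^bsub>hom_group (gr_cat A) X Y\<^esub>"
      by (intro bexI[of _ "\<lambda>m\<in>carrier X. \<ominus>\<^bsub>Y\<^esub> f m"])
        (auto simp: hom_group_def F(2) Y.M.l_neg intro!: restrict_ext)
    show "\<one>\<^bsub>hom_group (gr_cat A) X Y\<^esub> \<otimes>\<^bsub>hom_group (gr_cat A) X Y\<^esub> f = f"
      using F(1) by (auto simp: hom_group_def F(2) fun_eq_iff extensional_def)
    fix g assume "g \<in> carrier (hom_group (gr_cat A) X Y)"
    then have g: "g \<in> graded_hom A X Y" by (simp add: hom_group_def)
    note G = graded_homD[OF g]
    have "(\<lambda>m\<in>carrier X. f m \<oplus>\<^bsub>Y\<^esub> g m) \<in> graded_hom A X Y"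
      by (rule graded_homI)
        (auto simp: F G X.act_closed X.homog_closed Y.act_add_right Y.M.a_ac Y.homog_add)
    then show "f \<otimes>\<^bsub>hom_group (gr_cat A) X Y\<^esub> g \<in> carrier (hom_group (gr_cat A) X Y)"
      by (simp add: hom_group_def)
    show "f \<otimes>\<^bsub>hom_group (gr_cat A) X Y\<^esub> g = g \<otimes>\<^bsub>hom_group (gr_cat A) X Y\<^esub> f"
      by (auto simp: hom_group_def F(2) G(2) Y.M.a_comm intro!: restrict_ext)
    fix h assume "h \<in> carrier (hom_group (gr_cat A) X Y)"
    then have h: "h \<in> graded_hom A X Y" by (simp add: hom_group_def)
    note H = graded_homD[OF h]
    show "f \<otimes>\<^bsub>hom_group (gr_cat A) X Y\<^esub> g \<otimes>\<^bsub>hom_group (gr_cat A) X Y\<^esub> h =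
        f \<otimes>\<^bsub>hom_group (gr_cat A) X Y\<^esub> (g \<otimes>\<^bsub>hom_group (gr_cat A) X Y\<^esub> h)"
      by (auto simp: hom_group_def F(2) G(2) H(2) Y.M.a_assoc intro!: restrict_ext)
  next
    show "\<one>\<^bsub>hom_group (gr_cat A) X Y\<^esub> \<in> carrier (hom_group (gr_cat A) X Y)"
      using o by (simp add: hom_group_def graded_hom_zero fg_rmod_def)
  qed
next
  fix X Y Z :: "(bit, 'a, 'b) graded" and f f' g g'
  assume o: "X \<in> Ob (gr_cat A)" "Y \<in> Ob (gr_cat A)" "Z \<in> Ob (gr_cat A)"
    and f: "f \<in> Hom (gr_cat A) X Y" "f' \<in> Hom (gr_cat A) X Y"
    and g: "g \<in> Hom (gr_cat A) Y Z" "g' \<in> Hom (gr_cat A) Y Z"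
  note * = f[unfolded gr_cat_simps, THEN graded_homD(2)] g[unfolded gr_cat_simps, THEN graded_homD(3)]
  show "Cmp (gr_cat A) X Y Z g (HAdd (gr_cat A) X Y f f') =
      HAdd (gr_cat A) X Z (Cmp (gr_cat A) X Y Z g f) (Cmp (gr_cat A) X Y Z g f')"
    "Cmp (gr_cat A) X Y Z (HAdd (gr_cat A) Y Z g g') f =
      HAdd (gr_cat A) X Z (Cmp (gr_cat A) X Y Z g f) (Cmp (gr_cat A) X Y Z g' f)"
    by (auto simp: compose_def * intro!: restrict_ext)
qed (rule category_gr_cat)

text \<open>The source of \<open>k\<close> is arbitrary, not necessarily a subset of X: in this form
  the lemma serves kernels, monomorphisms and isomorphisms alike. A morphism \<open>g\<close> killed
  by \<open>f\<close> factors as the pointwise inverse of \<open>k\<close> after \<open>g\<close>;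
  its degrees come from \<open>homog_preimage\<close>.\<close>

lemma is_kernel_gr_cat:
  fixes A :: "(bit, complex, 'a) graded"
  assumes "fg_rmod A X" "fg_rmod A Y" "fg_rmod A K" "f \<in> graded_hom A X Y" "k \<in> graded_hom A K X"
    and inj: "inj_on k (carrier K)"
    and ker: "k ` carrier K = {x \<in> carrier X. f x = \<zero>\<^bsub>Y\<^esub>}"
  shows "is_kernel (gr_cat A) X Y f K k"
  unfolding is_kernel_def
proof (intro conjI ballI impI)
  interpret k: z2_hom A K X k using assms by (intro z2_homI)
  show "K \<in> Ob (gr_cat A)" "k \<in> Hom (gr_cat A) K X" using assms by simp_all
  have "f (k x) = \<zero>\<^bsub>Y\<^esub>" if "x \<in> carrier K" for x
    using ker that by blast
  then show "Cmp (gr_cat A) K X Y f k = HZero (gr_cat A) K Y"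
    by (auto simp: compose_def intro!: restrict_ext)
  fix Z g assume Z: "Z \<in> Ob (gr_cat A)" and g: "g \<in> Hom (gr_cat A) Z X"
    and 0: "Cmp (gr_cat A) Z X Y f g = HZero (gr_cat A) Z Y"
  interpret g: z2_hom A Z X g using assms Z g by (intro z2_homI) simp_all
  define h where "h = (\<lambda>z\<in>carrier Z. inv_into (carrier K) k (g z))"
  have im: "g z \<in> k ` carrier K" if "z \<in> carrier Z" for z
  proof -
    have "f (g z) = \<zero>\<^bsub>Y\<^esub>"
      using fun_cong[OF 0, of z] that by (simp add: compose_def)
    then show ?thesis using ker g.hom_closed[OF that] by blast
  qed
  have h: "h z \<in> carrier K" "k (h z) = g z" if "z \<in> carrier Z" for z
    using im[OF that] that by (simp_all add: h_def inv_into_into f_inv_into_f)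
  have eqI: "x = y" if "x \<in> carrier K" "y \<in> carrier K" "k x = k y" for x y
    using inj_on_eq_iff[OF inj that(1,2)] that(3) by simp
  have "h \<in> graded_hom A Z K"
  proof (rule graded_homI)
    fix m n assume "m \<in> carrier Z" "n \<in> carrier Z"
    then show "h (m \<oplus>\<^bsub>Z\<^esub> n) = h m \<oplus>\<^bsub>K\<^esub> h n"
      by - (rule eqI, simp_all add: h k.hom_add g.hom_add)
  next
    fix a m assume "a \<in> carrier A" "m \<in> carrier Z"
    then show "h (a \<odot>\<^bsub>Z\<^esub> m) = a \<odot>\<^bsub>K\<^esub> h m"
      by - (rule eqI, simp_all add: h k.hom_act g.hom_act g.X.act_closed k.X.act_closed)
  next
    fix e m assume m: "m \<in> homog Z e"
    then have c: "m \<in> carrier Z" by (rule g.X.homog_closed)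
    then obtain y where y: "y \<in> homog K e" "k y = k (h m)"
      using k.homog_preimage[of "h m" e] g.hom_homog[OF m] h(1)[OF c] h(2)[OF c] by auto
    then have "y = h m" using c k.X.homog_closed[OF y(1)] by - (rule eqI, simp_all add: h)
    then show "h m \<in> homog K e" using y by simp
  qed (simp_all add: h, simp add: h_def)
  have kh: "compose (carrier Z) k h = g"
    by (rule extensionalityI[OF _ g.hom_ext]) (simp_all add: compose_def h)
  show "\<exists>!h. h \<in> Hom (gr_cat A) Z K \<and> Cmp (gr_cat A) Z K X k h = g"
    unfolding gr_cat_simps
  proof (intro ex1I[of _ h] conjI \<open>h \<in> _\<close> kh, elim conjE)
    fix h' assume h': "h' \<in> graded_hom A Z K" "compose (carrier Z) k h' = g"
    show "h' = h"
    proof (rule graded_hom_eqI[OF h'(1) \<open>h \<in> _\<close>])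
      fix z assume z: "z \<in> carrier Z"
      have "k (h' z) = g z" using fun_cong[OF h'(2), of z] z by (simp add: compose_def)
      then show "h' z = h z" using z by - (rule eqI, simp_all add: h graded_homD(2)[OF h'(1)])
    qed
  qed
qed

text \<open>A morphism \<open>g\<close> that kills the image of \<open>f\<close> is constant on the
  fibres of \<open>q\<close>, since two elements of a fibre differ by an element of that image;
  surjectivity makes the induced map total and unique.\<close>

lemma is_cokernel_gr_cat:
  fixes A :: "(bit, complex, 'a) graded"
  assumes "fg_rmod A X" "fg_rmod A Y" "fg_rmod A Q" "f \<in> graded_hom A X Y" "q \<in> graded_hom A Y Q"
    and surj: "q ` carrier Y = carrier Q"
    and ker: "{y \<in> carrier Y. q y = \<zero>\<^bsub>Q\<^esub>} = f ` carrier X"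
  shows "is_cokernel (gr_cat A) X Y f Q q"
  unfolding is_cokernel_def
proof (intro conjI ballI impI)
  interpret q: z2_hom A Y Q q using assms by (intro z2_homI)
  interpret f: z2_hom A X Y f using assms by (intro z2_homI)
  show "Q \<in> Ob (gr_cat A)" "q \<in> Hom (gr_cat A) Y Q" using assms by simp_all
  have "q (f x) = \<zero>\<^bsub>Q\<^esub>" if "x \<in> carrier X" for x
    using ker that by blast
  then show "Cmp (gr_cat A) X Y Q q f = HZero (gr_cat A) X Q"
    by (auto simp: compose_def intro!: restrict_ext)
  fix Z g assume Z: "Z \<in> Ob (gr_cat A)" and g: "g \<in> Hom (gr_cat A) Y Z"
    and 0: "Cmp (gr_cat A) X Y Z g f = HZero (gr_cat A) X Z"
  interpret g: z2_hom A Y Z g using assms Z g by (intro z2_homI) simp_all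
  have gf: "g (f x) = \<zero>\<^bsub>Z\<^esub>" if "x \<in> carrier X" for x
    using fun_cong[OF 0, of x] that by (simp add: compose_def)
  have eq: "g y = g y'" if y: "y \<in> carrier Y" "y' \<in> carrier Y" and e: "q y = q y'" for y y'
  proof -
    have "q (y \<ominus>\<^bsub>Y\<^esub> y') = \<zero>\<^bsub>Q\<^esub>"
      unfolding q.hom_diff[OF y] q.Y.diff_eq_zero[OF q.hom_closed[OF y(1)] q.hom_closed[OF y(2)]] by (rule e)
    then have "y \<ominus>\<^bsub>Y\<^esub> y' \<in> f ` carrier X"
      using y ker by auto
    then have "g (y \<ominus>\<^bsub>Y\<^esub> y') = \<zero>\<^bsub>Z\<^esub>" using gf by auto
    then show ?thesis
      unfolding g.hom_diff[OF y] g.Y.diff_eq_zero[OF g.hom_closed[OF y(1)] g.hom_closed[OF y(2)]] .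
  qed
  define h where "h = (\<lambda>p\<in>carrier Q. g (inv_into (carrier Y) q p))"
  have h: "h (q y) = g y" if "y \<in> carrier Y" for y
  proof -
    have y: "q y \<in> q ` carrier Y" using that by simp
    have "g (inv_into (carrier Y) q (q y)) = g y"
      by (rule eq[OF inv_into_into[OF y] that f_inv_into_f[OF y]])
    then show ?thesis using y surj by (simp add: h_def)
  qed
  have im: "\<exists>y\<in>carrier Y. p = q y" if "p \<in> carrier Q" for p
    using surj that by auto
  have "h \<in> graded_hom A Q Z"
  proof (rule graded_homI)
    show "h \<in> extensional (carrier Q)" by (simp add: h_def)
  next
    fix m assume "m \<in> carrier Q"
    then obtain y where "y \<in> carrier Y" "m = q y" using im[of m] by metis
    then show "h m \<in> carrier Z" by (simp add: h g.hom_closed)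
  next
    fix m n assume "m \<in> carrier Q" "n \<in> carrier Q"
    then obtain y y' where "y \<in> carrier Y" "m = q y" "y' \<in> carrier Y" "n = q y'"
      using im[of m] im[of n] by metis
    then show "h (m \<oplus>\<^bsub>Q\<^esub> n) = h m \<oplus>\<^bsub>Z\<^esub> h n"
      using h[of "y \<oplus>\<^bsub>Y\<^esub> y'"] by (simp add: h g.hom_add q.hom_add)
  next
    fix a m assume a: "a \<in> carrier A" and "m \<in> carrier Q"
    then obtain y where "y \<in> carrier Y" "m = q y" using im[of m] by metis
    then show "h (a \<odot>\<^bsub>Q\<^esub> m) = a \<odot>\<^bsub>Z\<^esub> h m"
      using a h[of "a \<odot>\<^bsub>Y\<^esub> y"] by (simp add: h g.hom_act q.hom_act q.X.act_closed)
  next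
    fix e m assume m: "m \<in> homog Q e"
    from im[OF q.Y.homog_closed[OF m]] obtain y where "y \<in> carrier Y" "m = q y" ..
    \<comment> \<open>Lifting to an element of the same degree shows that \<open>h\<close> preserves
      degrees.\<close>
    then obtain y' where "y' \<in> homog Y e" "m = q y'"
      using q.homog_preimage[of y e] m by auto
    then show "h m \<in> homog Z e"
      using q.X.homog_closed by (simp add: h g.hom_homog)
  qed
  have hq: "compose (carrier Y) h q = g"
    by (rule extensionalityI[OF _ g.hom_ext]) (simp_all add: compose_def h)
  show "\<exists>!h. h \<in> Hom (gr_cat A) Q Z \<and> Cmp (gr_cat A) Y Q Z h q = g"
    unfolding gr_cat_simps
  proof (intro ex1I[of _ h] conjI \<open>h \<in> _\<close> hq, elim conjE)
    fix h' assume h': "h' \<in> graded_hom A Q Z" "compose (carrier Y) h' q = g"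
    show "h' = h"
    proof (rule graded_hom_eqI[OF h'(1) \<open>h \<in> _\<close>])
      fix p assume "p \<in> carrier Q"
      from im[OF this] obtain y where y: "y \<in> carrier Y" "p = q y" ..
      then have "h' (q y) = g y" using fun_cong[OF h'(2), of y] by (simp add: compose_def)
      then show "h' p = h p" using y by (simp add: h)
    qed
  qed
qed

definition zero_rmod :: "'m \<Rightarrow> ('g, 'a, 'm) graded" where
  "zero_rmod z = \<lparr>carrier = {z}, mult = undefined, one = undefined, zero = z, add = (\<lambda>_ _. z),
    smult = (\<lambda>_ _. z), homog = (\<lambda>_. {z})\<rparr>"

lemma zero_rmod_simps [simp]:
  "carrier (zero_rmod z) = {z}" "zero (zero_rmod z) = z" "add (zero_rmod z) p q = z"
  "smult (zero_rmod z) a p = z" "homog (zero_rmod z) g = {z}"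
  by (simp_all add: zero_rmod_def)

lemma fg_rmod_zero_rmod:
  fixes A :: "(bit, complex, 'a) graded"
  assumes "ring A" shows "fg_rmod A (zero_rmod z)"
proof -
  have "z2_group (zero_rmod z :: (bit, 'a, 'b) graded)"
    by (rule z2_groupI) auto
  then interpret z2_rmod A "zero_rmod z"
    by (intro z2_rmod.intro z2_rmod_axioms.intro assms) auto
  have "generates A (zero_rmod z) {z} (carrier (zero_rmod z))"
    by (simp add: generates_def)
  then show ?thesis
    unfolding fg_rmod_def finitely_generated_iff using z2_rmod_axioms finite.intros by blast
qed

lemma is_zero_object_gr_cat:
  fixes A :: "(bit, complex, 'a) graded" and z :: 'm
  assumes "ring A" shows "is_zero_object (gr_cat A) (zero_rmod z)"
  unfolding is_zero_object_def
proof (intro conjI ballI)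
  show "zero_rmod z \<in> Ob (gr_cat A)" using fg_rmod_zero_rmod[OF assms] by simp
  interpret Z: z2_rmod A "zero_rmod z" using fg_rmod_zero_rmod[OF assms, of z] by (simp add: fg_rmod_def)
  fix X :: "(bit, 'a, 'm) graded" assume "X \<in> Ob (gr_cat A)"
  then interpret X: z2_rmod A X by (simp add: fg_rmod_def)
  show "\<exists>!f. f \<in> Hom (gr_cat A) X (zero_rmod z)"
  proof (rule ex1I)
    show "(\<lambda>m\<in>carrier X. z) \<in> Hom (gr_cat A) X (zero_rmod z)"
      using graded_hom_zero[OF X.z2_rmod_axioms Z.z2_rmod_axioms] by simp
    fix f assume f: "f \<in> Hom (gr_cat A) X (zero_rmod z)"
    show "f = (\<lambda>m\<in>carrier X. z)"
      using graded_homD(1,2)[OF f[unfolded gr_cat_simps]] by (auto simp: extensional_def fun_eq_iff)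
  qed
  show "\<exists>!f. f \<in> Hom (gr_cat A) (zero_rmod z) X"
  proof (rule ex1I)
    show "(\<lambda>m\<in>carrier (zero_rmod z). \<zero>\<^bsub>X\<^esub>) \<in> Hom (gr_cat A) (zero_rmod z) X"
      using graded_hom_zero[OF Z.z2_rmod_axioms X.z2_rmod_axioms] by simp
    fix f assume f: "f \<in> Hom (gr_cat A) (zero_rmod z) X"
    then interpret f: z2_hom A "zero_rmod z" X f by unfold_locales simp
    show "f = (\<lambda>m\<in>carrier (zero_rmod z). \<zero>\<^bsub>X\<^esub>)"
      using f.hom_zero f.hom_ext by (auto simp: extensional_def fun_eq_iff)
  qed
qed

text \<open>The noetherian property in the form in which kernels need it. It speaks of modules in a
  fixed universe and of all their submodules, graded or not, so that it can be transferred along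
  \<open>corner\<close> without passing through right ideals.\<close>

definition submodules_fg :: "(bit, complex, 'a) graded \<Rightarrow> 'u itself \<Rightarrow> bool" where
  "submodules_fg A u \<longleftrightarrow> (\<forall>(M :: (bit, 'a, 'u) graded) L. fg_rmod A M \<longrightarrow> submod A M L \<longrightarrow>
    (\<exists>S. finite S \<and> generates A M S L))"

text \<open>The injection \<open>j\<close> makes room for direct sums inside the universe \<open>'u\<close>.\<close>

locale noetherian_gr =
  fixes A :: "(bit, complex, 'a) graded" and j :: "'u \<times> 'u \<Rightarrow> 'u"
  assumes ring_A: "ring A" and homog_A: "\<And>g. homog A g \<subseteq> carrier A"
    and inj_j: "inj j"
    and noetherian: "submodules_fg A TYPE('u)"
begin

abbreviation C :: "((bit, 'a, 'u) graded, 'u \<Rightarrow> 'u) precat" where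
  "C \<equiv> gr_cat A"

text \<open>This is where \<open>noetherian\<close> enters: the kernel of a morphism has to be
  finitely generated to be an object again.\<close>

lemma fg_rmod_sub_rmod:
  fixes M :: "(bit, 'a, 'u) graded"
  assumes "fg_rmod A M" "submod A M L" "graded_subset M L"
  shows "fg_rmod A (sub_rmod M L (smult M))"
proof -
  interpret M: z2_rmod A M using assms by (simp add: fg_rmod_def)
  interpret L: z2_rmod A "sub_rmod M L (smult M)"
    by (rule M.z2_rmod_sub_rmod) (use homog_A assms in auto)
  obtain S where "finite S" "generates A M S L"
    using assms noetherian unfolding submodules_fg_def by blast
  then have "finite S" "generates A (sub_rmod M L (smult M)) S (carrier (sub_rmod M L (smult M)))"
    using M.generates_sub_rmod[OF assms(2)] by simp_all
  then show ?thesis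
    unfolding fg_rmod_def L.finitely_generated_iff using L.z2_rmod_axioms by blast
qed

lemma kernel_gr_cat:
  fixes X Y :: "(bit, 'a, 'u) graded"
  assumes "fg_rmod A X" "fg_rmod A Y" "f \<in> graded_hom A X Y"
  defines "K \<equiv> {x \<in> carrier X. f x = \<zero>\<^bsub>Y\<^esub>}"
  shows "fg_rmod A (sub_rmod X K (smult X))"
    and "(\<lambda>x\<in>K. x) \<in> graded_hom A (sub_rmod X K (smult X)) X"
    and "is_kernel C X Y f (sub_rmod X K (smult X)) (\<lambda>x\<in>K. x)"
proof -
  interpret f: z2_hom A X Y f using assms by (intro z2_homI)
  show fg: "fg_rmod A (sub_rmod X K (smult X))"
    unfolding K_def by (rule fg_rmod_sub_rmod[OF assms(1) f.submod_kernel f.graded_kernel])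
  have K: "K \<subseteq> carrier X" "submod A X K" using f.submod_kernel by (auto simp: K_def)
  show h: "(\<lambda>x\<in>K. x) \<in> graded_hom A (sub_rmod X K (smult X)) X"
    by (rule graded_homI) (use K in \<open>auto simp: submod_def\<close>)
  show "is_kernel C X Y f (sub_rmod X K (smult X)) (\<lambda>x\<in>K. x)"
    by (rule is_kernel_gr_cat[OF assms(1,2) fg assms(3) h]) (auto simp: K_def inj_on_def)
qed

text \<open>The quotient by the image is realised on one chosen representative per coset, so that
  its elements remain in \<open>'u\<close>.\<close>

lemma cokernel_gr_cat:
  fixes X Y :: "(bit, 'a, 'u) graded"
  assumes "fg_rmod A X" "fg_rmod A Y" "f \<in> graded_hom A X Y"
  obtains Q q where "fg_rmod A Q" "q \<in> graded_hom A Y Q" "q ` carrier Y = carrier Q"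
    "{y \<in> carrier Y. q y = \<zero>\<^bsub>Q\<^esub>} = f ` carrier X" "is_cokernel C X Y f Q q"
proof -
  interpret f: z2_hom A X Y f using assms by (intro z2_homI)
  define K where "K = f ` carrier X"
  define \<pi> where "\<pi> m = (SOME n. n \<in> carrier Y \<and> m \<ominus>\<^bsub>Y\<^esub> n \<in> K)" for m
  have K: "submod A Y K" "graded_subset Y K"
    unfolding K_def by (rule f.submod_image[OF f.X.submod_carrier], rule f.graded_image)
  have diff0: "m \<ominus>\<^bsub>Y\<^esub> m \<in> K" if "m \<in> carrier Y" for m
    using f.Y.diff_eq_zero[OF that that] K(1) by (simp add: submod_def)
  have \<pi>: "\<pi> m \<in> carrier Y \<and> m \<ominus>\<^bsub>Y\<^esub> \<pi> m \<in> K" if "m \<in> carrier Y" for m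
    unfolding \<pi>_def by (rule someI[of _ m]) (use that diff0 in auto)
  have tr: "m \<ominus>\<^bsub>Y\<^esub> k \<in> K" if "m \<in> carrier Y" "n \<in> carrier Y" "k \<in> carrier Y"
    "m \<ominus>\<^bsub>Y\<^esub> n \<in> K" "n \<ominus>\<^bsub>Y\<^esub> k \<in> K" for m n k
  proof -
    have "m \<ominus>\<^bsub>Y\<^esub> k = (m \<ominus>\<^bsub>Y\<^esub> n) \<oplus>\<^bsub>Y\<^esub> (n \<ominus>\<^bsub>Y\<^esub> k)"
      using that by (simp add: a_minus_def f.Y.M.a_assoc f.Y.M.r_neg1)
    then show ?thesis using K(1) that by (simp add: submod_def)
  qed
  have sy: "n \<ominus>\<^bsub>Y\<^esub> m \<in> K" if "m \<in> carrier Y" "n \<in> carrier Y" "m \<ominus>\<^bsub>Y\<^esub> n \<in> K" for m n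
  proof -
    have "n \<ominus>\<^bsub>Y\<^esub> m = \<ominus>\<^bsub>Y\<^esub> (m \<ominus>\<^bsub>Y\<^esub> n)"
      using that by (simp add: a_minus_def f.Y.M.minus_add f.Y.M.a_comm)
    then show ?thesis using f.Y.submod_minus[OF K(1) that(3)] by simp
  qed
  interpret I: rmod_image A Y \<pi> K
  proof (unfold_locales)
    fix m n assume mn: "m \<in> carrier Y" "n \<in> carrier Y"
    note m = \<pi>[OF mn(1)] and n = \<pi>[OF mn(2)]
    show "\<pi> m = \<pi> n \<longleftrightarrow> m \<ominus>\<^bsub>Y\<^esub> n \<in> K"
    proof
      assume "\<pi> m = \<pi> n"
      then show "m \<ominus>\<^bsub>Y\<^esub> n \<in> K"
        using tr[OF mn(1) _ mn(2)] m n sy[OF mn(2)] by auto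
    next
      assume e: "m \<ominus>\<^bsub>Y\<^esub> n \<in> K"
      \<comment> \<open>Congruent elements define the same coset, so that the choice operator sees
        the same predicate and returns the same representative.\<close>
      have "k \<in> carrier Y \<and> m \<ominus>\<^bsub>Y\<^esub> k \<in> K \<longleftrightarrow> k \<in> carrier Y \<and> n \<ominus>\<^bsub>Y\<^esub> k \<in> K" for k
        using tr[OF mn(1,2) _ e] tr[OF mn(2,1) _ sy[OF mn e]] by blast
      then show "\<pi> m = \<pi> n" unfolding \<pi>_def by simp
    qed
  qed (use homog_A K in auto)
  let ?Q = "image_rmod \<pi> Y" and ?q = "\<lambda>m\<in>carrier Y. \<pi> m"
  have fg: "fg_rmod A ?Q"
    using assms(2) I.z2_rmod_image I.finitely_generated_image by (simp add: fg_rmod_def)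
  have surj: "?q ` carrier Y = carrier ?Q" by (auto simp: image_rmod_simps)
  have "?q y = \<zero>\<^bsub>?Q\<^esub> \<longleftrightarrow> y \<in> K" if "y \<in> carrier Y" for y
    using that I.\<pi>_eq[OF that f.Y.M.zero_closed]
    by (simp add: image_rmod_simps a_minus_def f.Y.group_minus_zero)
  moreover have "K \<subseteq> carrier Y" using K(1) by (simp add: submod_def)
  ultimately have ker: "{y \<in> carrier Y. ?q y = \<zero>\<^bsub>?Q\<^esub>} = f ` carrier X"
    unfolding K_def[symmetric] by auto
  show thesis
    by (rule that[OF fg I.\<pi>_hom surj ker is_cokernel_gr_cat[OF assms(1,2) fg assms(3) I.\<pi>_hom surj ker]])
qed

lemma biproduct_gr_cat:
  fixes X Y :: "(bit, 'a, 'u) graded"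
  assumes "fg_rmod A X" "fg_rmod A Y"
  shows "\<exists>P i i' p p'. is_biproduct C X Y P i i' p p'"
proof -
  interpret X: z2_rmod A X using assms by (simp add: fg_rmod_def)
  interpret Y: z2_rmod A Y using assms by (simp add: fg_rmod_def)
  let ?D = "dsum_rmod X Y (\<lambda>a p. (a \<odot>\<^bsub>X\<^esub> fst p, a \<odot>\<^bsub>Y\<^esub> snd p))"
  have D: "z2_rmod A ?D" "finitely_generated_rmod A ?D"
    using assms by (auto simp: fg_rmod_def intro!: z2_rmod_dsum_rmod finitely_generated_dsum_rmod)
  then interpret D: z2_rmod A ?D by simp
  define P where "P = image_rmod j ?D"
  interpret I: rmod_image A ?D j "{\<zero>\<^bsub>?D\<^esub>}"
    by (rule D.rmod_image_inj[OF homog_A]) (rule inj_on_subset[OF inj_j subset_UNIV])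
  have P: "fg_rmod A P"
    using D(2) I.z2_rmod_image I.finitely_generated_image by (simp add: fg_rmod_def P_def)
  define k where "k = inv_into UNIV j"
  have k: "k (j p) = p" for p using inj_j by (simp add: k_def)
  have carr: "q \<in> carrier P \<longleftrightarrow> (\<exists>x\<in>carrier X. \<exists>y\<in>carrier Y. q = j (x, y))" for q
    by (auto simp: P_def image_rmod_simps)
  have hom: "q \<in> homog P g \<longleftrightarrow> (\<exists>x\<in>homog X g. \<exists>y\<in>homog Y g. q = j (x, y))" for q g
    by (auto simp: P_def image_rmod_simps)
  have add: "j (x, y) \<oplus>\<^bsub>P\<^esub> j (x', y') = j (x \<oplus>\<^bsub>X\<^esub> x', y \<oplus>\<^bsub>Y\<^esub> y')"
    if "x \<in> carrier X" "y \<in> carrier Y" "x' \<in> carrier X" "y' \<in> carrier Y" for x y x' y'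
    using that I.\<pi>_add[of "(x, y)" "(x', y')"] by (simp add: P_def)
  have act: "a \<odot>\<^bsub>P\<^esub> j (x, y) = j (a \<odot>\<^bsub>X\<^esub> x, a \<odot>\<^bsub>Y\<^esub> y)"
    if "a \<in> carrier A" "x \<in> carrier X" "y \<in> carrier Y" for a x y
    using that I.\<pi>_act[of a "(x, y)"] by (simp add: P_def)
  have zero: "\<zero>\<^bsub>P\<^esub> = j (\<zero>\<^bsub>X\<^esub>, \<zero>\<^bsub>Y\<^esub>)" by (simp add: P_def image_rmod_simps)
  define i where "i = (\<lambda>x\<in>carrier X. j (x, \<zero>\<^bsub>Y\<^esub>))"
  define i' where "i' = (\<lambda>y\<in>carrier Y. j (\<zero>\<^bsub>X\<^esub>, y))"
  define p where "p = (\<lambda>q\<in>carrier P. fst (k q))"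
  define p' where "p' = (\<lambda>q\<in>carrier P. snd (k q))"
  have p: "p (j (x, y)) = x" "p' (j (x, y)) = y" if "x \<in> carrier X" "y \<in> carrier Y" for x y
    using that carr by (auto simp: p_def p'_def k)
  have jP: "j (x, y) \<in> carrier P" if "x \<in> carrier X" "y \<in> carrier Y" for x y
    using that carr by auto
  have homI: "j (x, y) \<in> homog P g" if "x \<in> homog X g" "y \<in> homog Y g" for x y g
    using that hom by auto
  have "i \<in> graded_hom A X P"
    by (rule graded_homI) (auto simp: i_def jP add act homI X.act_closed Y.act_zero_right X.homog_closed Y.homog_zero)
  moreover have "i' \<in> graded_hom A Y P"
    by (rule graded_homI) (auto simp: i'_def jP add act homI Y.act_closed X.act_zero_right Y.homog_closed X.homog_zero)
  moreover have "p \<in> graded_hom A P X"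
  proof (rule graded_homI)
    show "p \<in> extensional (carrier P)" by (simp add: p_def)
  qed (auto simp: p carr hom add act X.act_closed Y.act_closed X.homog_closed Y.homog_closed)
  moreover have "p' \<in> graded_hom A P Y"
  proof (rule graded_homI)
    show "p' \<in> extensional (carrier P)" by (simp add: p'_def)
  qed (auto simp: p carr hom add act X.act_closed Y.act_closed X.homog_closed Y.homog_closed)
  moreover have "compose (carrier X) p i = (\<lambda>x\<in>carrier X. x)" "compose (carrier Y) p' i' = (\<lambda>x\<in>carrier Y. x)"
    "compose (carrier X) p' i = (\<lambda>x\<in>carrier X. \<zero>\<^bsub>Y\<^esub>)" "compose (carrier Y) p i' = (\<lambda>x\<in>carrier Y. \<zero>\<^bsub>X\<^esub>)"
    by (auto simp: compose_def i_def i'_def p intro!: restrict_ext)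
  moreover have "compose (carrier P) i p q \<oplus>\<^bsub>P\<^esub> compose (carrier P) i' p' q = q" if "q \<in> carrier P" for q
  proof -
    obtain x y where "x \<in> carrier X" "y \<in> carrier Y" "q = j (x, y)" using \<open>q \<in> carrier P\<close> carr by auto
    then show ?thesis by (simp add: compose_def jP p i_def i'_def add)
  qed
  ultimately have "is_biproduct C X Y P i i' p p'"
    unfolding is_biproduct_def gr_cat_simps using P by (auto intro!: restrict_ext)
  then show ?thesis by blast
qed

text \<open>A monomorphism cannot distinguish the inclusion of its kernel from the zero map, so it
  is injective and is the kernel of its cokernel. Dually, an epimorphism cannot distinguish the
  projection to its cokernel from zero, so it is surjective and is the cokernel of its
  kernel.\<close>

theorem abelian_category_gr_cat: "abelian_category C"
  unfolding abelian_category_def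
proof (intro conjI ballI impI)
  show "preadditive C" by (rule preadditive_gr_cat)
  have "is_zero_object C (zero_rmod undefined)" by (rule is_zero_object_gr_cat[OF ring_A])
  then show "\<exists>Z. is_zero_object C Z" by (rule exI)
next
  fix X Y assume o: "X \<in> Ob C" "Y \<in> Ob C"
  then show "\<exists>P i i' p p'. is_biproduct C X Y P i i' p p'" by (simp add: biproduct_gr_cat)
  fix f assume f: "f \<in> Hom C X Y"
  note a = o[unfolded gr_cat_simps] f[unfolded gr_cat_simps]
  show "\<exists>K k. is_kernel C X Y f K k" using kernel_gr_cat(3)[OF a] by blast
  show "\<exists>Q q. is_cokernel C X Y f Q q" using cokernel_gr_cat[OF a] by metis
next
  fix X Y f assume o: "X \<in> Ob C" "Y \<in> Ob C" "f \<in> Hom C X Y" and mono: "is_mono C X Y f"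
  note a = o[unfolded gr_cat_simps]
  interpret f: z2_hom A X Y f using a by (intro z2_homI)
  define K where "K = {x \<in> carrier X. f x = \<zero>\<^bsub>Y\<^esub>}"
  let ?K = "sub_rmod X K (smult X)"
  note k = kernel_gr_cat[OF a, folded K_def]
  have z: "(\<lambda>x\<in>K. \<zero>\<^bsub>X\<^esub>) \<in> graded_hom A ?K X"
    using graded_hom_zero[of A ?K X] k(1) a by (simp add: fg_rmod_def)
  have "compose K f (\<lambda>x\<in>K. x) = compose K f (\<lambda>x\<in>K. \<zero>\<^bsub>X\<^esub>)"
    by (auto simp: compose_def K_def f.hom_zero intro!: restrict_ext)
  then have "(\<lambda>x\<in>K. x) = (\<lambda>x\<in>K. \<zero>\<^bsub>X\<^esub>)"
    using mono k(1,2) z unfolding is_mono_def gr_cat_simps by simp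
  then have "\<forall>x\<in>K. x = \<zero>\<^bsub>X\<^esub>" by (metis restrict_apply')
  then have inj: "inj_on f (carrier X)"
    unfolding f.inj_on_iff_kernel by (simp add: K_def)
  obtain Q q where q: "fg_rmod A Q" "q \<in> graded_hom A Y Q" "q ` carrier Y = carrier Q"
    "{y \<in> carrier Y. q y = \<zero>\<^bsub>Q\<^esub>} = f ` carrier X" "is_cokernel C X Y f Q q"
    by (rule cokernel_gr_cat[OF a])
  have "is_kernel C Y Q q X f"
    by (rule is_kernel_gr_cat[OF a(2) q(1) a(1) q(2) a(3) inj]) (simp add: q(4))
  then show "\<exists>Z\<in>Ob C. \<exists>g\<in>Hom C Y Z. is_kernel C Y Z g X f"
    using q by (intro bexI[of _ Q] bexI[of _ q]) simp_all
next
  fix X Y f assume o: "X \<in> Ob C" "Y \<in> Ob C" "f \<in> Hom C X Y" and epi: "is_epi C X Y f"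
  note a = o[unfolded gr_cat_simps]
  interpret f: z2_hom A X Y f using a by (intro z2_homI)
  obtain Q q where q: "fg_rmod A Q" "q \<in> graded_hom A Y Q" "q ` carrier Y = carrier Q"
    "{y \<in> carrier Y. q y = \<zero>\<^bsub>Q\<^esub>} = f ` carrier X" "is_cokernel C X Y f Q q"
    by (rule cokernel_gr_cat[OF a])
  have z: "(\<lambda>x\<in>carrier Y. \<zero>\<^bsub>Q\<^esub>) \<in> graded_hom A Y Q"
    using graded_hom_zero[of A Y Q] q(1) a by (simp add: fg_rmod_def)
  have "q (f x) = \<zero>\<^bsub>Q\<^esub>" if "x \<in> carrier X" for x using q(4) that by auto
  then have "compose (carrier X) q f = compose (carrier X) (\<lambda>x\<in>carrier Y. \<zero>\<^bsub>Q\<^esub>) f"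
    by (auto simp: compose_def f.hom_closed intro!: restrict_ext)
  then have "q = (\<lambda>x\<in>carrier Y. \<zero>\<^bsub>Q\<^esub>)"
    using epi q(1,2) z unfolding is_epi_def gr_cat_simps by simp
  then have surj: "f ` carrier X = carrier Y" using q(4) by auto
  define K where "K = {x \<in> carrier X. f x = \<zero>\<^bsub>Y\<^esub>}"
  note k = kernel_gr_cat[OF a, folded K_def]
  have "is_cokernel C (sub_rmod X K (smult X)) X (\<lambda>x\<in>K. x) Y f"
    by (rule is_cokernel_gr_cat[OF k(1) a(1,2) k(2) a(3) surj]) (auto simp: K_def)
  then show "\<exists>Z\<in>Ob C. \<exists>g\<in>Hom C Z X. is_cokernel C Z X g Y f"
    using k by (intro bexI[of _ "sub_rmod X K (smult X)"] bexI[of _ "\<lambda>x\<in>K. x"]) simp_all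
qed

end

text \<open>A bijective morphism is a kernel of the zero endomorphism of Y; factoring the identity
  of Y through it yields an inverse that is automatically linear and of degree 0.\<close>

lemma is_iso_gr_cat:
  fixes A :: "(bit, complex, 'a) graded"
  assumes "fg_rmod A X" "fg_rmod A Y" "f \<in> graded_hom A X Y"
    and inj: "inj_on f (carrier X)" and surj: "f ` carrier X = carrier Y"
  shows "is_iso (gr_cat A) X Y f"
proof -
  interpret f: z2_hom A X Y f using assms by (intro z2_homI)
  have "is_kernel (gr_cat A) Y Y (\<lambda>y\<in>carrier Y. \<zero>\<^bsub>Y\<^esub>) X f"
    by (rule is_kernel_gr_cat[OF assms(2,2,1) graded_hom_zero assms(3) inj])
      (auto simp: surj f.Y.z2_rmod_axioms)
  note universal = this[unfolded is_kernel_def, THEN conjunct2, THEN conjunct2, THEN conjunct2,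
      rule_format, of Y "\<lambda>y\<in>carrier Y. y", unfolded gr_cat_simps]
  have "compose (carrier Y) (\<lambda>y\<in>carrier Y. \<zero>\<^bsub>Y\<^esub>) (\<lambda>y\<in>carrier Y. y) = (\<lambda>y\<in>carrier Y. \<zero>\<^bsub>Y\<^esub>)"
    by (simp add: compose_def cong: restrict_cong)
  from ex1_implies_ex[OF universal[OF assms(2) graded_hom_id[OF f.Y.z2_rmod_axioms] this]]
  obtain g where g: "g \<in> graded_hom A Y X" "compose (carrier Y) f g = (\<lambda>y\<in>carrier Y. y)" by blast
  have "g (f x) = x" if x: "x \<in> carrier X" for x
  proof (rule inj_onD[OF inj])
    show "f (g (f x)) = f x"
      using fun_cong[OF g(2), of "f x"] f.hom_closed[OF x] by (simp add: compose_def)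
  qed (use x graded_homD(2)[OF g(1) f.hom_closed[OF x]] in auto)
  then have "compose (carrier X) g f = (\<lambda>x\<in>carrier X. x)"
    by (simp add: compose_def cong: restrict_cong)
  then show ?thesis
    unfolding is_iso_def gr_cat_simps using assms(3) g by blast
qed

section \<open>Graded Morita equivalence with matrices\<close>

text \<open>\<open>\<phi>\<close> identifies \<open>D\<close> with the algebra of \<open>2 \<times> 2\<close> matrices over \<open>A\<close> in which the position
  \<open>(r, c)\<close> has degree \<open>r + c\<close>; \<open>\<psi> r c a\<close> is the element with the single entry \<open>a\<close>.\<close>

locale z2_matrix_iso = A: ring A + D: ring D
  for A :: "(bit, complex, 'a) graded" and D :: "(bit, complex, 'd) graded" +
  fixes \<phi> :: "bit \<Rightarrow> bit \<Rightarrow> 'd \<Rightarrow> 'a" and \<psi> :: "bit \<Rightarrow> bit \<Rightarrow> 'a \<Rightarrow> 'd"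
  assumes homog_A: "homog A g \<subseteq> carrier A" and one_homog: "\<one>\<^bsub>A\<^esub> \<in> homog A 0"
    and homog_D: "homog D g \<subseteq> carrier D"
    and \<phi>_closed: "d \<in> carrier D \<Longrightarrow> \<phi> r c d \<in> carrier A"
    and \<phi>_add: "\<lbrakk>d \<in> carrier D; d' \<in> carrier D\<rbrakk> \<Longrightarrow> \<phi> r c (d \<oplus>\<^bsub>D\<^esub> d') = \<phi> r c d \<oplus>\<^bsub>A\<^esub> \<phi> r c d'"
    and \<phi>_mult: "\<lbrakk>d \<in> carrier D; d' \<in> carrier D\<rbrakk> \<Longrightarrow>
      \<phi> r c (d \<otimes>\<^bsub>D\<^esub> d') = \<phi> r 0 d \<otimes>\<^bsub>A\<^esub> \<phi> 0 c d' \<oplus>\<^bsub>A\<^esub> \<phi> r 1 d \<otimes>\<^bsub>A\<^esub> \<phi> 1 c d'"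
    and \<phi>_one: "\<phi> r c \<one>\<^bsub>D\<^esub> = (if r = c then \<one>\<^bsub>A\<^esub> else \<zero>\<^bsub>A\<^esub>)"
    and \<phi>_homog: "d \<in> homog D g \<Longrightarrow> \<phi> r c d \<in> homog A (g + r + c)"
    and \<psi>_closed: "a \<in> carrier A \<Longrightarrow> \<psi> r c a \<in> carrier D"
    and \<psi>_homog: "a \<in> homog A g \<Longrightarrow> \<psi> r c a \<in> homog D (g + r + c)"
    and \<phi>_\<psi>: "a \<in> carrier A \<Longrightarrow> \<phi> r c (\<psi> r' c' a) = (if r = r' \<and> c = c' then a else \<zero>\<^bsub>A\<^esub>)"
    and \<phi>_inj: "\<lbrakk>d \<in> carrier D; d' \<in> carrier D; \<And>r c. \<phi> r c d = \<phi> r c d'\<rbrakk> \<Longrightarrow> d = d'"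
begin

section \<open>Calculus of matrix units\<close>

lemma \<phi>_zero: "\<phi> r c \<zero>\<^bsub>D\<^esub> = \<zero>\<^bsub>A\<^esub>"
  using \<phi>_add[of "\<zero>\<^bsub>D\<^esub>" "\<zero>\<^bsub>D\<^esub>" r c] \<phi>_closed[of "\<zero>\<^bsub>D\<^esub>" r c]
  by (metis A.add.l_cancel_one' D.l_zero D.zero_closed)

lemma \<psi>_add: "\<lbrakk>a \<in> carrier A; b \<in> carrier A\<rbrakk> \<Longrightarrow> \<psi> r c (a \<oplus>\<^bsub>A\<^esub> b) = \<psi> r c a \<oplus>\<^bsub>D\<^esub> \<psi> r c b"
  by (rule \<phi>_inj) (simp_all add: \<psi>_closed \<phi>_\<psi> \<phi>_add)

lemma \<psi>_mult:
  assumes "a \<in> carrier A" "b \<in> carrier A"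
  shows "\<psi> r c a \<otimes>\<^bsub>D\<^esub> \<psi> r' c' b = (if c = r' then \<psi> r c' (a \<otimes>\<^bsub>A\<^esub> b) else \<zero>\<^bsub>D\<^esub>)"
proof (rule \<phi>_inj)
  fix s t
  show "\<phi> s t (\<psi> r c a \<otimes>\<^bsub>D\<^esub> \<psi> r' c' b) = \<phi> s t (if c = r' then \<psi> r c' (a \<otimes>\<^bsub>A\<^esub> b) else \<zero>\<^bsub>D\<^esub>)"
    using assms by (cases c rule: bit_cases; cases r' rule: bit_cases)
      (simp_all add: \<psi>_closed \<phi>_\<psi> \<phi>_mult \<phi>_zero)
qed (use assms in \<open>simp_all add: \<psi>_closed\<close>)

text \<open>Acting on a right module, \<open>e\<close> and \<open>u\<close> send an element to its
  two coordinates in the corner, and \<open>v\<close> puts the second coordinate back in its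
  place.\<close>

abbreviation "e \<equiv> \<psi> 0 0 \<one>\<^bsub>A\<^esub>"
abbreviation "u \<equiv> \<psi> 1 0 \<one>\<^bsub>A\<^esub>"
abbreviation "v \<equiv> \<psi> 0 1 \<one>\<^bsub>A\<^esub>"

text \<open>The product of \<open>u\<close> and \<open>v\<close> is the other diagonal idempotent.
  As \<open>u\<close> equals \<open>u\<close> times \<open>e\<close>, the idempotent
  \<open>e\<close> generates the unit ideal, which is the source of the Morita equivalence.\<close>

lemma one_split: "\<one>\<^bsub>D\<^esub> = e \<oplus>\<^bsub>D\<^esub> u \<otimes>\<^bsub>D\<^esub> v"
proof (rule \<phi>_inj)
  show "\<phi> r c \<one>\<^bsub>D\<^esub> = \<phi> r c (e \<oplus>\<^bsub>D\<^esub> u \<otimes>\<^bsub>D\<^esub> v)" for r c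
    by (cases r rule: bit_cases; cases c rule: bit_cases)
      (simp_all add: \<phi>_one \<phi>_add \<psi>_mult \<psi>_closed \<phi>_\<psi>)
qed (simp_all add: \<psi>_closed)

text \<open>Right multiplication by the matrix unit at (r, 0) moves column r of d to column 0 and
  erases the rest; the two summands are the two entries of that column.\<close>

lemma mult_\<psi>:
  assumes "d \<in> carrier D"
  shows "d \<otimes>\<^bsub>D\<^esub> \<psi> r 0 \<one>\<^bsub>A\<^esub> = e \<otimes>\<^bsub>D\<^esub> \<psi> 0 0 (\<phi> 0 r d) \<oplus>\<^bsub>D\<^esub> u \<otimes>\<^bsub>D\<^esub> \<psi> 0 0 (\<phi> 1 r d)"
proof (rule \<phi>_inj)
  show "\<phi> s t (d \<otimes>\<^bsub>D\<^esub> \<psi> r 0 \<one>\<^bsub>A\<^esub>) =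
      \<phi> s t (e \<otimes>\<^bsub>D\<^esub> \<psi> 0 0 (\<phi> 0 r d) \<oplus>\<^bsub>D\<^esub> u \<otimes>\<^bsub>D\<^esub> \<psi> 0 0 (\<phi> 1 r d))" for s t
    using assms
    by (cases r rule: bit_cases; cases s rule: bit_cases; cases t rule: bit_cases)
      (simp_all add: \<phi>_add \<phi>_mult \<psi>_mult \<psi>_closed \<phi>_\<psi> \<phi>_closed)
qed (use assms in \<open>simp_all add: \<psi>_closed \<phi>_closed\<close>)

subsection \<open>The functors\<close>

definition corner :: "(bit, 'd, 'm) graded \<Rightarrow> (bit, 'a, 'm) graded" where
  "corner N = sub_rmod N {n \<in> carrier N. e \<odot>\<^bsub>N\<^esub> n = n} (\<lambda>a n. \<psi> 0 0 a \<odot>\<^bsub>N\<^esub> n)"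

lemma corner_simps:
  "n \<in> carrier (corner N) \<longleftrightarrow> n \<in> carrier N \<and> e \<odot>\<^bsub>N\<^esub> n = n" "zero (corner N) = \<zero>\<^bsub>N\<^esub>"
  "add (corner N) = add N" "a \<odot>\<^bsub>corner N\<^esub> n = \<psi> 0 0 a \<odot>\<^bsub>N\<^esub> n"
  "n \<in> homog (corner N) g \<longleftrightarrow> n \<in> homog N g \<and> n \<in> carrier N \<and> e \<odot>\<^bsub>N\<^esub> n = n"
  by (simp_all add: corner_def)

text \<open>Pairs are row vectors, on which the matrix of d acts from the right. Shifting the second
  component by one matches the degree r + c of position (r, c).\<close>

definition columns :: "(bit, 'a, 'm) graded \<Rightarrow> (bit, 'd, 'm \<times> 'm) graded" where
  "columns M = dsum_rmod M (shift_rmod 1 M) (\<lambda>d p.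
    (\<phi> 0 0 d \<odot>\<^bsub>M\<^esub> fst p \<oplus>\<^bsub>M\<^esub> \<phi> 1 0 d \<odot>\<^bsub>M\<^esub> snd p, \<phi> 0 1 d \<odot>\<^bsub>M\<^esub> fst p \<oplus>\<^bsub>M\<^esub> \<phi> 1 1 d \<odot>\<^bsub>M\<^esub> snd p))"

lemma columns_simps:
  "carrier (columns M) = carrier M \<times> carrier M" "zero (columns M) = (\<zero>\<^bsub>M\<^esub>, \<zero>\<^bsub>M\<^esub>)"
  "add (columns M) p q = (fst p \<oplus>\<^bsub>M\<^esub> fst q, snd p \<oplus>\<^bsub>M\<^esub> snd q)"
  "d \<odot>\<^bsub>columns M\<^esub> p = (\<phi> 0 0 d \<odot>\<^bsub>M\<^esub> fst p \<oplus>\<^bsub>M\<^esub> \<phi> 1 0 d \<odot>\<^bsub>M\<^esub> snd p,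
    \<phi> 0 1 d \<odot>\<^bsub>M\<^esub> fst p \<oplus>\<^bsub>M\<^esub> \<phi> 1 1 d \<odot>\<^bsub>M\<^esub> snd p)"
  "homog (columns M) g = homog M g \<times> homog M (g + 1)"
  by (simp_all add: columns_def shift_rmod_def)

lemma e_homog: "e \<in> homog D 0"
  and u_homog: "u \<in> homog D 1"
  using \<psi>_homog[OF one_homog, of 0 0] \<psi>_homog[OF one_homog, of 1 0] by simp_all

section \<open>The corner of a module\<close>

context
  fixes N :: "(bit, 'd, 'm) graded"
  assumes N: "z2_rmod D N"
begin

interpretation N: z2_rmod D N by (rule N)

text \<open>For right modules the element that acts first is the left factor of the product, hence
  the condition that the column of the inner unit be the row of the outer one.\<close>

lemma \<psi>_\<psi>_act: "\<lbrakk>n \<in> carrier N; a \<in> carrier A; b \<in> carrier A\<rbrakk> \<Longrightarrow>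
    \<psi> r c b \<odot>\<^bsub>N\<^esub> (\<psi> r' c' a \<odot>\<^bsub>N\<^esub> n) = (if c' = r then \<psi> r' c (a \<otimes>\<^bsub>A\<^esub> b) \<odot>\<^bsub>N\<^esub> n else \<zero>\<^bsub>N\<^esub>)"
  by (simp add: N.act_mult[symmetric] \<psi>_closed \<psi>_mult N.act_zero_left)

lemma e_act_closed: "n \<in> carrier N \<Longrightarrow> e \<odot>\<^bsub>N\<^esub> n \<in> carrier (corner N)"
  and u_act_closed: "n \<in> carrier N \<Longrightarrow> u \<odot>\<^bsub>N\<^esub> n \<in> carrier (corner N)"
  by (simp_all add: corner_simps N.act_closed \<psi>_closed \<psi>_\<psi>_act)

lemma split_act: "n \<in> carrier N \<Longrightarrow> n = e \<odot>\<^bsub>N\<^esub> n \<oplus>\<^bsub>N\<^esub> v \<odot>\<^bsub>N\<^esub> (u \<odot>\<^bsub>N\<^esub> n)"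
  using N.act_one[of n] unfolding one_split
  by (simp add: N.act_add_left N.act_mult \<psi>_closed)

text \<open>The pair (ne, nu) is multiplied by d as a row vector by a matrix, by the formula used in
  \<open>columns\<close>. This is what makes \<open>\<eta>\<close> linear.\<close>

lemma act_e_u:
  assumes "d \<in> carrier D" "n \<in> carrier N"
  shows "\<psi> r 0 \<one>\<^bsub>A\<^esub> \<odot>\<^bsub>N\<^esub> (d \<odot>\<^bsub>N\<^esub> n) =
    \<psi> 0 0 (\<phi> 0 r d) \<odot>\<^bsub>N\<^esub> (e \<odot>\<^bsub>N\<^esub> n) \<oplus>\<^bsub>N\<^esub> \<psi> 0 0 (\<phi> 1 r d) \<odot>\<^bsub>N\<^esub> (u \<odot>\<^bsub>N\<^esub> n)"
proof -
  have "\<psi> r 0 \<one>\<^bsub>A\<^esub> \<odot>\<^bsub>N\<^esub> (d \<odot>\<^bsub>N\<^esub> n) = (d \<otimes>\<^bsub>D\<^esub> \<psi> r 0 \<one>\<^bsub>A\<^esub>) \<odot>\<^bsub>N\<^esub> n"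
    using assms by (simp add: N.act_mult \<psi>_closed)
  also have "\<dots> = \<psi> 0 0 (\<phi> 0 r d) \<odot>\<^bsub>N\<^esub> (e \<odot>\<^bsub>N\<^esub> n) \<oplus>\<^bsub>N\<^esub> \<psi> 0 0 (\<phi> 1 r d) \<odot>\<^bsub>N\<^esub> (u \<odot>\<^bsub>N\<^esub> n)"
    unfolding mult_\<psi>[OF assms(1)]
    using assms by (simp only: N.act_add_left N.act_mult \<psi>_closed \<phi>_closed D.m_closed A.one_closed)
  finally show ?thesis .
qed

lemma z2_rmod_corner: "z2_rmod A (corner N)"
proof (intro z2_rmod.intro z2_rmod_axioms.intro A.ring_axioms)
  let ?L = "{n \<in> carrier N. e \<odot>\<^bsub>N\<^esub> n = n}"
  have "graded_subset N ?L"
    unfolding graded_subset_def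
  proof (intro ballI impI)
    fix x y assume xy: "x \<in> homog N 0" "y \<in> homog N 1" "x \<oplus>\<^bsub>N\<^esub> y \<in> ?L"
    have c: "x \<in> carrier N" "y \<in> carrier N"
      using xy N.homog_closed by auto
    \<comment> \<open>As \<open>e\<close> is even, both components keep their degrees, and
      uniqueness of components shows that each of them is fixed by \<open>e\<close>.\<close>
    have h: "e \<odot>\<^bsub>N\<^esub> x \<in> homog N 0" "e \<odot>\<^bsub>N\<^esub> y \<in> homog N 1"
      using N.homog_act[OF e_homog xy(1)] N.homog_act[OF e_homog xy(2)] by simp_all
    have "e \<odot>\<^bsub>N\<^esub> x \<oplus>\<^bsub>N\<^esub> e \<odot>\<^bsub>N\<^esub> y = x \<oplus>\<^bsub>N\<^esub> y"
      using xy(3) c by (simp add: N.act_add_right \<psi>_closed)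
    from N.homog_unique[OF h xy(1,2) this] show "x \<in> ?L \<and> y \<in> ?L" using c by simp
  qed
  then show "z2_group (corner N)"
    unfolding corner_def
    by (intro N.z2_group_sub_rmod)
      (simp_all add: N.act_zero_right N.act_add_right N.act_minus_right \<psi>_closed)
next
  fix a g n h assume "a \<in> homog A g" "n \<in> homog (corner N) h"
  then show "a \<odot>\<^bsub>corner N\<^esub> n \<in> homog (corner N) (h + g)"
    using \<psi>_homog[of a g 0 0] N.homog_act[of "\<psi> 0 0 a" g n h] subsetD[OF homog_A, of a g]
    by (simp add: corner_simps \<psi>_\<psi>_act N.act_closed \<psi>_closed)
next
  fix a b m assume ab: "a \<in> carrier A" "b \<in> carrier A" "m \<in> carrier (corner N)"
  then show "(a \<otimes>\<^bsub>A\<^esub> b) \<odot>\<^bsub>corner N\<^esub> m = b \<odot>\<^bsub>corner N\<^esub> (a \<odot>\<^bsub>corner N\<^esub> m)"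
    using \<psi>_\<psi>_act[of m a b 0 0 0 0] by (simp add: corner_simps)
qed (simp_all add: corner_simps \<psi>_\<psi>_act \<psi>_closed \<psi>_add N.act_closed N.act_add_left N.act_add_right)

text \<open>The submodule of N that corresponds to L. Both coordinates have to be tested because the
  action of D mixes them.\<close>

lemma submod_corner_pair:
  assumes "submod A (corner N) L"
  shows "submod D N {n \<in> carrier N. e \<odot>\<^bsub>N\<^esub> n \<in> L \<and> u \<odot>\<^bsub>N\<^esub> n \<in> L}"
  unfolding submod_def
proof (intro conjI ballI)
  have L: "\<zero>\<^bsub>N\<^esub> \<in> L" "\<And>x y. \<lbrakk>x \<in> L; y \<in> L\<rbrakk> \<Longrightarrow> x \<oplus>\<^bsub>N\<^esub> y \<in> L"
    "\<And>a x. \<lbrakk>a \<in> carrier A; x \<in> L\<rbrakk> \<Longrightarrow> \<psi> 0 0 a \<odot>\<^bsub>N\<^esub> x \<in> L"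
    using assms by (simp_all add: submod_def corner_simps)
  let ?K = "{n \<in> carrier N. e \<odot>\<^bsub>N\<^esub> n \<in> L \<and> u \<odot>\<^bsub>N\<^esub> n \<in> L}"
  show "\<zero>\<^bsub>N\<^esub> \<in> ?K" using L(1) by (simp add: N.act_zero_right \<psi>_closed)
  show "x \<oplus>\<^bsub>N\<^esub> y \<in> ?K" if "x \<in> ?K" "y \<in> ?K" for x y
    using that by (simp add: N.act_add_right \<psi>_closed L(2))
  show "d \<odot>\<^bsub>N\<^esub> x \<in> ?K" if "d \<in> carrier D" "x \<in> ?K" for d x
    using that by (simp add: act_e_u N.act_closed L(2,3) \<phi>_closed)
qed simp

text \<open>The elements se with s in S do not suffice in general: by \<open>act_e_u\<close> the
  element (sd)e also involves su.\<close>

lemma finitely_generated_corner: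
  assumes "finitely_generated_rmod D N"
  shows "finitely_generated_rmod A (corner N)"
proof -
  interpret F: z2_rmod A "corner N" by (rule z2_rmod_corner)
  obtain S where S: "finite S" "generates D N S (carrier N)"
    using assms N.finitely_generated_iff by blast
  have c: "S \<subseteq> carrier N" using S(2) by (simp add: generates_def)
  let ?T = "(\<lambda>s. e \<odot>\<^bsub>N\<^esub> s) ` S \<union> (\<lambda>s. u \<odot>\<^bsub>N\<^esub> s) ` S"
  have "generates A (corner N) ?T (carrier (corner N))"
    unfolding generates_def
  proof (intro conjI allI impI)
    show "?T \<subseteq> carrier (corner N)" using c e_act_closed u_act_closed by auto
    fix L assume L: "submod A (corner N) L" "?T \<subseteq> L"
    have "S \<subseteq> {n \<in> carrier N. e \<odot>\<^bsub>N\<^esub> n \<in> L \<and> u \<odot>\<^bsub>N\<^esub> n \<in> L}" using c L(2) by auto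
    then have *: "carrier N \<subseteq> {n \<in> carrier N. e \<odot>\<^bsub>N\<^esub> n \<in> L \<and> u \<odot>\<^bsub>N\<^esub> n \<in> L}"
      using S(2) submod_corner_pair[OF L(1)] by (simp add: generates_def)
    show "carrier (corner N) \<subseteq> L"
    proof
      fix n assume "n \<in> carrier (corner N)"
      then have "n \<in> carrier N" "e \<odot>\<^bsub>N\<^esub> n = n" by (simp_all add: corner_simps)
      then show "n \<in> L" using subsetD[OF *, of n] by simp
    qed
  qed
  then show ?thesis
    unfolding F.finitely_generated_iff using S(1) by (intro exI[of _ ?T]) simp
qed

lemma submod_corner:
  assumes "submod D N K"
  shows "submod A (corner N) {n \<in> K. e \<odot>\<^bsub>N\<^esub> n = n}"
proof -
  have K: "K \<subseteq> carrier N" "\<zero>\<^bsub>N\<^esub> \<in> K" "\<And>x y. \<lbrakk>x \<in> K; y \<in> K\<rbrakk> \<Longrightarrow> x \<oplus>\<^bsub>N\<^esub> y \<in> K"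
    "\<And>a x. \<lbrakk>a \<in> carrier D; x \<in> K\<rbrakk> \<Longrightarrow> a \<odot>\<^bsub>N\<^esub> x \<in> K"
    using assms by (simp_all add: submod_def)
  show ?thesis
    unfolding submod_def
  proof (intro conjI ballI)
    show "{n \<in> K. e \<odot>\<^bsub>N\<^esub> n = n} \<subseteq> carrier (corner N)"
      using K(1) by (auto simp: corner_simps)
    show "\<zero>\<^bsub>corner N\<^esub> \<in> {n \<in> K. e \<odot>\<^bsub>N\<^esub> n = n}"
      using K(2) by (simp add: corner_simps N.act_zero_right \<psi>_closed)
  next
    fix x y assume xy: "x \<in> {n \<in> K. e \<odot>\<^bsub>N\<^esub> n = n}" "y \<in> {n \<in> K. e \<odot>\<^bsub>N\<^esub> n = n}"
    then have "x \<in> carrier N" "y \<in> carrier N" using K(1) by auto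
    with xy show "x \<oplus>\<^bsub>corner N\<^esub> y \<in> {n \<in> K. e \<odot>\<^bsub>N\<^esub> n = n}"
      by (simp add: corner_simps N.act_add_right \<psi>_closed K(3))
  next
    fix a x assume ax: "a \<in> carrier A" "x \<in> {n \<in> K. e \<odot>\<^bsub>N\<^esub> n = n}"
    then have "x \<in> carrier N" using K(1) by auto
    with ax show "a \<odot>\<^bsub>corner N\<^esub> x \<in> {n \<in> K. e \<odot>\<^bsub>N\<^esub> n = n}"
      by (simp add: corner_simps \<psi>_\<psi>_act \<psi>_closed K(4))
  qed
qed

end

lemma fg_rmod_corner: "fg_rmod D N \<Longrightarrow> fg_rmod A (corner N)"
  by (simp add: fg_rmod_def z2_rmod_corner finitely_generated_corner)

text \<open>Each l in L is le + (lu)v, where le and lu lie in the corner part of L. Generators of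
  that part over A therefore generate L over D.\<close>

lemma submodules_fg_transfer:
  assumes "submodules_fg A TYPE('u)"
  shows "submodules_fg D TYPE('u)"
  unfolding submodules_fg_def
proof (intro allI impI)
  fix N :: "(bit, 'd, 'u) graded" and L
  assume fg: "fg_rmod D N" and L: "submod D N L"
  then have N: "z2_rmod D N" by (simp add: fg_rmod_def)
  interpret N: z2_rmod D N by (rule N)
  have Lc: "L \<subseteq> carrier N" using L by (simp add: submod_def)
  obtain S where S: "finite S" "generates A (corner N) S {n \<in> L. e \<odot>\<^bsub>N\<^esub> n = n}"
    using assms fg_rmod_corner[OF fg] submod_corner[OF N L] unfolding submodules_fg_def by blast
  have "generates D N S L"
    unfolding generates_def
  proof (intro conjI allI impI subsetI)
    show "s \<in> L" if "s \<in> S" for s using S(2) that by (auto simp: generates_def)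
    fix K l assume K: "submod D N K" "S \<subseteq> K" and l: "l \<in> L"
    have "S \<subseteq> {n \<in> K. e \<odot>\<^bsub>N\<^esub> n = n}"
      using S(2) K(2) by (auto simp: generates_def)
    then have *: "{n \<in> L. e \<odot>\<^bsub>N\<^esub> n = n} \<subseteq> {n \<in> K. e \<odot>\<^bsub>N\<^esub> n = n}"
      using S(2) submod_corner[OF N K(1)] by (simp add: generates_def)
    have c: "l \<in> carrier N" using l Lc by auto
    have "\<psi> r 0 \<one>\<^bsub>A\<^esub> \<odot>\<^bsub>N\<^esub> l \<in> {n \<in> L. e \<odot>\<^bsub>N\<^esub> n = n}" for r
      using L l c by (simp add: submod_def \<psi>_closed \<psi>_\<psi>_act[OF N])
    then have "\<psi> r 0 \<one>\<^bsub>A\<^esub> \<odot>\<^bsub>N\<^esub> l \<in> K" for r using * by blast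
    then have "e \<odot>\<^bsub>N\<^esub> l \<oplus>\<^bsub>N\<^esub> v \<odot>\<^bsub>N\<^esub> (u \<odot>\<^bsub>N\<^esub> l) \<in> K"
      using K(1) by (simp add: submod_def \<psi>_closed)
    then show "l \<in> K" using split_act[OF N c] by simp
  qed
  with S(1) show "\<exists>S. finite S \<and> generates D N S L" by blast
qed

section \<open>Row vectors over a module\<close>

context
  fixes M :: "(bit, 'a, 'm) graded"
  assumes M: "z2_rmod A M"
begin

interpretation M: z2_rmod A M by (rule M)

lemma z2_rmod_columns: "z2_rmod D (columns M)"
proof (intro z2_rmod.intro z2_rmod_axioms.intro D.ring_axioms)
  have "z2_group (shift_rmod 1 M)"
  proof (rule z2_groupI)
    fix x assume "x \<in> carrier (shift_rmod 1 M)"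
    then have x: "x \<in> carrier M" by (simp add: shift_rmod_def)
    from M.homog_splitE'[OF x, of 1] obtain y z where
      "y \<in> homog M 1" "z \<in> homog M (1 + 1)" "y \<in> carrier M" "z \<in> carrier M" "x = y \<oplus>\<^bsub>M\<^esub> z" .
    then show "\<exists>x0\<in>homog (shift_rmod 1 M) 0. \<exists>x1\<in>homog (shift_rmod 1 M) 1. x = x0 \<oplus>\<^bsub>shift_rmod 1 M\<^esub> x1"
      by (intro bexI[of _ y] bexI[of _ z]) (simp_all add: shift_rmod_def)
    show "\<exists>y\<in>carrier (shift_rmod 1 M). y \<oplus>\<^bsub>shift_rmod 1 M\<^esub> x = \<zero>\<^bsub>shift_rmod 1 M\<^esub>"
      using x by (intro bexI[of _ "\<ominus>\<^bsub>M\<^esub> x"]) (simp_all add: shift_rmod_def M.M.l_neg)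
  next
    fix x g assume "x \<in> homog (shift_rmod 1 M) g"
    then have "x \<in> homog M (g + 1)" by (simp add: shift_rmod_def)
    then show "\<exists>y\<in>homog (shift_rmod 1 M) g. y \<oplus>\<^bsub>shift_rmod 1 M\<^esub> x = \<zero>\<^bsub>shift_rmod 1 M\<^esub>"
      using M.homog_closed[of x "g + 1"] M.homog_minus[of x "g + 1"]
      by (intro bexI[of _ "\<ominus>\<^bsub>M\<^esub> x"]) (simp_all add: shift_rmod_def M.M.l_neg)
  qed (auto simp: shift_rmod_def M.M.a_ac M.homog_closed M.homog_zero M.homog_add M.homog_disjoint)
  then show "z2_group (columns M)"
    unfolding columns_def by (intro z2_group_dsum_rmod M.z2_group_axioms)
next
  fix d g m h assume d: "d \<in> homog D g" and "m \<in> homog (columns M) h"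
  then have m: "fst m \<in> homog M h" "snd m \<in> homog M (h + 1)"
    by (auto simp: columns_simps mem_Times_iff)
  \<comment> \<open>Row r of the matrix meets a component shifted by r, so in each of the four
    products the index r cancels; the column index gives the shift of the result.\<close>
  have "\<phi> 0 0 d \<odot>\<^bsub>M\<^esub> fst m \<in> homog M (h + g)" "\<phi> 0 1 d \<odot>\<^bsub>M\<^esub> fst m \<in> homog M (h + g + 1)"
    using M.homog_act[OF \<phi>_homog[OF d, of 0 0] m(1)] M.homog_act[OF \<phi>_homog[OF d, of 0 1] m(1)]
    by (simp_all add: ac_simps)
  moreover have "\<phi> 1 0 d \<odot>\<^bsub>M\<^esub> snd m \<in> homog M (h + g)" "\<phi> 1 1 d \<odot>\<^bsub>M\<^esub> snd m \<in> homog M (h + g + 1)"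
    using M.homog_act[OF \<phi>_homog[OF d, of 1 0] m(2)] M.homog_act[OF \<phi>_homog[OF d, of 1 1] m(2)]
    by (simp_all add: ac_simps)
  ultimately show "d \<odot>\<^bsub>columns M\<^esub> m \<in> homog (columns M) (h + g)"
    by (simp add: columns_simps M.homog_add)
next
  fix a b m assume "a \<in> carrier D" "b \<in> carrier D" "m \<in> carrier (columns M)"
  then show "(a \<otimes>\<^bsub>D\<^esub> b) \<odot>\<^bsub>columns M\<^esub> m = b \<odot>\<^bsub>columns M\<^esub> (a \<odot>\<^bsub>columns M\<^esub> m)"
    by (auto simp: columns_simps \<phi>_mult \<phi>_closed M.act_add_left M.act_add_right M.act_mult M.act_closed M.M.a_ac)
next
  fix a b m assume "a \<in> carrier D" "b \<in> carrier D" "m \<in> carrier (columns M)"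
  then show "(a \<oplus>\<^bsub>D\<^esub> b) \<odot>\<^bsub>columns M\<^esub> m = a \<odot>\<^bsub>columns M\<^esub> m \<oplus>\<^bsub>columns M\<^esub> b \<odot>\<^bsub>columns M\<^esub> m"
    by (auto simp: columns_simps \<phi>_add \<phi>_closed M.act_add_left M.act_closed M.M.a_ac)
next
  fix a m n assume "a \<in> carrier D" "m \<in> carrier (columns M)" "n \<in> carrier (columns M)"
  then show "a \<odot>\<^bsub>columns M\<^esub> (m \<oplus>\<^bsub>columns M\<^esub> n) = a \<odot>\<^bsub>columns M\<^esub> m \<oplus>\<^bsub>columns M\<^esub> a \<odot>\<^bsub>columns M\<^esub> n"
    by (auto simp: columns_simps \<phi>_closed M.act_add_right M.act_closed M.M.a_ac)
qed (auto simp: columns_simps \<phi>_closed \<phi>_one M.act_closed M.act_zero_left M.act_one)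

lemma \<psi>_columns:
  assumes "a \<in> carrier A" "p \<in> carrier M" "q \<in> carrier M"
  shows "\<psi> 0 0 a \<odot>\<^bsub>columns M\<^esub> (p, q) = (a \<odot>\<^bsub>M\<^esub> p, \<zero>\<^bsub>M\<^esub>)"
    and "\<psi> 0 1 a \<odot>\<^bsub>columns M\<^esub> (p, q) = (\<zero>\<^bsub>M\<^esub>, a \<odot>\<^bsub>M\<^esub> p)"
  using assms by (simp_all add: columns_simps \<phi>_\<psi> M.act_zero_left M.act_closed)

text \<open>Generators of the form (s, 0) suffice, because the matrix unit at (0, 1) turns (m, 0)
  into (0, m).\<close>

lemma finitely_generated_columns:
  assumes "finitely_generated_rmod A M"
  shows "finitely_generated_rmod D (columns M)"
proof -
  interpret G: z2_rmod D "columns M" by (rule z2_rmod_columns)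
  obtain S where S: "finite S" "generates A M S (carrier M)"
    using assms M.finitely_generated_iff by blast
  have c: "S \<subseteq> carrier M" using S(2) by (simp add: generates_def)
  let ?T = "(\<lambda>s. (s, \<zero>\<^bsub>M\<^esub>)) ` S"
  have "generates D (columns M) ?T (carrier (columns M))"
    unfolding generates_def
  proof (intro conjI allI impI)
    show "?T \<subseteq> carrier (columns M)" using c by (auto simp: columns_simps)
    fix L assume L: "submod D (columns M) L" "?T \<subseteq> L"
    have add: "x \<oplus>\<^bsub>columns M\<^esub> y \<in> L" if "x \<in> L" "y \<in> L" for x y
      using L(1) that by (simp add: submod_def)
    have act: "d \<odot>\<^bsub>columns M\<^esub> x \<in> L" if "d \<in> carrier D" "x \<in> L" for d x
      using L(1) that by (simp add: submod_def)
    have "submod A M {m \<in> carrier M. (m, \<zero>\<^bsub>M\<^esub>) \<in> L}"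
      unfolding submod_def
    proof (intro conjI ballI)
      show "\<zero>\<^bsub>M\<^esub> \<in> {m \<in> carrier M. (m, \<zero>\<^bsub>M\<^esub>) \<in> L}"
        using L(1) by (simp add: submod_def columns_simps)
    next
      fix x y assume "x \<in> {m \<in> carrier M. (m, \<zero>\<^bsub>M\<^esub>) \<in> L}" "y \<in> {m \<in> carrier M. (m, \<zero>\<^bsub>M\<^esub>) \<in> L}"
      then show "x \<oplus>\<^bsub>M\<^esub> y \<in> {m \<in> carrier M. (m, \<zero>\<^bsub>M\<^esub>) \<in> L}"
        using add[of "(x, \<zero>\<^bsub>M\<^esub>)" "(y, \<zero>\<^bsub>M\<^esub>)"] by (simp add: columns_simps)
    next
      fix a x assume "a \<in> carrier A" "x \<in> {m \<in> carrier M. (m, \<zero>\<^bsub>M\<^esub>) \<in> L}"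
      then show "a \<odot>\<^bsub>M\<^esub> x \<in> {m \<in> carrier M. (m, \<zero>\<^bsub>M\<^esub>) \<in> L}"
        using act[of "\<psi> 0 0 a" "(x, \<zero>\<^bsub>M\<^esub>)"] by (simp add: \<psi>_columns \<psi>_closed M.act_closed)
    qed simp
    moreover have "S \<subseteq> {m \<in> carrier M. (m, \<zero>\<^bsub>M\<^esub>) \<in> L}" using c L(2) by auto
    ultimately have *: "carrier M \<subseteq> {m \<in> carrier M. (m, \<zero>\<^bsub>M\<^esub>) \<in> L}"
      using S(2) by (simp add: generates_def)
    have 1: "(m, \<zero>\<^bsub>M\<^esub>) \<in> L" if "m \<in> carrier M" for m
      using subsetD[OF * that] by simp
    have 2: "(\<zero>\<^bsub>M\<^esub>, m) \<in> L" if "m \<in> carrier M" for m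
      using act[OF \<psi>_closed[OF A.one_closed] 1[OF that], of 0 1] that
      by (simp add: \<psi>_columns M.act_one)
    show "carrier (columns M) \<subseteq> L"
    proof
      fix p assume "p \<in> carrier (columns M)"
      then have "fst p \<in> carrier M" "snd p \<in> carrier M" by (simp_all add: columns_simps mem_Times_iff)
      then show "p \<in> L"
        using add[OF 1[of "fst p"] 2[of "snd p"]] by (simp add: columns_simps)
    qed
  qed
  then show ?thesis
    unfolding G.finitely_generated_iff using S(1) by (intro exI[of _ ?T]) simp
qed

end

end

section \<open>The equivalence of categories\<close>

locale z2_morita = z2_matrix_iso A D \<phi> \<psi>
  for A :: "(bit, complex, 'a) graded" and D :: "(bit, complex, 'd) graded" and \<phi> \<psi> +
  fixes j :: "'u \<times> 'u \<Rightarrow> 'u"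
  assumes inj_j: "inj j" and submodules_fg: "submodules_fg A TYPE('u)"
begin

sublocale CA: noetherian_gr A j
  by (intro noetherian_gr.intro A.ring_axioms homog_A inj_j submodules_fg)

sublocale CD: noetherian_gr D j
  by (intro noetherian_gr.intro D.ring_axioms homog_D inj_j submodules_fg_transfer submodules_fg)

definition k :: "'u \<Rightarrow> 'u \<times> 'u" where "k = inv_into UNIV j"

lemma k_j [simp]: "k (j p) = p"
  using inj_j by (simp add: k_def)

text \<open>The passage to pairs leaves the universe \<open>'u\<close>, and \<open>j\<close> leads
  back to it. The opposite functor \<open>corner\<close> needs no transport, since it keeps a subset
  of the elements.\<close>

definition G :: "(bit, 'a, 'u) graded \<Rightarrow> (bit, 'd, 'u) graded" where
  "G M = image_rmod j (columns M)"

definition Gm :: "(bit, 'a, 'u) graded \<Rightarrow> (bit, 'a, 'u) graded \<Rightarrow> ('u \<Rightarrow> 'u) \<Rightarrow> 'u \<Rightarrow> 'u" where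
  "Gm M M' f = (\<lambda>q\<in>carrier (G M). j (f (fst (k q)), f (snd (k q))))"

definition Fm :: "(bit, 'd, 'u) graded \<Rightarrow> (bit, 'd, 'u) graded \<Rightarrow> ('u \<Rightarrow> 'u) \<Rightarrow> 'u \<Rightarrow> 'u" where
  "Fm N N' f = (\<lambda>n\<in>carrier (corner N). f n)"

lemma G_carrier: "q \<in> carrier (G M) \<longleftrightarrow> (\<exists>x\<in>carrier M. \<exists>y\<in>carrier M. q = j (x, y))"
  and G_homog: "q \<in> homog (G M) g \<longleftrightarrow> (\<exists>x\<in>homog M g. \<exists>y\<in>homog M (g + 1). q = j (x, y))"
  by (auto simp: G_def image_rmod_simps columns_simps)

lemma j_carrier [simp]: "j (x, y) \<in> carrier (G M) \<longleftrightarrow> x \<in> carrier M \<and> y \<in> carrier M"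
  and j_homog [simp]: "j (x, y) \<in> homog (G M) g \<longleftrightarrow> x \<in> homog M g \<and> y \<in> homog M (g + 1)"
  using injD[OF inj_j] by (auto simp: G_carrier G_homog)

context
  fixes M :: "(bit, 'a, 'u) graded"
  assumes M: "fg_rmod A M"
begin

interpretation M: z2_rmod A M using M by (simp add: fg_rmod_def)
interpretation c: z2_rmod D "columns M" by (rule z2_rmod_columns) (rule M.z2_rmod_axioms)
interpretation I: rmod_image D "columns M" j "{\<zero>\<^bsub>columns M\<^esub>}"
  by (rule c.rmod_image_inj[OF homog_D]) (rule inj_on_subset[OF inj_j subset_UNIV])

lemma fg_rmod_G: "fg_rmod D (G M)"
  unfolding G_def fg_rmod_def
  using I.z2_rmod_image I.finitely_generated_image finitely_generated_columns[OF M.z2_rmod_axioms] M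
  by (simp add: fg_rmod_def)

lemma G_add: "\<lbrakk>x \<in> carrier M; y \<in> carrier M; x' \<in> carrier M; y' \<in> carrier M\<rbrakk> \<Longrightarrow>
    j (x, y) \<oplus>\<^bsub>G M\<^esub> j (x', y') = j (x \<oplus>\<^bsub>M\<^esub> x', y \<oplus>\<^bsub>M\<^esub> y')"
  using I.\<pi>_add[of "(x, y)" "(x', y')"] by (simp add: G_def columns_simps)

lemma G_act: "\<lbrakk>d \<in> carrier D; x \<in> carrier M; y \<in> carrier M\<rbrakk> \<Longrightarrow>
    d \<odot>\<^bsub>G M\<^esub> j (x, y) = j (\<phi> 0 0 d \<odot>\<^bsub>M\<^esub> x \<oplus>\<^bsub>M\<^esub> \<phi> 1 0 d \<odot>\<^bsub>M\<^esub> y, \<phi> 0 1 d \<odot>\<^bsub>M\<^esub> x \<oplus>\<^bsub>M\<^esub> \<phi> 1 1 d \<odot>\<^bsub>M\<^esub> y)"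
  using I.\<pi>_act[of d "(x, y)"] by (simp add: G_def columns_simps)

lemma G_act_\<psi>: "\<lbrakk>a \<in> carrier A; x \<in> carrier M; y \<in> carrier M\<rbrakk> \<Longrightarrow>
    \<psi> 0 0 a \<odot>\<^bsub>G M\<^esub> j (x, y) = j (a \<odot>\<^bsub>M\<^esub> x, \<zero>\<^bsub>M\<^esub>)"
  by (simp add: G_act \<psi>_closed \<phi>_\<psi> M.act_zero_left M.act_closed)

lemma corner_G: "q \<in> carrier (corner (G M)) \<longleftrightarrow> (\<exists>x\<in>carrier M. q = j (x, \<zero>\<^bsub>M\<^esub>))"
proof
  assume "q \<in> carrier (corner (G M))"
  then obtain x y where xy: "x \<in> carrier M" "y \<in> carrier M" "q = j (x, y)" and "e \<odot>\<^bsub>G M\<^esub> q = q"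
    by (auto simp: corner_simps G_carrier)
  then have "q = j (x, \<zero>\<^bsub>M\<^esub>)" by (simp add: G_act_\<psi> M.act_one)
  then show "\<exists>x\<in>carrier M. q = j (x, \<zero>\<^bsub>M\<^esub>)" using xy by blast
next
  assume "\<exists>x\<in>carrier M. q = j (x, \<zero>\<^bsub>M\<^esub>)"
  then show "q \<in> carrier (corner (G M))"
    by (auto simp: corner_simps G_act_\<psi> M.act_one)
qed

end

lemma Gm_hom:
  assumes "fg_rmod A M" "fg_rmod A M'" "f \<in> graded_hom A M M'"
  shows "Gm M M' f \<in> graded_hom D (G M) (G M')"
proof -
  interpret f: z2_hom A M M' f using assms by (intro z2_homI)
  have Gm: "Gm M M' f (j (x, y)) = j (f x, f y)" if "x \<in> carrier M" "y \<in> carrier M" for x y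
    using that by (simp add: Gm_def)
  show ?thesis
  proof (rule graded_homI)
    show "Gm M M' f \<in> extensional (carrier (G M))" by (simp add: Gm_def)
  qed (auto simp: G_carrier[of _ M] G_homog[of _ M] Gm G_add assms G_act f.hom_closed f.hom_add f.hom_act f.hom_homog
      \<phi>_closed f.X.act_closed f.X.homog_closed)
qed

lemma Fm_hom:
  assumes "fg_rmod D N" "fg_rmod D N'" "f \<in> graded_hom D N N'"
  shows "Fm N N' f \<in> graded_hom A (corner N) (corner N')"
proof -
  interpret f: z2_hom D N N' f using assms by (intro z2_homI)
  interpret F: z2_rmod A "corner N" by (rule z2_rmod_corner[OF f.X.z2_rmod_axioms])
  have eq: "e \<odot>\<^bsub>N'\<^esub> f n = f n" if "n \<in> carrier N" "e \<odot>\<^bsub>N\<^esub> n = n" for n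
    using f.hom_act[of e n] that by (simp add: \<psi>_closed)
  show ?thesis
  proof (rule graded_homI)
    show "Fm N N' f \<in> extensional (carrier (corner N))" by (simp add: Fm_def)
    show "Fm N N' f m \<in> carrier (corner N')" if "m \<in> carrier (corner N)" for m
      using that by (simp add: Fm_def corner_simps eq f.hom_closed)
    show "Fm N N' f (m \<oplus>\<^bsub>corner N\<^esub> n) = Fm N N' f m \<oplus>\<^bsub>corner N'\<^esub> Fm N N' f n"
      if "m \<in> carrier (corner N)" "n \<in> carrier (corner N)" for m n
      using that F.M.a_closed[OF that] by (simp add: Fm_def corner_simps f.hom_add)
    show "Fm N N' f (a \<odot>\<^bsub>corner N\<^esub> m) = a \<odot>\<^bsub>corner N'\<^esub> Fm N N' f m"
      if "a \<in> carrier A" "m \<in> carrier (corner N)" for a m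
      using that F.act_closed[OF that] by (simp add: Fm_def corner_simps f.hom_act \<psi>_closed)
    show "Fm N N' f m \<in> homog (corner N') g" if "m \<in> homog (corner N) g" for m g
      using that by (simp add: Fm_def corner_simps eq f.hom_homog f.hom_closed)
  qed
qed

lemma additive_functor_G: "additive_functor CA.C CD.C G Gm"
  unfolding additive_functor_def
proof (intro conjI ballI)
  fix X Y f assume o: "X \<in> Ob CA.C" "Y \<in> Ob CA.C" "f \<in> Hom CA.C X Y"
  note a = o[unfolded gr_cat_simps]
  interpret f: z2_hom A X Y f using a by (intro z2_homI)
  show "Gm X Y f \<in> Hom CD.C (G X) (G Y)" using a by (simp add: Gm_hom)
  fix g assume g: "g \<in> Hom CA.C X Y"
  interpret g: z2_hom A X Y g using a g by (intro z2_homI) simp_all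
  show "Gm X Y (HAdd CA.C X Y f g) = HAdd CD.C (G X) (G Y) (Gm X Y f) (Gm X Y g)"
    unfolding gr_cat_simps Gm_def
    by (rule restrict_ext) (auto simp: G_carrier[of _ X] G_add[OF a(2)] f.hom_closed g.hom_closed)
next
  fix X Y Z f g assume o: "X \<in> Ob CA.C" "Y \<in> Ob CA.C" "Z \<in> Ob CA.C" "f \<in> Hom CA.C X Y" "g \<in> Hom CA.C Y Z"
  note a = o[unfolded gr_cat_simps]
  interpret f: z2_hom A X Y f using a by (intro z2_homI)
  show "Gm X Z (Cmp CA.C X Y Z g f) = Cmp CD.C (G X) (G Y) (G Z) (Gm Y Z g) (Gm X Y f)"
    unfolding gr_cat_simps Gm_def compose_def
    by (rule restrict_ext) (auto simp: G_carrier[of _ X] f.hom_closed)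
next
  fix X assume "X \<in> Ob CA.C"
  then show "G X \<in> Ob CD.C" by (simp add: fg_rmod_G)
  show "Gm X X (Idn CA.C X) = Idn CD.C (G X)"
    unfolding gr_cat_simps Gm_def by (rule restrict_ext) (auto simp: G_carrier)
qed

lemma additive_functor_F: "additive_functor CD.C CA.C corner Fm"
  unfolding additive_functor_def
proof (intro conjI ballI)
  fix X Y f assume o: "X \<in> Ob CD.C" "Y \<in> Ob CD.C" "f \<in> Hom CD.C X Y"
  note a = o[unfolded gr_cat_simps]
  show "Fm X Y f \<in> Hom CA.C (corner X) (corner Y)" using a by (simp add: Fm_hom)
  fix g assume g: "g \<in> Hom CD.C X Y"
  show "Fm X Y (HAdd CD.C X Y f g) = HAdd CA.C (corner X) (corner Y) (Fm X Y f) (Fm X Y g)"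
    unfolding gr_cat_simps Fm_def by (rule restrict_ext) (simp add: corner_simps)
next
  fix X Y Z f g assume o: "X \<in> Ob CD.C" "Y \<in> Ob CD.C" "Z \<in> Ob CD.C" "f \<in> Hom CD.C X Y" "g \<in> Hom CD.C Y Z"
  note a = o[unfolded gr_cat_simps]
  note c = graded_homD(2)[OF Fm_hom[OF a(1,2,4)]]
  show "Fm X Z (Cmp CD.C X Y Z g f) = Cmp CA.C (corner X) (corner Y) (corner Z) (Fm Y Z g) (Fm X Y f)"
    unfolding gr_cat_simps compose_def
  proof
    fix n
    show "Fm X Z (\<lambda>x\<in>carrier X. g (f x)) n = (\<lambda>x\<in>carrier (corner X). Fm Y Z g (Fm X Y f x)) n"
      using c[of n] by (simp add: Fm_def restrict_def corner_simps(1)[of _ X])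
  qed
next
  fix X assume "X \<in> Ob CD.C"
  then show "corner X \<in> Ob CA.C" by (simp add: fg_rmod_corner)
  show "Fm X X (Idn CD.C X) = Idn CA.C (corner X)"
    unfolding gr_cat_simps Fm_def by (rule restrict_ext) (simp add: corner_simps)
qed

text \<open>By \<open>split_act\<close> the pair (ne, nu) determines n. That \<open>u\<close> is odd
  agrees with the shift of the second component of \<open>columns\<close>.\<close>

definition \<eta> :: "(bit, 'd, 'u) graded \<Rightarrow> 'u \<Rightarrow> 'u" where
  "\<eta> N = (\<lambda>n\<in>carrier N. j (e \<odot>\<^bsub>N\<^esub> n, u \<odot>\<^bsub>N\<^esub> n))"

definition \<epsilon> :: "(bit, 'a, 'u) graded \<Rightarrow> 'u \<Rightarrow> 'u" where
  "\<epsilon> M = (\<lambda>q\<in>carrier (corner (G M)). fst (k q))"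

lemma is_iso_\<eta>:
  assumes "fg_rmod D N"
  shows "is_iso CD.C N (G (corner N)) (\<eta> N)"
proof (rule is_iso_gr_cat)
  have N: "z2_rmod D N" using assms by (simp add: fg_rmod_def)
  interpret N: z2_rmod D N by (rule N)
  have fgc: "fg_rmod A (corner N)" using assms by (rule fg_rmod_corner)
  interpret F: z2_rmod A "corner N" using fgc by (simp add: fg_rmod_def)
  note cl = e_act_closed[OF N] u_act_closed[OF N]
  have add: "add (corner N) = add N" by (simp add: corner_simps)
  show "fg_rmod D (G (corner N))" by (rule fg_rmod_G[OF fgc])
  show "\<eta> N \<in> graded_hom D N (G (corner N))"
  proof (rule graded_homI)
    show "\<eta> N \<in> extensional (carrier N)" by (simp add: \<eta>_def)
    show "\<eta> N m \<in> carrier (G (corner N))" if "m \<in> carrier N" for m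
      using that by (simp add: \<eta>_def cl)
    show "\<eta> N (m \<oplus>\<^bsub>N\<^esub> n) = \<eta> N m \<oplus>\<^bsub>G (corner N)\<^esub> \<eta> N n" if "m \<in> carrier N" "n \<in> carrier N" for m n
      using that by (simp add: \<eta>_def G_add[OF fgc] cl add N.act_add_right \<psi>_closed)
    show "\<eta> N (d \<odot>\<^bsub>N\<^esub> n) = d \<odot>\<^bsub>G (corner N)\<^esub> \<eta> N n" if "d \<in> carrier D" "n \<in> carrier N" for d n
      using that by (simp add: \<eta>_def G_act[OF fgc] cl N.act_closed act_e_u[OF N] add corner_simps(4))
    show "\<eta> N n \<in> homog (G (corner N)) g" if n: "n \<in> homog N g" for n g
      using N.homog_closed[OF n] N.homog_act[OF e_homog n] N.homog_act[OF u_homog n]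
        cl[of n] by (simp add: \<eta>_def corner_simps)
  qed
  have eq: "n = e \<odot>\<^bsub>N\<^esub> n \<oplus>\<^bsub>N\<^esub> v \<odot>\<^bsub>N\<^esub> (u \<odot>\<^bsub>N\<^esub> n)" if "n \<in> carrier N" for n
    by (rule split_act[OF N that])
  show "inj_on (\<eta> N) (carrier N)"
  proof (rule inj_onI)
    fix m n assume mn: "m \<in> carrier N" "n \<in> carrier N" "\<eta> N m = \<eta> N n"
    then have "k (\<eta> N m) = k (\<eta> N n)" by simp
    then have "e \<odot>\<^bsub>N\<^esub> m = e \<odot>\<^bsub>N\<^esub> n" "u \<odot>\<^bsub>N\<^esub> m = u \<odot>\<^bsub>N\<^esub> n"
      using mn(1,2) by (simp_all add: \<eta>_def)
    then show "m = n" using eq[OF mn(1)] eq[OF mn(2)] by simp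
  qed
  show "\<eta> N ` carrier N = carrier (G (corner N))"
  proof
    show "\<eta> N ` carrier N \<subseteq> carrier (G (corner N))"
      by (rule image_subsetI) (simp add: \<eta>_def cl)
    show "carrier (G (corner N)) \<subseteq> \<eta> N ` carrier N"
    proof
      fix q assume "q \<in> carrier (G (corner N))"
      then obtain x y where xy: "x \<in> carrier N" "e \<odot>\<^bsub>N\<^esub> x = x" "y \<in> carrier N" "e \<odot>\<^bsub>N\<^esub> y = y"
        and q: "q = j (x, y)"
        by (auto simp: G_carrier corner_simps)
      \<comment> \<open>The candidate for a preimage of (x, y) is the recombination x + yv suggested
        by \<open>split_act\<close>.\<close>
      define n where "n = x \<oplus>\<^bsub>N\<^esub> v \<odot>\<^bsub>N\<^esub> y"
      have vy: "v \<odot>\<^bsub>N\<^esub> y \<in> carrier N" using xy by (simp add: N.act_closed \<psi>_closed)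
      have n: "n \<in> carrier N" using xy vy by (simp add: n_def)
      have "e \<odot>\<^bsub>N\<^esub> n = x"
        using xy vy by (simp add: n_def N.act_add_right \<psi>_\<psi>_act[OF N] \<psi>_closed)
      \<comment> \<open>As x is fixed by \<open>e\<close>, this is the vanishing of the product of
        the matrix units at (0, 0) and (1, 0), in this order.\<close>
      moreover have "u \<odot>\<^bsub>N\<^esub> x = \<zero>\<^bsub>N\<^esub>"
        using \<psi>_\<psi>_act[OF N xy(1) A.one_closed A.one_closed, of 1 0 0 0] xy(2) by simp
      then have "u \<odot>\<^bsub>N\<^esub> n = y"
        using xy vy by (simp add: n_def N.act_add_right \<psi>_\<psi>_act[OF N] \<psi>_closed)
      ultimately have "q = \<eta> N n" using n q by (simp add: \<eta>_def)
      then show "q \<in> \<eta> N ` carrier N" using n by simp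
    qed
  qed
qed (rule assms)

lemma is_iso_\<epsilon>:
  assumes M: "fg_rmod A M"
  shows "is_iso CA.C (corner (G M)) M (\<epsilon> M)"
proof (rule is_iso_gr_cat)
  interpret M: z2_rmod A M using M by (simp add: fg_rmod_def)
  interpret F: z2_rmod A "corner (G M)"
    using fg_rmod_corner[OF fg_rmod_G[OF M]] by (simp add: fg_rmod_def)
  show "fg_rmod A (corner (G M))" by (intro fg_rmod_corner fg_rmod_G M)
  have \<epsilon>: "\<epsilon> M (j (x, \<zero>\<^bsub>M\<^esub>)) = x" if "x \<in> carrier M" for x
    using that corner_G[OF M] by (auto simp: \<epsilon>_def)
  show "\<epsilon> M \<in> graded_hom A (corner (G M)) M"
  proof (rule graded_homI)
    show "\<epsilon> M \<in> extensional (carrier (corner (G M)))" by (simp add: \<epsilon>_def)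
    fix q assume "q \<in> carrier (corner (G M))"
    then obtain x where x: "x \<in> carrier M" "q = j (x, \<zero>\<^bsub>M\<^esub>)" unfolding corner_G[OF M] by blast
    show "\<epsilon> M q \<in> carrier M" using x by (simp add: \<epsilon>)
    show "\<epsilon> M (a \<odot>\<^bsub>corner (G M)\<^esub> q) = a \<odot>\<^bsub>M\<^esub> \<epsilon> M q" if "a \<in> carrier A" for a
      using x that by (simp add: corner_simps G_act_\<psi>[OF M] \<epsilon> M.act_closed)
    fix q' assume "q' \<in> carrier (corner (G M))"
    then obtain x' where x': "x' \<in> carrier M" "q' = j (x', \<zero>\<^bsub>M\<^esub>)" unfolding corner_G[OF M] by blast
    show "\<epsilon> M (q \<oplus>\<^bsub>corner (G M)\<^esub> q') = \<epsilon> M q \<oplus>\<^bsub>M\<^esub> \<epsilon> M q'"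
      using x x' by (simp add: corner_simps G_add[OF M] \<epsilon>)
  next
    fix q g assume q: "q \<in> homog (corner (G M)) g"
    from F.homog_closed[OF this] obtain x where x: "x \<in> carrier M" "q = j (x, \<zero>\<^bsub>M\<^esub>)"
      unfolding corner_G[OF M] by blast
    then show "\<epsilon> M q \<in> homog M g" using q by (simp add: corner_simps \<epsilon>)
  qed
  show "inj_on (\<epsilon> M) (carrier (corner (G M)))"
    by (rule inj_onI) (auto simp: corner_G[OF M] \<epsilon>)
  show "\<epsilon> M ` carrier (corner (G M)) = carrier M"
  proof
    show "\<epsilon> M ` carrier (corner (G M)) \<subseteq> carrier M" by (auto simp: corner_G[OF M] \<epsilon>)
    show "carrier M \<subseteq> \<epsilon> M ` carrier (corner (G M))"
    proof
      fix x assume "x \<in> carrier M"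
      then show "x \<in> \<epsilon> M ` carrier (corner (G M))"
        by (intro image_eqI[of _ _ "j (x, \<zero>\<^bsub>M\<^esub>)"]) (auto simp: \<epsilon> corner_G[OF M])
    qed
  qed
qed (rule M)

lemma natural_iso_\<eta>: "natural_iso CD.C CD.C (\<lambda>X. X) (\<lambda>X Y f. f)
    (\<lambda>X. G (corner X)) (\<lambda>X Y f. Gm (corner X) (corner Y) (Fm X Y f)) \<eta>"
  unfolding natural_iso_def
proof (intro conjI ballI)
  fix X assume "X \<in> Ob CD.C"
  then show "is_iso CD.C X (G (corner X)) (\<eta> X)" by (simp add: is_iso_\<eta>)
next
  fix X Y f assume o: "X \<in> Ob CD.C" "Y \<in> Ob CD.C" "f \<in> Hom CD.C X Y"
  note a = o[unfolded gr_cat_simps]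
  interpret f: z2_hom D X Y f using a by (intro z2_homI)
  note cl = e_act_closed[OF f.X.z2_rmod_axioms] u_act_closed[OF f.X.z2_rmod_axioms]
  show "Cmp CD.C X Y (G (corner Y)) (\<eta> Y) f =
      Cmp CD.C X (G (corner X)) (G (corner Y)) (Gm (corner X) (corner Y) (Fm X Y f)) (\<eta> X)"
    unfolding gr_cat_simps compose_def
    by (rule restrict_ext) (simp add: \<eta>_def Gm_def Fm_def cl f.hom_act \<psi>_closed f.hom_closed)
qed

lemma natural_iso_\<epsilon>: "natural_iso CA.C CA.C (\<lambda>X. corner (G X)) (\<lambda>X Y f. Fm (G X) (G Y) (Gm X Y f))
    (\<lambda>X. X) (\<lambda>X Y f. f) \<epsilon>"
  unfolding natural_iso_def
proof (intro conjI ballI)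
  fix X assume "X \<in> Ob CA.C"
  then show "is_iso CA.C (corner (G X)) X (\<epsilon> X)" by (simp add: is_iso_\<epsilon>)
next
  fix X Y f assume o: "X \<in> Ob CA.C" "Y \<in> Ob CA.C" "f \<in> Hom CA.C X Y"
  note a = o[unfolded gr_cat_simps]
  interpret f: z2_hom A X Y f using a by (intro z2_homI)
  show "Cmp CA.C (corner (G X)) (corner (G Y)) Y (\<epsilon> Y) (Fm (G X) (G Y) (Gm X Y f)) =
      Cmp CA.C (corner (G X)) X Y f (\<epsilon> X)"
    unfolding gr_cat_simps compose_def
  proof (rule restrict_ext)
    fix q assume q: "q \<in> carrier (corner (G X))"
    then obtain x where x: "x \<in> carrier X" "q = j (x, \<zero>\<^bsub>X\<^esub>)" unfolding corner_G[OF a(1)] by blast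
    have "j (f x, \<zero>\<^bsub>Y\<^esub>) \<in> carrier (corner (G Y))"
      unfolding corner_G[OF a(2)] using f.hom_closed[OF x(1)] by blast
    then show "\<epsilon> Y (Fm (G X) (G Y) (Gm X Y f) q) = f (\<epsilon> X q)"
      using x q by (simp add: \<epsilon>_def Fm_def Gm_def f.hom_zero)
  qed
qed

theorem abelian_equivalent_gr_cat: "abelian_equivalent CD.C CA.C"
  unfolding abelian_equivalent_def
  using CD.abelian_category_gr_cat CA.abelian_category_gr_cat additive_functor_F additive_functor_G
    natural_iso_\<eta> natural_iso_\<epsilon> by blast

end

section \<open>Finite dimensional algebras are noetherian\<close>

text \<open>A module record has only the action of the ring, so complex scalars have to act through
  their images under \<open>\<kappa>\<close>.\<close>

definition linear_subset :: "(complex \<Rightarrow> 'a) \<Rightarrow> ('g, 'a, 'm) graded \<Rightarrow> 'm set \<Rightarrow> bool" where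
  "linear_subset \<kappa> M W \<longleftrightarrow> W \<subseteq> carrier M \<and> \<zero>\<^bsub>M\<^esub> \<in> W \<and> (\<forall>x\<in>W. \<forall>y\<in>W. x \<oplus>\<^bsub>M\<^esub> y \<in> W) \<and>
    (\<forall>c. \<forall>x\<in>W. \<kappa> c \<odot>\<^bsub>M\<^esub> x \<in> W)"

fun list_span :: "(complex \<Rightarrow> 'a) \<Rightarrow> ('g, 'a, 'm) graded \<Rightarrow> 'm list \<Rightarrow> 'm set" where
  "list_span \<kappa> M [] = {\<zero>\<^bsub>M\<^esub>}"
| "list_span \<kappa> M (x # xs) = {\<kappa> c \<odot>\<^bsub>M\<^esub> x \<oplus>\<^bsub>M\<^esub> y | c y. y \<in> list_span \<kappa> M xs}"

locale scalars = A: ring A for A :: "(bit, complex, 'a) graded" +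
  fixes \<kappa> :: "complex \<Rightarrow> 'a"
  assumes \<kappa>_closed: "\<kappa> c \<in> carrier A" and \<kappa>_add: "\<kappa> (c + d) = \<kappa> c \<oplus>\<^bsub>A\<^esub> \<kappa> d"
    and \<kappa>_mult: "\<kappa> (c * d) = \<kappa> c \<otimes>\<^bsub>A\<^esub> \<kappa> d" and \<kappa>_one: "\<kappa> 1 = \<one>\<^bsub>A\<^esub>"
begin

lemma \<kappa>_zero: "\<kappa> 0 = \<zero>\<^bsub>A\<^esub>"
  using \<kappa>_add[of 0 0] \<kappa>_closed[of 0] by (metis A.add.l_cancel_one' add_0)

context
  fixes M :: "(bit, 'a, 'm) graded"
  assumes M: "z2_rmod A M"
begin

interpretation M: z2_rmod A M by (rule M)

lemma linear_subset_diff: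
  assumes "linear_subset \<kappa> M W" "x \<in> W" "y \<in> W"
  shows "x \<ominus>\<^bsub>M\<^esub> y \<in> W"
proof -
  have c: "y \<in> carrier M" using assms by (auto simp: linear_subset_def)
  have "\<kappa> 1 \<oplus>\<^bsub>A\<^esub> \<kappa> (- 1) = \<zero>\<^bsub>A\<^esub>"
    using \<kappa>_add[of 1 "- 1"] \<kappa>_zero by simp
  then have "\<kappa> (- 1) = \<ominus>\<^bsub>A\<^esub> \<one>\<^bsub>A\<^esub>"
    using \<kappa>_closed[of "- 1"] by (metis A.minus_equality A.add.m_comm A.one_closed \<kappa>_one)
  then have "\<kappa> (- 1) \<odot>\<^bsub>M\<^esub> y = \<ominus>\<^bsub>M\<^esub> y"
    using c by (simp add: M.act_minus_left M.act_one)
  moreover have "\<kappa> (- 1) \<odot>\<^bsub>M\<^esub> y \<in> W" using assms by (simp add: linear_subset_def)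
  ultimately show ?thesis using assms by (simp add: linear_subset_def a_minus_def)
qed

lemma linear_subset_list_span:
  assumes "set xs \<subseteq> carrier M"
  shows "linear_subset \<kappa> M (list_span \<kappa> M xs)" "set xs \<subseteq> list_span \<kappa> M xs"
proof -
  have "linear_subset \<kappa> M (list_span \<kappa> M xs) \<and> set xs \<subseteq> list_span \<kappa> M xs"
    using assms
  proof (induction xs)
    case Nil
    then show ?case by (simp add: linear_subset_def M.act_zero_right \<kappa>_closed)
  next
    case (Cons x xs)
    then have x: "x \<in> carrier M" and IH: "list_span \<kappa> M xs \<subseteq> carrier M" "\<zero>\<^bsub>M\<^esub> \<in> list_span \<kappa> M xs"
      "\<And>y z. \<lbrakk>y \<in> list_span \<kappa> M xs; z \<in> list_span \<kappa> M xs\<rbrakk> \<Longrightarrow> y \<oplus>\<^bsub>M\<^esub> z \<in> list_span \<kappa> M xs"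
      "\<And>c y. y \<in> list_span \<kappa> M xs \<Longrightarrow> \<kappa> c \<odot>\<^bsub>M\<^esub> y \<in> list_span \<kappa> M xs" "set xs \<subseteq> list_span \<kappa> M xs"
      by (simp_all add: linear_subset_def)
    have mem: "\<kappa> c \<odot>\<^bsub>M\<^esub> x \<oplus>\<^bsub>M\<^esub> y \<in> list_span \<kappa> M (x # xs)" if "y \<in> list_span \<kappa> M xs" for c y
      using that by auto
    have c: "\<kappa> c \<odot>\<^bsub>M\<^esub> x \<in> carrier M" for c using x by (simp add: M.act_closed \<kappa>_closed)
    have zero: "\<kappa> 0 \<odot>\<^bsub>M\<^esub> x \<oplus>\<^bsub>M\<^esub> y = y" if "y \<in> carrier M" for y
      using x that by (simp add: \<kappa>_zero M.act_zero_left)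
    have "linear_subset \<kappa> M (list_span \<kappa> M (x # xs))"
      unfolding linear_subset_def
    proof (intro conjI ballI allI)
      show "list_span \<kappa> M (x # xs) \<subseteq> carrier M" using c IH(1) by auto
      show "\<zero>\<^bsub>M\<^esub> \<in> list_span \<kappa> M (x # xs)" using mem[OF IH(2), of 0] zero by simp
    next
      fix p q assume "p \<in> list_span \<kappa> M (x # xs)" "q \<in> list_span \<kappa> M (x # xs)"
      then obtain a y b z where pq: "p = \<kappa> a \<odot>\<^bsub>M\<^esub> x \<oplus>\<^bsub>M\<^esub> y" "q = \<kappa> b \<odot>\<^bsub>M\<^esub> x \<oplus>\<^bsub>M\<^esub> z"
        "y \<in> list_span \<kappa> M xs" "z \<in> list_span \<kappa> M xs" by auto
      then have "p \<oplus>\<^bsub>M\<^esub> q = \<kappa> (a + b) \<odot>\<^bsub>M\<^esub> x \<oplus>\<^bsub>M\<^esub> (y \<oplus>\<^bsub>M\<^esub> z)"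
        using x c subsetD[OF IH(1)] by (simp add: \<kappa>_add \<kappa>_closed M.act_add_left M.M.a_ac)
      then show "p \<oplus>\<^bsub>M\<^esub> q \<in> list_span \<kappa> M (x # xs)" using mem pq IH(3) by simp
    next
      fix b p assume "p \<in> list_span \<kappa> M (x # xs)"
      then obtain a y where p: "p = \<kappa> a \<odot>\<^bsub>M\<^esub> x \<oplus>\<^bsub>M\<^esub> y" "y \<in> list_span \<kappa> M xs" by auto
      then have "\<kappa> b \<odot>\<^bsub>M\<^esub> p = \<kappa> (a * b) \<odot>\<^bsub>M\<^esub> x \<oplus>\<^bsub>M\<^esub> \<kappa> b \<odot>\<^bsub>M\<^esub> y"
        using x c subsetD[OF IH(1)] by (simp add: \<kappa>_mult \<kappa>_closed M.act_add_right M.act_mult)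
      then show "\<kappa> b \<odot>\<^bsub>M\<^esub> p \<in> list_span \<kappa> M (x # xs)" using mem p IH(4) by simp
    qed
    moreover have "x \<in> list_span \<kappa> M (x # xs)"
      using mem[OF IH(2), of 1] x by (simp add: \<kappa>_one M.act_one)
    moreover have "y \<in> list_span \<kappa> M (x # xs)" if "y \<in> list_span \<kappa> M xs" for y
      using mem[OF that, of 0] zero[of y] subsetD[OF IH(1) that] by simp
    ultimately show ?case using IH(5) by auto
  qed
  then show "linear_subset \<kappa> M (list_span \<kappa> M xs)" "set xs \<subseteq> list_span \<kappa> M xs" by auto
qed

lemma list_span_subset:
  assumes "linear_subset \<kappa> M W" "set xs \<subseteq> W"
  shows "list_span \<kappa> M xs \<subseteq> W"
  using assms(2)
proof (induction xs)
  case Nil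
  then show ?case using assms(1) by (simp add: linear_subset_def)
next
  case (Cons x xs)
  have "\<kappa> c \<odot>\<^bsub>M\<^esub> x \<oplus>\<^bsub>M\<^esub> y \<in> W" if "y \<in> W" for c y
    using assms(1) Cons.prems that by (simp add: linear_subset_def)
  then show ?case using Cons by auto
qed

text \<open>Steinitz: a subspace of the span of \<open>x # xs\<close> is spanned by its intersection with the span of
  \<open>xs\<close> and at most one more vector.\<close>

lemma linear_subset_finite_span:
  assumes "set xs \<subseteq> carrier M" "linear_subset \<kappa> M W" "W \<subseteq> list_span \<kappa> M xs"
  shows "\<exists>ys. set ys \<subseteq> W \<and> W \<subseteq> list_span \<kappa> M ys"
  using assms
proof (induction xs arbitrary: W)
  case Nil
  then show ?case by (intro exI[of _ "[]"]) simp
next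
  case (Cons x xs)
  let ?U = "list_span \<kappa> M xs"
  have x: "x \<in> carrier M" and U: "linear_subset \<kappa> M ?U"
    using Cons.prems linear_subset_list_span[of xs] by auto
  have W: "linear_subset \<kappa> M W" by fact
  have WU: "linear_subset \<kappa> M (W \<inter> ?U)"
    using U W by (auto simp: linear_subset_def)
  then obtain ys where ys: "set ys \<subseteq> W \<inter> ?U" "W \<inter> ?U \<subseteq> list_span \<kappa> M ys"
    using Cons.IH[of "W \<inter> ?U"] Cons.prems by auto
  have Uc: "?U \<subseteq> carrier M" and Wc: "W \<subseteq> carrier M" using U W by (simp_all add: linear_subset_def)
  show ?case
  proof (cases "W \<subseteq> ?U")
    case True
    then show ?thesis using ys by (intro exI[of _ ys]) auto
  next
    case False
    then obtain w where w: "w \<in> W" "w \<notin> ?U" by auto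
    then obtain c y where cy: "w = \<kappa> c \<odot>\<^bsub>M\<^esub> x \<oplus>\<^bsub>M\<^esub> y" "y \<in> ?U" using Cons.prems(3) by auto
    have yc: "y \<in> carrier M" and wc: "w \<in> carrier M" using cy Uc w Wc by auto
    have c: "c \<noteq> 0"
    proof
      assume "c = 0"
      then have "w = y" using cy(1) x yc by (simp add: \<kappa>_zero M.act_zero_left)
      then show False using w cy(2) by simp
    qed
    have "p \<in> list_span \<kappa> M (w # ys)" if p: "p \<in> W" for p
    proof -
      obtain b z where bz: "p = \<kappa> b \<odot>\<^bsub>M\<^esub> x \<oplus>\<^bsub>M\<^esub> z" "z \<in> ?U" using Cons.prems(3) p by auto
      have zc: "z \<in> carrier M" and pc: "p \<in> carrier M" using bz Uc p Wc by auto
      \<comment> \<open>The multiple of w with the same coefficient at x as p; subtracting it brings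
        p into the span of the remaining vectors.\<close>
      define t where "t = \<kappa> (b / c) \<odot>\<^bsub>M\<^esub> w"
      have ty: "\<kappa> (b / c) \<odot>\<^bsub>M\<^esub> y \<in> ?U" using U cy(2) by (simp add: linear_subset_def)
      have tyc: "\<kappa> (b / c) \<odot>\<^bsub>M\<^esub> y \<in> carrier M" using ty Uc by auto
      have bx: "\<kappa> b \<odot>\<^bsub>M\<^esub> x \<in> carrier M" using x by (simp add: M.act_closed \<kappa>_closed)
      have tW: "t \<in> W" using W w by (simp add: linear_subset_def t_def)
      have tc: "t \<in> carrier M" using tW Wc by auto
      have "\<kappa> b = \<kappa> c \<otimes>\<^bsub>A\<^esub> \<kappa> (b / c)" using c by (simp add: \<kappa>_mult[symmetric])
      then have "t = \<kappa> b \<odot>\<^bsub>M\<^esub> x \<oplus>\<^bsub>M\<^esub> \<kappa> (b / c) \<odot>\<^bsub>M\<^esub> y"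
        unfolding t_def cy(1) using x yc by (simp add: M.act_add_right M.act_mult M.act_closed \<kappa>_closed)
      then have "p \<ominus>\<^bsub>M\<^esub> t = (\<kappa> b \<odot>\<^bsub>M\<^esub> x \<ominus>\<^bsub>M\<^esub> \<kappa> b \<odot>\<^bsub>M\<^esub> x) \<oplus>\<^bsub>M\<^esub> (z \<ominus>\<^bsub>M\<^esub> \<kappa> (b / c) \<odot>\<^bsub>M\<^esub> y)"
        using bz(1) M.diff_diff_sum[OF bx zc bx tyc] by simp
      also have "\<dots> = z \<ominus>\<^bsub>M\<^esub> \<kappa> (b / c) \<odot>\<^bsub>M\<^esub> y"
        using M.diff_eq_zero[OF bx bx] zc tyc by simp
      finally have "p \<ominus>\<^bsub>M\<^esub> t \<in> W \<inter> ?U"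
        using linear_subset_diff[OF W p tW] linear_subset_diff[OF U bz(2) ty] by simp
      then have "t \<oplus>\<^bsub>M\<^esub> (p \<ominus>\<^bsub>M\<^esub> t) \<in> list_span \<kappa> M (w # ys)"
        using ys(2) unfolding t_def by auto
      moreover have "t \<oplus>\<^bsub>M\<^esub> (p \<ominus>\<^bsub>M\<^esub> t) = p"
        using tc pc by (simp add: a_minus_def M.M.a_lcomm M.M.r_neg)
      ultimately show ?thesis by simp
    qed
    then show ?thesis using w ys by (intro exI[of _ "w # ys"]) auto
  qed
qed

end

text \<open>A finitely generated module is spanned over the complex numbers by the finitely many
  products of generators with elements of B, so each submodule is spanned by finitely many vectors,
  which generate it a fortiori. The assumption \<open>span\<close> says that B spans A, in terms of
  subspaces; this form is easily pulled back to tensors.\<close>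

lemma submodules_fg_finite_dimensional:
  assumes B: "finite B" "B \<subseteq> carrier A"
    and span: "\<And>W. \<lbrakk>W \<subseteq> carrier A; \<zero>\<^bsub>A\<^esub> \<in> W; \<And>a b. \<lbrakk>a \<in> W; b \<in> W\<rbrakk> \<Longrightarrow> a \<oplus>\<^bsub>A\<^esub> b \<in> W;
      \<And>a c. a \<in> W \<Longrightarrow> a \<otimes>\<^bsub>A\<^esub> \<kappa> c \<in> W; B \<subseteq> W\<rbrakk> \<Longrightarrow> carrier A \<subseteq> W"
  shows "submodules_fg A TYPE('u)"
  unfolding submodules_fg_def
proof (intro allI impI)
  fix M :: "(bit, 'a, 'u) graded" and L
  assume fg: "fg_rmod A M" and L: "submod A M L"
  then have M: "z2_rmod A M" by (simp add: fg_rmod_def)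
  interpret M: z2_rmod A M by (rule M)
  obtain S where S: "finite S" "generates A M S (carrier M)"
    using fg M.finitely_generated_iff by (auto simp: fg_rmod_def)
  have Sc: "S \<subseteq> carrier M" using S(2) by (simp add: generates_def)
  obtain xs where xs: "set xs = (\<lambda>(b, s). b \<odot>\<^bsub>M\<^esub> s) ` (B \<times> S)"
    using finite_list[of "(\<lambda>(b, s). b \<odot>\<^bsub>M\<^esub> s) ` (B \<times> S)"] B S by auto
  have xs_c: "set xs \<subseteq> carrier M"
    unfolding xs using B(2) Sc by (auto intro!: M.act_closed)
  let ?K = "list_span \<kappa> M xs"
  have K: "?K \<subseteq> carrier M" "\<zero>\<^bsub>M\<^esub> \<in> ?K" "\<And>x y. \<lbrakk>x \<in> ?K; y \<in> ?K\<rbrakk> \<Longrightarrow> x \<oplus>\<^bsub>M\<^esub> y \<in> ?K"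
    "\<And>c x. x \<in> ?K \<Longrightarrow> \<kappa> c \<odot>\<^bsub>M\<^esub> x \<in> ?K" "set xs \<subseteq> ?K"
    using linear_subset_list_span[OF M xs_c] by (simp_all add: linear_subset_def)
  have SK: "a \<odot>\<^bsub>M\<^esub> s \<in> ?K" if s: "s \<in> S" and a: "a \<in> carrier A" for s a
  proof -
    have sc: "s \<in> carrier M" using s Sc by auto
    have "carrier A \<subseteq> {a \<in> carrier A. a \<odot>\<^bsub>M\<^esub> s \<in> ?K}"
    proof (rule span)
      show "B \<subseteq> {a \<in> carrier A. a \<odot>\<^bsub>M\<^esub> s \<in> ?K}"
      proof
        fix b assume b: "b \<in> B"
        then have "b \<odot>\<^bsub>M\<^esub> s \<in> set xs" unfolding xs using s by auto
        then show "b \<in> {a \<in> carrier A. a \<odot>\<^bsub>M\<^esub> s \<in> ?K}" using K(5) B(2) b by auto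
      qed
    qed (use sc in \<open>simp_all add: M.act_zero_left M.act_add_left M.act_mult K \<kappa>_closed\<close>)
    then show ?thesis using a by auto
  qed
  \<comment> \<open>The span K is not known to be a submodule, whereas the elements whose products
    with all of A lie in K do form one.\<close>
  have "submod A M {m \<in> carrier M. \<forall>a\<in>carrier A. a \<odot>\<^bsub>M\<^esub> m \<in> ?K}"
    unfolding submod_def
  proof (intro conjI ballI)
    fix b m assume b: "b \<in> carrier A" and "m \<in> {m \<in> carrier M. \<forall>a\<in>carrier A. a \<odot>\<^bsub>M\<^esub> m \<in> ?K}"
    then have m: "m \<in> carrier M" "\<And>a. a \<in> carrier A \<Longrightarrow> a \<odot>\<^bsub>M\<^esub> m \<in> ?K" by auto
    have "a \<odot>\<^bsub>M\<^esub> (b \<odot>\<^bsub>M\<^esub> m) \<in> ?K" if "a \<in> carrier A" for a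
      using m(2)[of "b \<otimes>\<^bsub>A\<^esub> a"] b that m(1) by (simp add: M.act_mult)
    then show "b \<odot>\<^bsub>M\<^esub> m \<in> {m \<in> carrier M. \<forall>a\<in>carrier A. a \<odot>\<^bsub>M\<^esub> m \<in> ?K}"
      using b m(1) by (simp add: M.act_closed)
  qed (auto simp: M.act_zero_right M.act_add_right K)
  moreover have "S \<subseteq> {m \<in> carrier M. \<forall>a\<in>carrier A. a \<odot>\<^bsub>M\<^esub> m \<in> ?K}" using SK Sc by auto
  ultimately have *: "carrier M \<subseteq> {m \<in> carrier M. \<forall>a\<in>carrier A. a \<odot>\<^bsub>M\<^esub> m \<in> ?K}"
    using S(2) by (simp add: generates_def)
  have MK: "carrier M \<subseteq> ?K"
  proof
    fix m assume m: "m \<in> carrier M"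
    then have "\<one>\<^bsub>A\<^esub> \<odot>\<^bsub>M\<^esub> m \<in> ?K" using subsetD[OF * m] by simp
    then show "m \<in> ?K" using m by (simp add: M.act_one)
  qed
  have lin: "linear_subset \<kappa> M N" if "submod A M N" for N
    using that by (simp add: submod_def linear_subset_def \<kappa>_closed)
  have "L \<subseteq> ?K" using L MK unfolding submod_def by blast
  then obtain ys where ys: "set ys \<subseteq> L" "L \<subseteq> list_span \<kappa> M ys"
    using linear_subset_finite_span[OF M xs_c lin[OF L]] by blast
  have "generates A M (set ys) L"
    unfolding generates_def
  proof (intro conjI allI impI ys(1))
    fix N assume "submod A M N" "set ys \<subseteq> N"
    then show "L \<subseteq> N" using list_span_subset[OF M lin] ys(2) by blast
  qed
  then show "\<exists>S. finite S \<and> generates A M S L" by blast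
qed

end

section \<open>Clifford deformations are finite dimensional\<close>

lemma scal_diff: "scal c (p - q) = scal c p - scal c q"
  using scal_add_right[of c "p - q" q] by simp

lemma scal_minus: "scal (- c) p = - scal c p" "scal c (- p) = - scal c p"
  by (rule poly_mapping_eqI; simp)+

lemma lin_diff: "lin g (p - q) = lin g p - lin g q"
  using lin_add[of g "p - q" q] by simp

lemma lin_sum: "lin g (sum f S) = (\<Sum>s\<in>S. lin g (f s))"
  by (induction S rule: infinite_finite_induct) (simp_all add: lin_add)

text \<open>The projection to a tensor power. The index is an integer so that removing a word from a
  product may produce a negative index, where the projection is zero.\<close>

definition length_part :: "int \<Rightarrow> 'x tensors \<Rightarrow> 'x tensors" where
  "length_part n = lin (\<lambda>w. if int (length (letters w)) = n then Poly_Mapping.single w 1 else 0)"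

lemma length_part_add: "length_part n (p + q) = length_part n p + length_part n q"
  and length_part_diff: "length_part n (p - q) = length_part n p - length_part n q"
  and length_part_0 [simp]: "length_part n 0 = 0"
  and length_part_sum: "length_part n (sum f S) = (\<Sum>s\<in>S. length_part n (f s))"
  and length_part_scal: "length_part n (scal c p) = scal c (length_part n p)"
  and length_part_single: "length_part n (Poly_Mapping.single w c) =
    (if int (length (letters w)) = n then Poly_Mapping.single w c else 0)"
  by (simp_all add: length_part_def lin_add lin_diff lin_sum lin_scal scal_single)

lemma length_part_single_mult: "length_part n (Poly_Mapping.single w c * p) =
    Poly_Mapping.single w c * length_part (n - int (length (letters w))) p"
  by (induction p rule: tensor_induct_UNIV)
    (auto simp: length_part_add distrib_left mult_single length_part_single)

lemma length_part_mult_single: "length_part n (p * Poly_Mapping.single w c) =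
    length_part (n - int (length (letters w))) p * Poly_Mapping.single w c"
  by (induction p rule: tensor_induct_UNIV)
    (auto simp: length_part_add distrib_right mult_single length_part_single)

lemma length_part_hom_tens: "p \<in> hom_tens X m \<Longrightarrow> length_part n p = (if n = m then p else 0)"
  unfolding hom_tens_def mem_Collect_eq
  by (induction rule: tensor_induct) (auto simp: length_part_single length_part_add)

definition short_tens :: "'x set \<Rightarrow> int \<Rightarrow> 'x tensors set" where
  "short_tens X n = {p. Poly_Mapping.keys p \<subseteq> {w. set (letters w) \<subseteq> X \<and> int (length (letters w)) < n}}"

lemma short_tens_0 [simp]: "0 \<in> short_tens X n"
  by (simp add: short_tens_def)

lemma short_tens_single:
  "set (letters w) \<subseteq> X \<Longrightarrow> int (length (letters w)) < n \<Longrightarrow> Poly_Mapping.single w c \<in> short_tens X n"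
  by (auto simp: short_tens_def)

lemma short_tens_add: "p \<in> short_tens X n \<Longrightarrow> q \<in> short_tens X n \<Longrightarrow> p + q \<in> short_tens X n"
  using keys_add[of p q] by (force simp: short_tens_def)

lemma short_tens_mult_single:
  assumes "set (letters w) \<subseteq> X" "p \<in> short_tens X (n - int (length (letters w)))"
  shows "Poly_Mapping.single w c * p \<in> short_tens X n" "p * Poly_Mapping.single w c \<in> short_tens X n"
  using assms keys_mult[of "Poly_Mapping.single w c" p] keys_mult[of p "Poly_Mapping.single w c"]
  by (fastforce simp: short_tens_def split: if_splits)+

lemma length_part_short: "p \<in> short_tens X n \<Longrightarrow> n \<le> m \<Longrightarrow> length_part m p = 0"
  unfolding short_tens_def mem_Collect_eq
  by (induction rule: tensor_induct) (auto simp: length_part_single length_part_add)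

lemma (in tensor_ideal) Q_finsum:
  assumes "finite S" "\<And>s. s \<in> S \<Longrightarrow> p s \<in> tens X"
  shows "(\<Oplus>\<^bsub>Q\<^esub>s\<in>S. cl (p s)) = cl (\<Sum>s\<in>S. p s) \<and> (\<Sum>s\<in>S. p s) \<in> tens X"
proof -
  interpret Q: ring Q by (rule Q_ring)
  show ?thesis
    using assms
  proof (induction S)
    case empty
    then show ?case by (simp add: Q_zero)
  next
    case (insert s S)
    have c: "cl (p t) \<in> carrier Q" if "t \<in> insert s S" for t
      using insert.prems[OF that] by (auto simp: Q_carrier)
    then have "(\<Oplus>\<^bsub>Q\<^esub>t\<in>insert s S. cl (p t)) = cl (p s) \<oplus>\<^bsub>Q\<^esub> (\<Oplus>\<^bsub>Q\<^esub>t\<in>S. cl (p t))"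
      using insert.hyps by (intro Q.finsum_insert) auto
    then show ?case using insert by (simp add: Q_add)
  qed
qed

text \<open>The elements \<open>p\<close> with this property form an ideal that contains \<open>R\<close>.\<close>

lemma length_part_reducible:
  fixes X :: "'x set"
  defines "T \<equiv> tensor_algebra X :: (int, complex, 'x tensors) graded"
  assumes R: "R \<subseteq> tensor_power X 2"
    and I: "ideal I (tensor_algebra X :: (bit, complex, 'x tensors) graded)"
    and RI: "\<And>r. r \<in> R \<Longrightarrow> r - scal (\<theta> r) 1 \<in> I"
    and p: "p \<in> Idl\<^bsub>T\<^esub> R"
  shows "\<exists>q\<in>short_tens X n. length_part n p - q \<in> I"
proof -
  interpret I: tensor_ideal X I "tensor_algebra X :: (bit, complex, 'x tensors) graded"
    "\<lambda>p. I +>\<^bsub>(tensor_algebra X :: (bit, complex, 'x tensors) graded)\<^esub> p"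
    "quotient_algebra (tensor_algebra X :: (bit, complex, 'x tensors) graded) I"
    by (rule tensor_ideal.intro) (rule I)
  note Ic = I.I_closed[unfolded I.T_carrier]
  \<comment> \<open>All n are treated at once, because multiplication by a word of length k reduces
    the condition at n to the condition at n - k.\<close>
  define Z where "Z = {p \<in> tens X. \<forall>n. \<exists>q\<in>short_tens X n. length_part n p - q \<in> I}"
  have ZI: "p \<in> Z" if "p \<in> tens X" "\<And>n. \<exists>q\<in>short_tens X n. length_part n p - q \<in> I" for p
    using that by (simp add: Z_def)
  have Z: "p \<in> tens X" "\<exists>q\<in>short_tens X n. length_part n p - q \<in> I" if "p \<in> Z" for p n
    using that by (simp_all add: Z_def)
  have Z0: "0 \<in> Z" by (rule ZI) (auto intro!: bexI[of _ 0] simp: Ic)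
  have Zadd: "p + q \<in> Z" if pq: "p \<in> Z" "q \<in> Z" for p q
  proof (rule ZI)
    show "p + q \<in> tens X" using Z(1)[OF pq(1)] Z(1)[OF pq(2)] by simp
    fix n
    obtain p' where p': "p' \<in> short_tens X n" "length_part n p - p' \<in> I" using Z(2)[OF pq(1)] by blast
    obtain q' where q': "q' \<in> short_tens X n" "length_part n q - q' \<in> I" using Z(2)[OF pq(2)] by blast
    have "length_part n (p + q) - (p' + q') = (length_part n p - p') + (length_part n q - q')"
      by (simp add: length_part_add)
    also have "\<dots> \<in> I" using Ic(2)[OF p'(2) q'(2)] .
    finally show "\<exists>q'\<in>short_tens X n. length_part n (p + q) - q' \<in> I"
      using short_tens_add[OF p'(1) q'(1)] by blast
  qed
  have Zsingle: "Poly_Mapping.single w c * p \<in> Z \<and> p * Poly_Mapping.single w c \<in> Z"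
    if p: "p \<in> Z" and w: "set (letters w) \<subseteq> X" for p w c
  proof -
    have "\<exists>q\<in>short_tens X n. length_part n (Poly_Mapping.single w c * p) - q \<in> I" for n
    proof -
      obtain q where q: "q \<in> short_tens X (n - int (length (letters w)))"
        "length_part (n - int (length (letters w))) p - q \<in> I" using Z(2)[OF p] by blast
      have "Poly_Mapping.single w c * (length_part (n - int (length (letters w))) p - q) \<in> I"
        by (rule Ic(3)[OF q(2)]) (use w in simp)
      then show ?thesis
        using short_tens_mult_single(1)[OF w q(1)]
        by (intro bexI[of _ "Poly_Mapping.single w c * q"]) (simp_all add: length_part_single_mult right_diff_distrib)
    qed
    moreover have "\<exists>q\<in>short_tens X n. length_part n (p * Poly_Mapping.single w c) - q \<in> I" for n
    proof -
      obtain q where q: "q \<in> short_tens X (n - int (length (letters w)))"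
        "length_part (n - int (length (letters w))) p - q \<in> I" using Z(2)[OF p] by blast
      have "(length_part (n - int (length (letters w))) p - q) * Poly_Mapping.single w c \<in> I"
        by (rule Ic(4)[OF q(2)]) (use w in simp)
      then show ?thesis
        using short_tens_mult_single(2)[OF w q(1)]
        by (intro bexI[of _ "q * Poly_Mapping.single w c"]) (simp_all add: length_part_mult_single left_diff_distrib)
    qed
    ultimately show ?thesis using Z(1)[OF p] w by (auto intro!: ZI)
  qed
  have Zmult: "a * p \<in> Z \<and> p * a \<in> Z" if p: "p \<in> Z" and a: "a \<in> tens X" for p a
    using a unfolding tensor_carrier[of a]
  proof (induction rule: tensor_induct)
    case (add a b)
    then show ?case by (simp add: distrib_left distrib_right Zadd)
  qed (use Z0 Zsingle[OF p] in auto)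
  have "ideal Z T"
    by (rule ideal_tensorI[OF T_def[THEN meta_eq_to_obj_eq]])
      (use Z(1) Z0 Zadd Zmult in \<open>auto simp: T_def\<close>)
  moreover have "R \<subseteq> Z"
  proof
    fix r assume r: "r \<in> R"
    then have h: "r \<in> hom_tens X 2" using R by (auto simp: tensor_power_hom_tens)
    show "r \<in> Z"
    proof (rule ZI)
      show "r \<in> tens X" by (rule hom_tens_tens[OF h])
      fix n
      \<comment> \<open>Modulo I the relation r, of length 2, equals the constant \<theta>(r), of
        length 0; in all other lengths r has no part.\<close>
      have "scal (\<theta> r) 1 \<in> short_tens X 2"
        unfolding single_one[symmetric] scal_single by (rule short_tens_single) auto
      then show "\<exists>q\<in>short_tens X n. length_part n r - q \<in> I"
        unfolding length_part_hom_tens[OF h] using RI[OF r] Ic(1)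
        by (intro bexI[of _ "if n = 2 then scal (\<theta> r) 1 else 0"]) auto
    qed
  qed
  moreover have "R \<subseteq> tens X"
    using R hom_tens_tens unfolding tensor_power_hom_tens by blast
  ultimately have "Idl\<^bsub>T\<^esub> R \<subseteq> Z"
    using Idl_tensor(3)[OF T_def[THEN meta_eq_to_obj_eq]] by blast
  then show ?thesis using p Z(2) by blast
qed

lemma clifford_relations_tens:
  assumes "quadratic_data X R"
  shows "(\<lambda>r. r - scal (\<theta> r) 1) ` R \<subseteq> tens X"
  using assms hom_tens_tens by (auto simp: quadratic_data_def tensor_power_hom_tens intro!: tensor_diff)

text \<open>The conclusion says that P spans T(V) modulo I. A spanning set of E is represented by
  tensors of length below N; a longer word differs from a combination of these by an element of (R),
  and the part of that element in the length of the word is the word itself. By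
  \<open>length_part_reducible\<close> the word is congruent modulo I to shorter tensors, and
  induction on the length applies.\<close>

lemma tens_finite_span:
  fixes X :: "'x set"
  assumes qd: "quadratic_data X R" and fd: "finite_dimensional (quadratic_algebra X R)"
    and I: "ideal I (tensor_algebra X :: (bit, complex, 'x tensors) graded)"
    and RI: "\<And>r. r \<in> R \<Longrightarrow> r - scal (\<theta> r) 1 \<in> I"
  obtains P where "finite P" "P \<subseteq> tens X"
    "\<And>V. \<lbrakk>0 \<in> V; \<And>p q. \<lbrakk>p \<in> V; q \<in> V\<rbrakk> \<Longrightarrow> p + q \<in> V; \<And>c p. p \<in> V \<Longrightarrow> scal c p \<in> V; I \<subseteq> V; P \<subseteq> V\<rbrakk>
      \<Longrightarrow> tens X \<subseteq> V"
proof -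
  define T where "T = (tensor_algebra X :: (int, complex, 'x tensors) graded)"
  define I0 where "I0 = Idl\<^bsub>T\<^esub> R"
  define cl where "cl = (\<lambda>p. I0 +>\<^bsub>T\<^esub> p)"
  define E where "E = quadratic_algebra X R"
  have fin: "finite X" and R: "R \<subseteq> tensor_power X 2"
    using qd by (auto simp: quadratic_data_def)
  have R_sub: "R \<subseteq> tens X" using R hom_tens_tens unfolding tensor_power_hom_tens by blast
  note I0 = Idl_tensor(1)[OF T_def R_sub, folded I0_def]
  interpret E: tensor_ideal X I0 T cl E
    by (rule tensor_ideal.intro)
      (use I0 in \<open>simp_all add: T_def cl_def E_def quadratic_algebra_def I0_def Let_def\<close>)
  obtain S where "finite S \<and> S \<subseteq> carrier E \<and> (\<forall>x\<in>carrier E. \<exists>c. x = (\<Oplus>\<^bsub>E\<^esub>s\<in>S. c s \<odot>\<^bsub>E\<^esub> s))"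
    using fd unfolding finite_dimensional_def E_def[symmetric] by (rule exE)
  then have S: "finite S" "S \<subseteq> carrier E"
    and span: "\<And>x. x \<in> carrier E \<Longrightarrow> \<exists>c. x = (\<Oplus>\<^bsub>E\<^esub>s\<in>S. c s \<odot>\<^bsub>E\<^esub> s)"
    by simp_all
  have "\<forall>s\<in>S. \<exists>p. p \<in> tens X \<and> cl p = s"
    using S(2) by (auto simp: E.Q_carrier)
  then obtain p where p: "\<And>s. s \<in> S \<Longrightarrow> p s \<in> tens X" "\<And>s. s \<in> S \<Longrightarrow> cl (p s) = s"
    by metis
  \<comment> \<open>A strict bound for the lengths of all words in the representatives; inserting 0
    keeps \<open>Max\<close> meaningful when there are none.\<close>
  define N where "N = Suc (Max (insert 0 (\<Union>s\<in>S. (\<lambda>w. length (letters w)) ` Poly_Mapping.keys (p s))))"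
  have N: "p s \<in> short_tens X (int N)" if s: "s \<in> S" for s
  proof -
    have "length (letters w) < N" if "w \<in> Poly_Mapping.keys (p s)" for w
      unfolding N_def less_Suc_eq_le by (rule Max_ge) (use S(1) s that in auto)
    then show ?thesis using p(1)[OF s] by (auto simp: short_tens_def tens_def)
  qed
  define P where "P = (\<lambda>w. Poly_Mapping.single (Word w) (1 :: complex)) ` {w. set w \<subseteq> X \<and> length w \<le> N}"
  show thesis
  proof (rule that)
    show "finite P" unfolding P_def by (intro finite_imageI finite_lists_length_le fin)
    show "P \<subseteq> tens X" by (auto simp: P_def)
    fix V assume V: "0 \<in> V" "\<And>p q. \<lbrakk>p \<in> V; q \<in> V\<rbrakk> \<Longrightarrow> p + q \<in> V" "\<And>c p. p \<in> V \<Longrightarrow> scal c p \<in> V"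
      "I \<subseteq> V" "P \<subseteq> V"
    have word: "set w \<subseteq> X \<Longrightarrow> Poly_Mapping.single (Word w) 1 \<in> V" for w
    proof (induction "length w" arbitrary: w rule: less_induct)
      case less
      show ?case
      proof (cases "length w \<le> N")
        case True
        then have "Poly_Mapping.single (Word w) 1 \<in> P" using less.prems by (auto simp: P_def)
        then show ?thesis using V(5) by auto
      next
        case False
        define m where "m = (Poly_Mapping.single (Word w) 1 :: 'x tensors)"
        have m: "m \<in> tens X" using less.prems by (simp add: m_def)
        obtain c where c: "cl m = (\<Oplus>\<^bsub>E\<^esub>s\<in>S. c s \<odot>\<^bsub>E\<^esub> s)"
          using span[of "cl m"] m by (auto simp: E.Q_carrier)
        define q where "q = (\<Sum>s\<in>S. scal (c s) (p s))"
        interpret EQ: ring E by (rule E.Q_ring)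
        have "(\<Oplus>\<^bsub>E\<^esub>s\<in>S. c s \<odot>\<^bsub>E\<^esub> s) = (\<Oplus>\<^bsub>E\<^esub>s\<in>S. cl (scal (c s) (p s)))"
        proof (rule EQ.finsum_cong')
          show "c s \<odot>\<^bsub>E\<^esub> s = cl (scal (c s) (p s))" if "s \<in> S" for s
            using E.Q_smult[of "p s" "c s"] p[OF that] by simp
        qed (use p in \<open>auto simp: E.Q_carrier\<close>)
        also have "\<dots> = cl q"
          using E.Q_finsum[OF S(1), of "\<lambda>s. scal (c s) (p s)"] p(1) by (simp add: q_def)
        finally have "cl m = cl q" using c by simp
        moreover have q: "q \<in> tens X"
          using E.Q_finsum[OF S(1), of "\<lambda>s. scal (c s) (p s)"] p(1) by (simp add: q_def)
        ultimately have "m - q \<in> I0" using m E.cl_eq[of m q] by simp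
        then obtain r where r: "r \<in> short_tens X (int (length w))" "length_part (int (length w)) (m - q) - r \<in> I"
          using length_part_reducible[OF R I RI] unfolding I0_def T_def by blast
        \<comment> \<open>All words of q are shorter than N, hence shorter than w.\<close>
        have "length_part (int (length w)) q = 0"
          unfolding q_def length_part_sum
          using N False by (intro sum.neutral ballI) (simp add: length_part_scal length_part_short[of _ X "int N"])
        then have "length_part (int (length w)) (m - q) = m"
          by (simp add: length_part_diff m_def length_part_single)
        then have "m - r \<in> V" using r(2) V(4) by auto
        moreover have "r \<in> V"
          using r(1) unfolding short_tens_def mem_Collect_eq
        proof (induction rule: tensor_induct)
          case (single w' d)
          then have "Poly_Mapping.single w' 1 \<in> V"
            using less.hyps[of "letters w'"] by simp
          then show ?case using V(3)[of _ d] by (fastforce simp: scal_single)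
        qed (use V in auto)
        ultimately have "(m - r) + r \<in> V" by (rule V(2))
        then show ?thesis by (simp add: m_def)
      qed
    qed
    show "tens X \<subseteq> V"
    proof
      fix t assume "t \<in> tens X"
      then show "t \<in> V"
        unfolding tensor_carrier
      proof (induction rule: tensor_induct)
        case (single w c)
        then show ?case using V(3)[OF word[of "letters w"], of c] by (simp add: scal_single)
      qed (use V in auto)
    qed
  qed
qed

section \<open>Homogeneous elements of the tensor algebra\<close>

lemma homog_tensor_subset: "homog (tensor_algebra X) g \<subseteq> tens X"
  by (auto simp: tensor_algebra_def tens_def)

lemma homog_tensor_0: "0 \<in> homog (tensor_algebra X) g"
  by (simp add: tensor_algebra_def)

lemma homog_tensor_single: "set (letters w) \<subseteq> X \<Longrightarrow> of_nat (length (letters w)) = g \<Longrightarrow>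
    Poly_Mapping.single w c \<in> homog (tensor_algebra X) g"
  by (simp add: tensor_algebra_def)

lemma homog_tensor_1: "1 \<in> homog (tensor_algebra X) 0"
  unfolding single_one[symmetric] by (rule homog_tensor_single) simp_all

lemma homog_tensor_add: "p \<in> homog (tensor_algebra X) g \<Longrightarrow> q \<in> homog (tensor_algebra X) g \<Longrightarrow>
    p + q \<in> homog (tensor_algebra X) g"
  using keys_add[of p q] by (force simp: tensor_algebra_def)

lemma homog_tensor_scal: "p \<in> homog (tensor_algebra X) g \<Longrightarrow> scal c p \<in> homog (tensor_algebra X) g"
  using keys_scal[of c p] by (force simp: tensor_algebra_def)

lemma homog_tensor_mult: "p \<in> homog (tensor_algebra X) g \<Longrightarrow> q \<in> homog (tensor_algebra X) h \<Longrightarrow>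
    p * q \<in> homog (tensor_algebra X) (g + h)"
  using keys_mult[of p q] by (force simp: tensor_algebra_def)

lemma clifford_deformation_tensor_ideal:
  fixes X :: "'x set" and R \<theta>
  defines "T \<equiv> tensor_algebra X :: (bit, complex, 'x tensors) graded"
  defines "I \<equiv> Idl\<^bsub>T\<^esub> ((\<lambda>r. r - scal (\<theta> r) 1) ` R)"
  assumes "quadratic_data X R"
  shows "clifford_deformation X R \<theta> = quotient_algebra T I" "ideal I T"
    and "r \<in> R \<Longrightarrow> r - scal (\<theta> r) 1 \<in> I"
    and "ideal K T \<Longrightarrow> (\<And>r. r \<in> R \<Longrightarrow> r - scal (\<theta> r) 1 \<in> K) \<Longrightarrow> I \<subseteq> K"
proof -
  note * = Idl_tensor[OF T_def[THEN meta_eq_to_obj_eq] clifford_relations_tens[OF assms(3), of \<theta>], folded I_def]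
  show "clifford_deformation X R \<theta> = quotient_algebra T I"
    by (simp add: clifford_deformation_def T_def I_def Let_def)
  show "ideal I T" by (rule *(1))
  show "r \<in> R \<Longrightarrow> r - scal (\<theta> r) 1 \<in> I" using *(2) by blast
  show "ideal K T \<Longrightarrow> (\<And>r. r \<in> R \<Longrightarrow> r - scal (\<theta> r) 1 \<in> K) \<Longrightarrow> I \<subseteq> K" using *(3) by blast
qed

lemma submodules_fg_clifford_deformation:
  fixes X :: "'x set"
  assumes qd: "quadratic_data X R" and fd: "finite_dimensional (quadratic_algebra X R)"
  shows "submodules_fg (clifford_deformation X R \<theta>) TYPE('u)"
proof -
  define T where "T = (tensor_algebra X :: (bit, complex, 'x tensors) graded)"
  define I where "I = Idl\<^bsub>T\<^esub> ((\<lambda>r. r - scal (\<theta> r) 1) ` R)"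
  define cl where "cl = (\<lambda>p. I +>\<^bsub>T\<^esub> p)"
  define B where "B = clifford_deformation X R \<theta>"
  note cd = clifford_deformation_tensor_ideal[where \<theta> = \<theta>, OF qd, folded T_def, folded I_def]
  interpret B: tensor_ideal X I T cl B
    by (rule tensor_ideal.intro) (use cd in \<open>simp_all add: T_def cl_def B_def\<close>)
  have c: "cl p \<in> carrier B" if "p \<in> tens X" for p using that by (auto simp: B.Q_carrier)
  have k: "scal d 1 \<in> tens X" for d by simp
  \<comment> \<open>The scalars are the classes of the constant tensors.\<close>
  interpret scalars B "\<lambda>d. cl (scal d 1)"
    by (intro scalars.intro scalars_axioms.intro B.Q_ring)
      (simp_all add: c B.Q_add B.Q_mult B.Q_one scal_add_left scal_mult_left)
  obtain P where P: "finite P" "P \<subseteq> tens X"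
    and span: "\<And>V. \<lbrakk>0 \<in> V; \<And>p q. \<lbrakk>p \<in> V; q \<in> V\<rbrakk> \<Longrightarrow> p + q \<in> V; \<And>c p. p \<in> V \<Longrightarrow> scal c p \<in> V; I \<subseteq> V; P \<subseteq> V\<rbrakk>
      \<Longrightarrow> tens X \<subseteq> V"
    by (rule tens_finite_span[OF qd fd cd(2)[unfolded T_def] cd(3)]) blast+
  have "submodules_fg B TYPE('u)"
  proof (rule submodules_fg_finite_dimensional)
    show "finite (cl ` P)" "cl ` P \<subseteq> carrier B" using P c by auto
    fix W assume W: "W \<subseteq> carrier B" "\<zero>\<^bsub>B\<^esub> \<in> W" "\<And>a b. \<lbrakk>a \<in> W; b \<in> W\<rbrakk> \<Longrightarrow> a \<oplus>\<^bsub>B\<^esub> b \<in> W"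
      "\<And>a d. a \<in> W \<Longrightarrow> a \<otimes>\<^bsub>B\<^esub> cl (scal d 1) \<in> W" "cl ` P \<subseteq> W"
    have "tens X \<subseteq> {p \<in> tens X. cl p \<in> W}"
    proof (rule span)
      show "0 \<in> {p \<in> tens X. cl p \<in> W}" using W(2) by (simp add: B.Q_zero)
      show "p + q \<in> {p \<in> tens X. cl p \<in> W}"
        if "p \<in> {p \<in> tens X. cl p \<in> W}" "q \<in> {p \<in> tens X. cl p \<in> W}" for p q
        using that W(3)[of "cl p" "cl q"] by (simp add: B.Q_add)
      show "scal d p \<in> {p \<in> tens X. cl p \<in> W}" if "p \<in> {p \<in> tens X. cl p \<in> W}" for d p
        using that W(4)[of "cl p" d] by (simp add: B.Q_mult scal_mult_right)
      show "I \<subseteq> {p \<in> tens X. cl p \<in> W}"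
      proof
        fix p assume p: "p \<in> I"
        then have "p \<in> tens X" using B.I_closed(5) by simp
        moreover from this have "cl p = \<zero>\<^bsub>B\<^esub>"
          using p unfolding B.Q_zero by (subst B.cl_eq) simp_all
        ultimately show "p \<in> {p \<in> tens X. cl p \<in> W}" using W(2) by simp
      qed
      show "P \<subseteq> {p \<in> tens X. cl p \<in> W}" using P(2) W(5) by auto
    qed
    then show "carrier B \<subseteq> W" by (auto simp: B.Q_carrier)
  qed
  then show ?thesis by (simp add: B_def)
qed

section \<open>The double extension as a matrix algebra\<close>

text \<open>With \<open>y = Some None\<close> and \<open>z = None\<close> the two adjoined generators, \<open>y\<close>, \<open>z\<close> and \<open>x \<in> V\<close> act
  by the matrices with rows \<open>(0, 1), (1, 0)\<close>, resp. \<open>(0, \<i>), (-\<i>, 0)\<close>, resp. \<open>(x, 0), (0, -x)\<close>.\<close>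

fun word_entry :: "bit \<Rightarrow> bit \<Rightarrow> 'x option option list \<Rightarrow> 'x tensors" where
  "word_entry r c [] = (if r = c then 1 else 0)"
| "word_entry r c (Some (Some x) # w) = (if r = 0 then gen x * word_entry r c w else - (gen x * word_entry r c w))"
| "word_entry r c (Some None # w) = word_entry (r + 1) c w"
| "word_entry r c (None # w) = scal (if r = 0 then \<i> else - \<i>) (word_entry (r + 1) c w)"

definition entry :: "bit \<Rightarrow> bit \<Rightarrow> 'x option option tensors \<Rightarrow> 'x tensors" where
  "entry r c = lin (\<lambda>w. word_entry r c (letters w))"

abbreviation y_el :: "'x option option tensors" where "y_el \<equiv> gen (Some None)"
abbreviation z_el :: "'x option option tensors" where "z_el \<equiv> gen None"
abbreviation emb2 :: "'x tensors \<Rightarrow> 'x option option tensors" where "emb2 p \<equiv> emb (emb p)"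

lemma entry_add: "entry r c (p + q) = entry r c p + entry r c q"
  and entry_diff: "entry r c (p - q) = entry r c p - entry r c q"
  and entry_scal: "entry r c (scal d p) = scal d (entry r c p)"
  and entry_0 [simp]: "entry r c 0 = 0"
  and entry_single: "entry r c (Poly_Mapping.single w d) = scal d (word_entry r c (letters w))"
  by (simp_all add: entry_def lin_add lin_diff lin_scal)

lemma entry_1: "entry r c 1 = (if r = c then 1 else 0)"
  unfolding single_one[symmetric] entry_single by simp

text \<open>Reading a word from the left, each letter multiplies by a coefficient and selects the
  row in which the rest is read. Cutting the word is thus the multiplication of matrices, with a sum
  over the row reached at the cut.\<close>

lemma word_entry_append: "word_entry r c (u @ v) =
    word_entry r 0 u * word_entry 0 c v + word_entry r 1 u * word_entry 1 c v"
proof (induction u arbitrary: r)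
  case Nil
  then show ?case by (cases r rule: bit_cases) simp_all
next
  case (Cons a u)
  show ?case
  proof (cases a)
    case None
    then show ?thesis by (simp add: Cons scal_add_right scal_mult_left)
  next
    case (Some b)
    then show ?thesis by (cases b) (simp_all add: Cons algebra_simps)
  qed
qed

lemma entry_mult: "entry r c (p * q) = entry r 0 p * entry 0 c q + entry r 1 p * entry 1 c q"
proof (induction p rule: tensor_induct_UNIV)
  case (single w d)
  show ?case
  proof (induction q rule: tensor_induct_UNIV)
    case (single v d')
    then show ?case
      by (simp add: mult_single entry_single word_entry_append scal_mult_left scal_mult_right
          scal_add_right mult.commute)
  qed (simp_all add: entry_add algebra_simps)
qed (simp_all add: entry_add algebra_simps)

lemma entry_y: "entry r c y_el = (if r = c then 0 else 1)"
  and entry_z: "entry r c z_el = (if r = c then 0 else if r = 0 then scal \<i> 1 else scal (- \<i>) 1)"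
  and entry_x: "entry r c (gen (Some (Some x))) = (if r = c then if r = 0 then gen x else - gen x else 0)"
  by (cases r rule: bit_cases; cases c rule: bit_cases; simp add: gen_def entry_single)+

text \<open>In row 1 every letter of V contributes a sign, so a word of length k is multiplied by
  (-1)^k, which is the twist.\<close>

lemma entry_emb2: "entry r c (emb2 p) = (if r = c then if r = 0 then p else sgn_twist p else 0)"
proof (induction p rule: tensor_induct_UNIV)
  case (single w d)
  have "word_entry r c (map Some (map Some xs)) =
      (if r = c then Poly_Mapping.single (Word xs) (if r = 0 then 1 else (- 1) ^ length xs) else 0)" for xs :: "'x list"
    by (induction xs) (auto simp: gen_single zero_word_def[symmetric] single_uminus)
  from this[of "letters w"] show ?case
    by (auto simp: emb_single entry_single word.map_sel scal_single sgn_twist_single)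
qed (auto simp: emb_add entry_add sgn_twist_add)

text \<open>An adjoined letter changes both the length and the row by one, which cancels in the
  degree; a letter of V keeps the row and contributes a factor of degree 1.\<close>

lemma word_entry_homog:
  assumes "set xs \<subseteq> ext_basis (ext_basis X)"
  shows "word_entry r c xs \<in> homog (tensor_algebra X) (of_nat (length xs) + r + c :: bit)"
  using assms
proof (induction xs arbitrary: r)
  case Nil
  then show ?case by (simp add: homog_tensor_1 homog_tensor_0)
next
  case (Cons a xs)
  then have IH: "word_entry r c xs \<in> homog (tensor_algebra X) (of_nat (length xs) + r + c)" for r
    by simp
  show ?case
  proof (cases "a = None \<or> a = Some None")
    case True
    then show ?thesis
      using IH[of "r + 1"] by (auto simp: ac_simps intro!: homog_tensor_scal)
  next
    case False
    then obtain x where x: "a = Some (Some x)" "x \<in> X"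
      using Cons.prems by (cases a) (auto simp: ext_basis_def)
    have "gen x \<in> homog (tensor_algebra X) (1 :: bit)"
      unfolding gen_def using x by (intro homog_tensor_single) simp_all
    from homog_tensor_mult[OF this IH[of r]]
    have *: "gen x * word_entry r c xs \<in> homog (tensor_algebra X) (of_nat (length (a # xs)) + r + c)"
      by (simp add: ac_simps)
    have eq: "word_entry r c (a # xs) = scal (if r = 0 then 1 else - 1) (gen x * word_entry r c xs)"
      by (simp add: x scal_minus_one)
    show ?thesis
      unfolding eq by (rule homog_tensor_scal[OF *])
  qed
qed

lemma entry_homog:
  assumes "p \<in> homog (tensor_algebra (ext_basis (ext_basis X))) (g :: bit)"
  shows "entry r c p \<in> homog (tensor_algebra X) (g + r + c)"
proof -
  have "Poly_Mapping.keys p \<subseteq> {w. set (letters w) \<subseteq> ext_basis (ext_basis X) \<and> of_nat (length (letters w)) = g}"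
    using assms by (auto simp: tensor_algebra_def)
  then show ?thesis
  proof (induction rule: tensor_induct)
    case (single w d)
    then show ?case
      using word_entry_homog[of "letters w" X r c] by (auto simp: entry_single intro: homog_tensor_scal)
  qed (auto simp: homog_tensor_0 entry_add intro: homog_tensor_add)
qed

lemma entry_tens:
  assumes "p \<in> tens (ext_basis (ext_basis X))"
  shows "entry r c p \<in> tens X"
  using assms unfolding tensor_carrier[of p]
proof (induction rule: tensor_induct)
  case (single w d)
  then show ?case
    using subsetD[OF homog_tensor_subset word_entry_homog[of "letters w" X r c]]
    by (auto simp: entry_single)
qed (auto simp: entry_add)

lemma emb_homog: "p \<in> homog (tensor_algebra X) g \<Longrightarrow> emb p \<in> homog (tensor_algebra (ext_basis X)) g"
proof -
  assume "p \<in> homog (tensor_algebra X) g"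
  then have "Poly_Mapping.keys p \<subseteq> {w. set (letters w) \<subseteq> X \<and> of_nat (length (letters w)) = g}"
    by (auto simp: tensor_algebra_def)
  then show ?thesis
    by (induction rule: tensor_induct)
      (auto simp: homog_tensor_0 emb_add emb_single word.map_sel ext_basis_def image_iff subset_iff
        intro!: homog_tensor_add homog_tensor_single)
qed

definition idem :: "'x option option tensors" where
  "idem = scal (1 / 2) (1 + scal \<i> (y_el * z_el))"

text \<open>The tensors whose matrices are the units at (r, 0), respectively at (0, c) for
  \<open>row_unit\<close>: multiplication by y exchanges the positions 0 and 1.\<close>

definition col_unit :: "bit \<Rightarrow> 'x option option tensors" where
  "col_unit r = (if r = 0 then idem else y_el * idem)"

definition row_unit :: "bit \<Rightarrow> 'x option option tensors" where
  "row_unit c = (if c = 0 then idem else idem * y_el)"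

text \<open>The matrix of \<open>emb2 p\<close> is diagonal with p at (0, 0) and its twist at (1,
  1). Routing p through position (0, 0) before moving it to (r, c) avoids every sign.\<close>

definition matrix_unit :: "bit \<Rightarrow> bit \<Rightarrow> 'x tensors \<Rightarrow> 'x option option tensors" where
  "matrix_unit r c p = col_unit r * emb2 p * row_unit c"

lemma emb_uminus: "emb (- p) = - emb p"
  using emb_diff[of 0 p] by simp

lemma scal_double: "scal c (p + p) = scal (c + c) p"
  by (simp only: scal_add_left scal_add_right)

lemma scal_half_add: "scal (1 / 2) (p + p) = p"
  by (simp add: scal_double)

lemma entry_idem: "entry r c idem = (if r = 0 \<and> c = 0 then 1 else 0)"
  by (cases r rule: bit_cases; cases c rule: bit_cases)
    (simp_all add: idem_def entry_scal entry_add entry_1 entry_mult entry_y entry_z scal_minus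
      scal_half_add[of 1, unfolded one_add_one])

text \<open>This holds exactly in T(V), before any relation is imposed: \<open>idem\<close> and y
  already have constant matrices there.\<close>

lemma entry_matrix_unit: "entry s t (matrix_unit r c p) = (if s = r \<and> t = c then p else 0)"
  by (cases r rule: bit_cases; cases c rule: bit_cases; cases s rule: bit_cases; cases t rule: bit_cases)
    (simp_all add: matrix_unit_def col_unit_def row_unit_def entry_mult entry_idem entry_y entry_emb2)

lemma matrix_unit_diff: "matrix_unit r c (p - q) = matrix_unit r c p - matrix_unit r c q"
  by (simp add: matrix_unit_def emb_diff algebra_simps)

section \<open>The ideals of relations\<close>

locale double_extension =
  fixes X :: "'x set" and R :: "'x tensors set" and \<theta> :: "'x tensors \<Rightarrow> complex"
  assumes qd: "quadratic_data X R" and \<theta>_zero: "\<theta> 0 = 0"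
begin

abbreviation "X2 \<equiv> ext_basis (ext_basis X)"
abbreviation "R2 \<equiv> ext_rel (ext_basis X) (ext_rel X R)"
abbreviation "\<theta>2 \<equiv> ext_map (ext_basis X) (ext_rel X R) (ext_map X R \<theta>)"

definition T :: "(bit, complex, 'x tensors) graded" where "T = tensor_algebra X"
definition T2 :: "(bit, complex, 'x option option tensors) graded" where "T2 = tensor_algebra X2"
definition I where "I = Idl\<^bsub>T\<^esub> ((\<lambda>r. r - scal (\<theta> r) 1) ` R)"
definition J where "J = Idl\<^bsub>T2\<^esub> ((\<lambda>r. r - scal (\<theta>2 r) 1) ` R2)"
definition cl where "cl = (\<lambda>p. I +>\<^bsub>T\<^esub> p)"
definition cl2 where "cl2 = (\<lambda>p. J +>\<^bsub>T2\<^esub> p)"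
definition B where "B = clifford_deformation X R \<theta>"
definition B2 where "B2 = clifford_deformation X2 R2 \<theta>2"

lemma qd2: "quadratic_data X2 R2"
  by (intro ext_rel_quadratic_data qd)

lemmas B_ideal = clifford_deformation_tensor_ideal[where \<theta> = \<theta>, OF qd, folded T_def, folded I_def]
lemmas B2_ideal = clifford_deformation_tensor_ideal[where \<theta> = \<theta>2, OF qd2, folded T2_def, folded J_def]

sublocale B: tensor_ideal X I T cl B
  by (rule tensor_ideal.intro) (use B_ideal in \<open>simp_all add: T_def cl_def B_def\<close>)

sublocale B2: tensor_ideal X2 J T2 cl2 B2
  by (rule tensor_ideal.intro) (use B2_ideal in \<open>simp_all add: T2_def cl2_def B2_def\<close>)

lemmas Ic = B.I_closed[unfolded B.T_carrier]
lemmas Jc = B2.I_closed[unfolded B2.T_carrier]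

text \<open>All relations of the double extension in one family with five parameters. The lemmas
  below specialise it by setting all but one of them to zero: c gives the square of y, c' that of z,
  v and v' give the anticommutators, and r the relations of B.\<close>

lemma J_relation:
  assumes "r \<in> R" "v \<in> tensor_power X 1" "v' \<in> tensor_power (ext_basis X) 1"
  shows "ext_elem (ext_elem r v c) v' c' - scal (\<theta> r + c + c') 1 \<in> J"
proof -
  have "v \<in> hom_tens X 1" "v' \<in> hom_tens (ext_basis X) 1"
    using assms by (simp_all add: tensor_power_hom_tens)
  then have "ext_elem r v c \<in> ext_rel X R" "ext_elem (ext_elem r v c) v' c' \<in> R2"
    using assms(1) by (simp_all add: ext_relI)
  then show ?thesis
    using B2_ideal(3)[of "ext_elem (ext_elem r v c) v' c'"] assms by (simp add: ext_map_ext_elem)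
qed

lemma R2_cases:
  assumes "s \<in> R2"
  obtains r v c v' c' where "r \<in> R" "v \<in> tensor_power X 1" "v' \<in> tensor_power (ext_basis X) 1"
    "s = ext_elem (ext_elem r v c) v' c'" "\<theta>2 s = \<theta> r + c + c'"
proof -
  obtain r' v' c' where 1: "s = ext_elem r' v' c'" "r' \<in> ext_rel X R" "v' \<in> tensor_power (ext_basis X) 1"
    using assms unfolding ext_rel_def[of "ext_basis X"] by blast
  obtain r v c where 2: "r' = ext_elem r v c" "r \<in> R" "v \<in> tensor_power X 1"
    using 1(2) unfolding ext_rel_def by blast
  have "\<theta>2 s = \<theta> r + c + c'" using 1 2 by (simp add: ext_map_ext_elem)
  then show thesis using that 1 2 by blast
qed

lemma zero_R: "0 \<in> R" and zero_tp: "0 \<in> tensor_power Z n"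
  using qd by (simp_all add: quadratic_data_def tensor_power_def)

lemma J_yy: "y_el * y_el - 1 \<in> J"
  using J_relation[OF zero_R zero_tp zero_tp, of 1 0] by (simp add: ext_elem_def emb_mult \<theta>_zero)

lemma J_zz: "z_el * z_el - 1 \<in> J"
  using J_relation[OF zero_R zero_tp zero_tp, of 0 1] by (simp add: ext_elem_def \<theta>_zero)

lemma J_yz: "y_el * z_el + z_el * y_el \<in> J"
proof -
  have "y_gen \<in> tensor_power (ext_basis X) 1"
    by (auto simp: tensor_power_hom_tens ext_basis_def intro!: hom_tens_gen)
  from J_relation[OF zero_R zero_tp this, of 0 0] show ?thesis by (simp add: ext_elem_def \<theta>_zero)
qed

lemma J_xy:
  assumes "x \<in> X" shows "gen (Some (Some x)) * y_el + y_el * gen (Some (Some x)) \<in> J"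
proof -
  have "gen x \<in> tensor_power X 1"
    using assms by (auto simp: tensor_power_hom_tens intro!: hom_tens_gen)
  from J_relation[OF zero_R this zero_tp, of 0 0] show ?thesis
    by (simp add: ext_elem_def \<theta>_zero emb_mult emb_add)
qed

lemma J_xz:
  assumes "x \<in> X" shows "gen (Some (Some x)) * z_el + z_el * gen (Some (Some x)) \<in> J"
proof -
  have "gen (Some x) \<in> tensor_power (ext_basis X) 1"
    using assms by (auto simp: tensor_power_hom_tens ext_basis_def intro!: hom_tens_gen)
  from J_relation[OF zero_R zero_tp this, of 0 0] show ?thesis by (simp add: ext_elem_def \<theta>_zero)
qed

lemma emb2_J:
  assumes "p \<in> I" shows "emb2 p \<in> J"
proof -
  have "ideal {p \<in> tens X. emb2 p \<in> J} T"
    by (rule ideal_tensorI[OF T_def]) (auto simp: T_def emb_add emb_mult emb_tens Jc)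
  moreover have "r - scal (\<theta> r) 1 \<in> {p \<in> tens X. emb2 p \<in> J}" if r: "r \<in> R" for r
  proof -
    have "emb2 r - scal (\<theta> r) 1 \<in> J"
      using J_relation[OF r zero_tp zero_tp, of 0 0] by (simp add: ext_elem_def)
    moreover have "r - scal (\<theta> r) 1 \<in> tens X"
      using clifford_relations_tens[OF qd, of \<theta>] r by blast
    ultimately show ?thesis by (simp add: emb_diff emb_scal)
  qed
  ultimately have "I \<subseteq> {p \<in> tens X. emb2 p \<in> J}" by (rule B_ideal(4))
  then show ?thesis using assms by blast
qed

text \<open>The matrices satisfy the relations of the double extension over B. A relation of the
  family in \<open>J_relation\<close> goes to the scalar matrix r - \<theta>(r): the anticommutators
  with y and z vanish, and c, c' cancel because y and z square to the identity matrix.\<close>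

lemma entry_J:
  assumes "p \<in> J" shows "entry r c p \<in> I"
proof -
  have id: "ideal {p \<in> tens X2. \<forall>r c. entry r c p \<in> I} T2"
    by (rule ideal_tensorI[OF T2_def]) (auto simp: T2_def entry_add entry_mult entry_tens Ic)
  have "s - scal (\<theta>2 s) 1 \<in> {p \<in> tens X2. \<forall>r c. entry r c p \<in> I}" if s: "s \<in> R2" for s
  proof -
    obtain r v c v' c' where m: "r \<in> R" "v \<in> tensor_power X 1" "v' \<in> tensor_power (ext_basis X) 1"
      and s: "s = ext_elem (ext_elem r v c) v' c'" and \<theta>s: "\<theta>2 s = \<theta> r + c + c'"
      by (rule R2_cases[OF s])
    \<comment> \<open>An element of length 2 is unchanged by the twist, so the matrix of r is
      scalar; the sign for v, of length 1, makes its matrix anticommute with that of y.\<close>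
    have sr: "sgn_twist r = r"
      using m(1) qd sgn_twist_hom_tens[of r X 2] by (auto simp: quadratic_data_def tensor_power_hom_tens)
    have sv: "sgn_twist v = - v"
      using m(2) sgn_twist_hom_tens[of v X 1] by (auto simp: tensor_power_hom_tens)
    \<comment> \<open>Here v' may involve y as well as V, so it is expanded into letters, each of
      which anticommutes with z.\<close>
    have "Poly_Mapping.keys v' \<subseteq> {w. set (letters w) \<subseteq> ext_basis X \<and> length (letters w) = 1}"
      using m(3) by (auto simp: tensor_power_def)
    then have v': "entry i k (emb v' * z_el + z_el * emb v') = 0" for i k
    proof (induction rule: tensor_induct)
      case (single w d)
      then obtain l where w: "w = Word [l]"
        by (cases w) (auto simp: length_Suc_conv)
      have "emb (Poly_Mapping.single w d) = scal d (gen (Some l))"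
        by (simp add: w emb_single gen_def scal_single)
      then show ?case
        by (cases l; cases i rule: bit_cases; cases k rule: bit_cases)
          (simp_all add: entry_add entry_mult entry_scal entry_z entry_y entry_x scal_minus
            scal_mult_left scal_mult_right)
    next
      case (add p q)
      have "emb (p + q) * z_el + z_el * emb (p + q) =
          (emb p * z_el + z_el * emb p) + (emb q * z_el + z_el * emb q)"
        by (simp add: emb_add algebra_simps)
      then show ?case
        using entry_add[of i k "emb p * z_el + z_el * emb p" "emb q * z_el + z_el * emb q"] add by simp
    qed simp
    have "entry i k (s - scal (\<theta>2 s) 1) = (if i = k then r - scal (\<theta> r) 1 else 0)" for i k
      using v'[of i k] unfolding \<theta>s unfolding s ext_elem_def[of "ext_elem r v c"] entry_add entry_diff
      by (cases i rule: bit_cases; cases k rule: bit_cases)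
        (simp_all add: ext_elem_def emb_add emb_mult emb_scal entry_add entry_mult entry_scal
          entry_emb2 entry_y entry_z entry_1 sr sv scal_add_left scal_minus
          scal_mult_left scal_mult_right)
    moreover have "s - scal (\<theta>2 s) 1 \<in> tens X2"
      using clifford_relations_tens[OF qd2, of \<theta>2] that by blast
    ultimately show ?thesis using B_ideal(3)[OF m(1)] Ic(1) by simp
  qed
  from B2_ideal(4)[OF id this] show ?thesis using assms by blast
qed

section \<open>The idempotent modulo the relations\<close>

lemma y_tens: "y_el \<in> tens X2" and z_tens: "z_el \<in> tens X2"
  and x_tens: "x \<in> X \<Longrightarrow> gen (Some (Some x)) \<in> tens X2"
  by (auto simp: ext_basis_def intro!: tensor_gen)

lemma idem_tens: "idem \<in> tens X2"
  unfolding idem_def by (intro tensor_scal tensor_add tensor_1 tensor_mult y_tens z_tens)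

lemma col_unit_tens: "col_unit r \<in> tens X2" and row_unit_tens: "row_unit c \<in> tens X2"
  unfolding col_unit_def row_unit_def by (auto intro: idem_tens y_tens)

lemma J_diff: "p \<in> J \<Longrightarrow> q \<in> J \<Longrightarrow> p - q \<in> J"
  using Jc(2)[of p "- q"] B2.I_uminus[of q] by simp

lemmas J_add = Jc(2) and J_left = Jc(3) and J_right = Jc(4) and J_scal = B2.I_scal

text \<open>The letter x passes y and z with one sign each, so it commutes with yz.\<close>

lemma x_idem:
  assumes "x \<in> X" shows "gen (Some (Some x)) * idem - idem * gen (Some (Some x)) \<in> J"
proof -
  let ?x = "gen (Some (Some x))"
  have "?x * idem - idem * ?x = scal (\<i> / 2) ((?x * y_el + y_el * ?x) * z_el - y_el * (?x * z_el + z_el * ?x))"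
    by (simp add: idem_def scal_mult_left scal_mult_right scal_add_right scal_diff algebra_simps)
  also have "\<dots> \<in> J"
    by (intro J_scal J_diff J_left[OF J_xz] J_right[OF J_xy] y_tens z_tens assms)
  finally show ?thesis .
qed

text \<open>On the column of \<open>idem\<close> the letter z acts as -\<i> y, because z(\<i>yz) =
  -\<i> y z^2 and (\<i>y)(\<i>yz) = - y^2 z. This eliminates z and explains the entry -\<i> of its
  matrix.\<close>

lemma z_idem: "z_el * idem + scal \<i> (y_el * idem) \<in> J"
proof -
  have "z_el * idem + scal \<i> (y_el * idem) = scal (1 / 2) (scal \<i> ((y_el * z_el + z_el * y_el) * z_el
      - y_el * (z_el * z_el - 1)) - (y_el * y_el - 1) * z_el)"
    by (simp add: idem_def scal_mult_left scal_mult_right scal_add_right scal_diff scal_minus algebra_simps)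
  also have "\<dots> \<in> J"
    by (intro J_scal J_diff J_left[OF J_zz] J_right[OF J_yz] J_right[OF J_yy] y_tens z_tens)
  finally show ?thesis .
qed

text \<open>Writing w for \<i>yz, the relations give w^2 = 1, and then (1 + w)^2 = 2(1 + w).\<close>

lemma idem_idem: "idem * idem - idem \<in> J"
proof -
  define w :: "'x option option tensors" where "w = scal \<i> (y_el * z_el)"
  have e: "idem = scal (1 / 2) (1 + w)" by (simp add: idem_def w_def)
  have "w * w - 1 = (y_el * y_el - 1) * (z_el * z_el) + (z_el * z_el - 1) - y_el * ((y_el * z_el + z_el * y_el) * z_el)"
    by (simp add: w_def scal_mult_left scal_mult_right scal_minus algebra_simps)
  also have "\<dots> \<in> J"
    by (intro J_diff J_add J_zz J_left J_right J_yy J_yz y_tens z_tens tensor_mult)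
  finally have "scal (1 / 4) (w * w - 1) \<in> J" by (rule J_scal)
  moreover have "idem * idem = scal (1 / 4) ((1 + w) * (1 + w))"
    by (simp add: e scal_mult_left scal_mult_right)
  moreover have "idem = scal (1 / 4) ((1 + w) + (1 + w))"
    by (simp only: scal_double e) simp
  moreover have "(1 + w) * (1 + w) - ((1 + w) + (1 + w)) = w * w - 1"
    by (simp add: algebra_simps)
  ultimately show ?thesis
    by (metis scal_diff)
qed

text \<open>Since y anticommutes with w = \<i>yz and squares to 1, conjugation by y turns (1 + w)/2
  into (1 - w)/2.\<close>

lemma idem_complement: "1 - idem - y_el * idem * y_el \<in> J"
proof -
  define w :: "'x option option tensors" where "w = scal \<i> (y_el * z_el)"
  have e: "idem = scal (1 / 2) (1 + w)" by (simp add: idem_def w_def)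
  have yw: "y_el * w + w * y_el = scal \<i> (y_el * (y_el * z_el + z_el * y_el))"
    by (simp add: w_def scal_mult_left scal_mult_right scal_add_right algebra_simps)
  have w: "w \<in> tens X2" unfolding w_def by (intro tensor_scal tensor_mult y_tens z_tens)
  have "scal (1 / 2) ((y_el * y_el - 1) * w - (y_el * y_el - 1) - y_el * (y_el * w + w * y_el)) \<in> J"
    unfolding yw by (intro J_scal J_diff J_left J_right J_yy J_yz y_tens w)
  also have "(y_el * y_el - 1) * w - (y_el * y_el - 1) - y_el * (y_el * w + w * y_el) =
      (1 + 1) - (1 + w) - y_el * (1 + w) * y_el"
    by (simp add: algebra_simps)
  also have "scal (1 / 2) \<dots> = 1 - idem - y_el * idem * y_el"
    by (simp only: e scal_diff scal_half_add scal_mult_left scal_mult_right)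
  finally show ?thesis .
qed

text \<open>The decomposition of the tensor 1, which starts the induction on words below. The
  squares of \<open>idem\<close> appear because the column unit and the row unit each bring one
  factor.\<close>

lemma idem_split: "1 - (idem * idem + y_el * idem * (idem * y_el)) \<in> J"
proof -
  have "(1 - idem - y_el * idem * y_el) - (idem * idem - idem) - y_el * ((idem * idem - idem) * y_el) \<in> J"
    by (intro J_diff J_left J_right idem_complement idem_idem y_tens)
  then show ?thesis by (simp add: algebra_simps)
qed

text \<open>By induction on words: modulo \<open>J\<close>, left multiplication by a generator permutes the columns
  \<open>col_unit r\<close> up to the coefficients given by its matrix.\<close>

lemma matrix_decomposition:
  assumes "p \<in> tens X2"
  shows "p - (\<Sum>r\<in>{0, 1}. \<Sum>c\<in>{0, 1}. matrix_unit r c (entry r c p)) \<in> J"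
proof -
  \<comment> \<open>Row r of the matrix of p, assembled as a tensor. The sum over matrix units
    becomes \<open>\<Psi>\<close>, in which a letter to the left of p meets only the two columns
    \<open>idem\<close> and \<open>y_el * idem\<close>.\<close>
  define K where "K r p = emb2 (entry r 0 p) * row_unit 0 + emb2 (entry r 1 p) * row_unit 1"
    for r :: bit and p :: "'x option option tensors"
  define \<Psi> where "\<Psi> p = idem * K 0 p + y_el * (idem * K 1 p)" for p :: "'x option option tensors"
  have \<Psi>: "(\<Sum>r\<in>{0, 1}. \<Sum>c\<in>{0, 1}. matrix_unit r c (entry r c p)) = \<Psi> p" for p
    by (simp add: \<Psi>_def K_def matrix_unit_def col_unit_def algebra_simps)
  have Kadd: "K r (p + q) = K r p + K r q" for r p q
    by (simp add: K_def entry_add emb_add algebra_simps)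
  have Kscal: "K r (scal d p) = scal d (K r p)" for r d p
    by (simp add: K_def entry_scal emb_scal scal_mult_left scal_add_right)
  have K_tens: "K r p \<in> tens X2" if "p \<in> tens X2" for r p
    unfolding K_def by (intro tensor_add tensor_mult emb_tens entry_tens that row_unit_tens)
  have "p - \<Psi> p \<in> J"
    using assms unfolding tensor_carrier[of p]
  proof (induction rule: tensor_induct)
    case zero
    show ?case by (simp add: \<Psi>_def K_def Jc(1))
  next
    case (add p q)
    have "(p + q) - \<Psi> (p + q) = (p - \<Psi> p) + (q - \<Psi> q)"
      by (simp add: \<Psi>_def Kadd algebra_simps)
    then show ?case using J_add[OF add] by (simp only:)
  next
    case (single w d)
    have word: "set xs \<subseteq> X2 \<Longrightarrow> Poly_Mapping.single (Word xs) 1 - \<Psi> (Poly_Mapping.single (Word xs) 1) \<in> J" for xs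
    proof (induction xs)
      case Nil
      have 1: "Poly_Mapping.single (Word []) 1 = (1 :: 'x option option tensors)"
        by (simp add: zero_word_def[symmetric])
      show ?case
        unfolding 1 using idem_split by (simp add: \<Psi>_def K_def entry_1 row_unit_def mult.assoc)
    next
      case (Cons a xs)
      define q where "q = (Poly_Mapping.single (Word xs) 1 :: 'x option option tensors)"
      have aq: "Poly_Mapping.single (Word (a # xs)) 1 = gen a * q" by (simp add: q_def gen_single)
      have IH: "q - \<Psi> q \<in> J" using Cons by (simp add: q_def)
      have q: "q \<in> tens X2" using Cons.prems by (simp add: q_def)
      note Kq = K_tens[OF q]
      consider "a = None" | "a = Some None" | x where "a = Some (Some x)" "x \<in> X"
        using Cons.prems by (cases a) (auto simp: ext_basis_def)
      then show ?case
      proof cases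
        case 1
        have K: "K 0 (z_el * q) = scal \<i> (K 1 q)" "K 1 (z_el * q) = - scal \<i> (K 0 q)"
          by (simp_all add: K_def entry_mult entry_z scal_mult_left scal_minus emb_scal emb_diff scal_add_right
              emb_uminus)
        \<comment> \<open>In the first column z \<open>idem\<close> is replaced by -\<i> y
          \<open>idem\<close>; in the second z is moved past y, then replaced likewise, and y^2 is
          cancelled.\<close>
        have "z_el * q - \<Psi> (z_el * q) = z_el * (q - \<Psi> q) + (z_el * idem + scal \<i> (y_el * idem)) * K 0 q
          + ((y_el * z_el + z_el * y_el) * (idem * K 1 q) - y_el * ((z_el * idem + scal \<i> (y_el * idem)) * K 1 q)
            + scal \<i> ((y_el * y_el - 1) * (idem * K 1 q)))"
          by (simp add: \<Psi>_def K scal_mult_left scal_mult_right scal_diff algebra_simps)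
        also have "\<dots> \<in> J"
          by (intro J_add J_diff J_left[OF IH] J_right[OF z_idem] J_right[OF J_yz] J_left J_scal
              J_right[OF J_yy] Kq tensor_mult idem_tens y_tens z_tens)
        finally show ?thesis unfolding aq unfolding 1 .
      next
        case 2
        have K: "K 0 (y_el * q) = K 1 q" "K 1 (y_el * q) = K 0 q"
          by (simp_all add: K_def entry_mult entry_y)
        have "y_el * q - \<Psi> (y_el * q) = y_el * (q - \<Psi> q) + (y_el * y_el - 1) * (idem * K 1 q)"
          by (simp add: \<Psi>_def K algebra_simps)
        also have "\<dots> \<in> J"
          by (intro J_add J_left[OF IH] J_right[OF J_yy] Kq tensor_mult idem_tens y_tens)
        finally show ?thesis unfolding aq unfolding 2 .
      next
        case 3
        let ?x = "gen (Some (Some x))"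
        have K: "K 0 (?x * q) = ?x * K 0 q" "K 1 (?x * q) = - (?x * K 1 q)"
          by (simp_all add: K_def entry_mult entry_x emb_mult emb_diff emb_uminus algebra_simps)
        \<comment> \<open>The letter x commutes with \<open>idem\<close>, and passing y in the
          second column produces the sign that its matrix has in row 1.\<close>
        have "?x * q - \<Psi> (?x * q) = ?x * (q - \<Psi> q) + (?x * idem - idem * ?x) * K 0 q
          + ((?x * y_el + y_el * ?x) * (idem * K 1 q) - y_el * ((?x * idem - idem * ?x) * K 1 q))"
          by (simp add: \<Psi>_def K algebra_simps)
        also have "\<dots> \<in> J"
          by (intro J_add J_diff J_left[OF IH] J_right[OF x_idem] J_right[OF J_xy] J_left
              Kq tensor_mult idem_tens y_tens x_tens 3)
        finally show ?thesis unfolding aq unfolding 3(1) .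
      qed
    qed
    define m where "m = (Poly_Mapping.single w 1 :: 'x option option tensors)"
    have "m - \<Psi> m \<in> J" using word[of "letters w"] single by (simp add: m_def)
    then have "scal d (m - \<Psi> m) \<in> J" by (rule J_scal)
    moreover have "scal d (m - \<Psi> m) = scal d m - \<Psi> (scal d m)"
      by (simp add: \<Psi>_def Kscal scal_diff scal_add_right scal_mult_right)
    moreover have "scal d m = Poly_Mapping.single w d" by (simp add: m_def scal_single)
    ultimately show ?case by simp
  qed
  then show ?thesis by (simp only: \<Psi>)
qed

section \<open>Passage to the quotients\<close>

definition rep where "rep C = (SOME p. p \<in> tens X \<and> cl p = C)"
definition rep2 where "rep2 C = (SOME p. p \<in> tens X2 \<and> cl2 p = C)"

lemma rep: "p \<in> tens X \<Longrightarrow> rep (cl p) \<in> tens X \<and> cl (rep (cl p)) = cl p"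
  unfolding rep_def by (rule someI[of _ p]) simp

lemma rep2: "p \<in> tens X2 \<Longrightarrow> rep2 (cl2 p) \<in> tens X2 \<and> cl2 (rep2 (cl2 p)) = cl2 p"
  unfolding rep2_def by (rule someI[of _ p]) simp

definition \<phi> where "\<phi> r c C = cl (entry r c (rep2 C))"
definition \<psi> where "\<psi> r c C = cl2 (matrix_unit r c (rep C))"

lemma matrix_unit_tens: "p \<in> tens X \<Longrightarrow> matrix_unit r c p \<in> tens X2"
  unfolding matrix_unit_def by (intro tensor_mult emb_tens col_unit_tens row_unit_tens)

text \<open>Independence of the chosen representative is \<open>entry_J\<close>.\<close>

lemma \<phi>_cl2:
  assumes "p \<in> tens X2" shows "\<phi> r c (cl2 p) = cl (entry r c p)"
proof -
  have "rep2 (cl2 p) - p \<in> J"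
    using rep2[OF assms] B2.cl_eq[of "rep2 (cl2 p)" p] assms by simp
  then have "entry r c (rep2 (cl2 p)) - entry r c p \<in> I"
    using entry_J[of "rep2 (cl2 p) - p"] by (simp add: entry_diff)
  then show ?thesis
    unfolding \<phi>_def by (subst B.cl_eq) (simp_all add: entry_tens rep2[OF assms] assms)
qed

lemma matrix_unit_J: "p \<in> I \<Longrightarrow> matrix_unit r c p \<in> J"
  unfolding matrix_unit_def by (intro J_right[OF J_left] emb2_J col_unit_tens row_unit_tens)

text \<open>Two representatives differ by an element of I, which \<open>matrix_unit\<close> carries
  into J because \<open>emb2\<close> does.\<close>

lemma \<psi>_cl:
  assumes "p \<in> tens X" shows "\<psi> r c (cl p) = cl2 (matrix_unit r c p)"
proof -
  have "rep (cl p) - p \<in> I"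
    using rep[OF assms] B.cl_eq[of "rep (cl p)" p] assms by simp
  then have "matrix_unit r c (rep (cl p)) - matrix_unit r c p \<in> J"
    using matrix_unit_J[of "rep (cl p) - p"] by (simp add: matrix_unit_diff)
  then show ?thesis
    unfolding \<psi>_def by (subst B2.cl_eq) (simp_all add: matrix_unit_tens rep[OF assms] assms)
qed

lemma B_carrierE:
  assumes "C \<in> carrier B" obtains p where "p \<in> tens X" "C = cl p"
  using assms by (auto simp: B.Q_carrier)

lemma B2_carrierE:
  assumes "C \<in> carrier B2" obtains p where "p \<in> tens X2" "C = cl2 p"
  using assms by (auto simp: B2.Q_carrier)

lemma cl_closed: "p \<in> tens X \<Longrightarrow> cl p \<in> carrier B" and cl2_closed: "q \<in> tens X2 \<Longrightarrow> cl2 q \<in> carrier B2"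
  by (auto simp: B.Q_carrier B2.Q_carrier)

lemma matrix_unit_homog:
  assumes "p \<in> homog (tensor_algebra X) (g :: bit)"
  shows "matrix_unit r c p \<in> homog (tensor_algebra X2) (g + r + c)"
proof -
  have y: "y_el \<in> homog (tensor_algebra X2) (1 :: bit)" and z: "z_el \<in> homog (tensor_algebra X2) (1 :: bit)"
    unfolding gen_def by (auto simp: ext_basis_def intro!: homog_tensor_single)
  have e: "idem \<in> homog (tensor_algebra X2) (0 :: bit)"
    unfolding idem_def
    using homog_tensor_mult[OF y z] by (intro homog_tensor_scal homog_tensor_add homog_tensor_1) simp
  have col: "col_unit r \<in> homog (tensor_algebra X2) r" and row: "row_unit c \<in> homog (tensor_algebra X2) c"
    using e homog_tensor_mult[OF y e] homog_tensor_mult[OF e y]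
    by (cases r rule: bit_cases; cases c rule: bit_cases; simp add: col_unit_def row_unit_def)+
  show ?thesis
    using homog_tensor_mult[OF homog_tensor_mult[OF col emb_homog[OF emb_homog[OF assms]]] row]
    by (simp add: matrix_unit_def ac_simps)
qed

text \<open>Addition, multiplication, degrees and the values on matrix units descend from identities
  for tensors. Injectivity is different: it rests on \<open>matrix_decomposition\<close>, by which a
  tensor with all entries in I lies in J.\<close>

lemma z2_matrix_iso: "z2_matrix_iso B B2 \<phi> \<psi>"
proof (intro z2_matrix_iso.intro z2_matrix_iso_axioms.intro B.Q_ring B2.Q_ring)
  have hB: "homog B g = cl ` homog (tensor_algebra X) g" for g by (simp add: B.Q_homog T_def)
  have hB2: "homog B2 g = cl2 ` homog (tensor_algebra X2) g" for g by (simp add: B2.Q_homog T2_def)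
  show "homog B g \<subseteq> carrier B" for g
    unfolding hB using homog_tensor_subset cl_closed by blast
  show "homog B2 g \<subseteq> carrier B2" for g
    unfolding hB2 using homog_tensor_subset cl2_closed by blast
  show "\<one>\<^bsub>B\<^esub> \<in> homog B 0"
    unfolding hB B.Q_one using homog_tensor_1 by blast
  show "\<phi> r c C \<in> carrier B" if "C \<in> carrier B2" for r c C
    using that by (elim B2_carrierE) (simp add: \<phi>_cl2 cl_closed entry_tens)
  show "\<phi> r c (C \<oplus>\<^bsub>B2\<^esub> D) = \<phi> r c C \<oplus>\<^bsub>B\<^esub> \<phi> r c D" if "C \<in> carrier B2" "D \<in> carrier B2" for r c C D
    using that by (elim B2_carrierE) (simp add: \<phi>_cl2 entry_tens entry_add B.Q_add B2.Q_add)
  show "\<phi> r c (C \<otimes>\<^bsub>B2\<^esub> D) = \<phi> r 0 C \<otimes>\<^bsub>B\<^esub> \<phi> 0 c D \<oplus>\<^bsub>B\<^esub> \<phi> r 1 C \<otimes>\<^bsub>B\<^esub> \<phi> 1 c D"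
    if "C \<in> carrier B2" "D \<in> carrier B2" for r c C D
    using that by (elim B2_carrierE) (simp add: \<phi>_cl2 entry_tens entry_mult B.Q_add B.Q_mult B2.Q_mult)
  show "\<phi> r c \<one>\<^bsub>B2\<^esub> = (if r = c then \<one>\<^bsub>B\<^esub> else \<zero>\<^bsub>B\<^esub>)" for r c
    by (simp add: B2.Q_one B.Q_one B.Q_zero \<phi>_cl2 entry_1)
  show "\<phi> r c C \<in> homog B (g + r + c)" if C: "C \<in> homog B2 g" for C g r c
  proof -
    obtain p where p: "p \<in> homog (tensor_algebra X2) g" "C = cl2 p" using C unfolding hB2 by blast
    then have "p \<in> tens X2" using homog_tensor_subset by blast
    then show ?thesis unfolding hB p(2) using entry_homog[OF p(1)] by (simp add: \<phi>_cl2)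
  qed
  show "\<psi> r c C \<in> carrier B2" if "C \<in> carrier B" for C r c
    using that by (elim B_carrierE) (simp add: \<psi>_cl cl2_closed matrix_unit_tens)
  show "\<psi> r c C \<in> homog B2 (g + r + c)" if C: "C \<in> homog B g" for C g r c
  proof -
    obtain p where p: "p \<in> homog (tensor_algebra X) g" "C = cl p" using C unfolding hB by blast
    then have "p \<in> tens X" using homog_tensor_subset by blast
    then show ?thesis unfolding hB2 p(2) using matrix_unit_homog[OF p(1)] by (simp add: \<psi>_cl)
  qed
  show "\<phi> r c (\<psi> r' c' C) = (if r = r' \<and> c = c' then C else \<zero>\<^bsub>B\<^esub>)" if "C \<in> carrier B" for r c r' c' C
    using that by (elim B_carrierE) (auto simp: \<psi>_cl \<phi>_cl2 matrix_unit_tens entry_matrix_unit B.Q_zero)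
  show "C = D" if C: "C \<in> carrier B2" and D: "D \<in> carrier B2" and eq: "\<And>r c. \<phi> r c C = \<phi> r c D" for C D
  proof -
    obtain p where p: "p \<in> tens X2" "C = cl2 p" by (rule B2_carrierE[OF C])
    obtain q where q: "q \<in> tens X2" "D = cl2 q" by (rule B2_carrierE[OF D])
    have "entry r c (p - q) \<in> I" for r c
      using eq[of r c] B.cl_eq[of "entry r c p" "entry r c q"] p q by (simp add: \<phi>_cl2 entry_tens entry_diff)
    then have "(\<Sum>r\<in>{0, 1}. \<Sum>c\<in>{0, 1}. matrix_unit r c (entry r c (p - q))) \<in> J"
      by (simp add: J_add matrix_unit_J)
    from J_add[OF matrix_decomposition[OF tensor_diff[OF p(1) q(1)]] this]
    have "p - q \<in> J" by simp
    then show ?thesis using p q B2.cl_eq[of p q] by simp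
  qed
qed

end

theorem proposition0p3:
  fixes X :: "'x set" and R :: "'x tensors set" and \<theta> :: "'x tensors \<Rightarrow> complex"
    and u :: "complex \<Rightarrow> 'u"
  assumes "koszul_frobenius X R"
    and "clifford_map X R \<theta>"
    and "inj u"
  shows "abelian_equivalent
    (gr_cat (clifford_deformation
        (ext_basis (ext_basis X))
        (ext_rel (ext_basis X) (ext_rel X R))
        (ext_map (ext_basis X) (ext_rel X R) (ext_map X R \<theta>)))
      :: ((bit, 'x option option tensors set, 'u) graded, 'u \<Rightarrow> 'u) precat)
    (gr_cat (clifford_deformation X R \<theta>)
      :: ((bit, 'x tensors set, 'u) graded, 'u \<Rightarrow> 'u) precat)"
proof -
  have qd: "quadratic_data X R" and fd: "finite_dimensional (quadratic_algebra X R)"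
    using assms(1) by (simp_all add: koszul_frobenius_def)
  have "0 \<in> R" using qd by (simp add: quadratic_data_def)
  \<comment> \<open>Linearity gives \<theta>(0) = 0, so that relations with r = 0 carry no constant
    from \<theta>.\<close>
  then have "\<theta> (0 + 0) = \<theta> 0 + \<theta> 0"
    using assms(2) unfolding clifford_map_def by blast
  then interpret double_extension X R \<theta>
    by unfold_locales (simp_all add: qd)
  \<comment> \<open>A type into which the complex numbers embed is infinite, hence in bijection with
    its square; this provides the encoding of pairs.\<close>
  have "infinite (UNIV :: 'u set)"
    using assms(3) infinite_UNIV_char_0 finite_imageD finite_subset[OF subset_UNIV[of "range u"]] by blast
  then have "\<exists>j. bij_betw j ((UNIV :: 'u set) \<times> (UNIV :: 'u set)) (UNIV :: 'u set)"
    unfolding card_of_ordIso by (rule card_of_Times_same_infinite)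
  then obtain j :: "'u \<times> 'u \<Rightarrow> 'u" where j: "inj j"
    by (auto simp: bij_betw_def)
  interpret z2_morita B B2 \<phi> \<psi> j
    by (intro z2_morita.intro z2_matrix_iso z2_morita_axioms.intro j)
      (simp add: B_def submodules_fg_clifford_deformation[OF qd fd])
  show ?thesis
    using abelian_equivalent_gr_cat unfolding B_def B2_def .
qed

end
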